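(* Let $n\ge 0$ be an integer and let $S=\{s_1,\dots,s_{n-1}\}$, $E=\{e_1,\dots,e_n\}$, $Q=\{q_1,\dots,q_{n-1}\}$, $O=\{o_1,\dots,o_n\}$ be alphabets. Let $\Psi:(S\cup E\cup Q\cup O)^*\to\mathcal{RP}_n$ be the monoid homomorphism determined by $s_i\mapsto\overline s_i$, $e_i\mapsto\overline e_i$, $q_i\mapsto\overline q_i$, $o_i\mapsto\overline o_i$. Then the rook partition monoid $\mathcal{RP}_n$ has monoid presentation $\langle S\cup E\cup Q\cup O: R\rangle$ via $\Psi$, where $R$ consists of the following relations (subscripts ranging over all values for which the letters are defined): $s_i^2=1$ for all $i$; $s_is_j=s_js_i$ if $|i-j|>1$; $s_is_js_i=s_js_is_j$ if $|i-j|=1$; $e_i^2=e_i$ for all $i$; $e_ie_j=e_je_i$ for distinct $i,j$; $s_ie_j=e_js_i$ if $j\notin\{i,i+1\}$; $s_ie_i=e_{i+1}s_i$ for all $i$; $e_ie_{i+1}s_i=e_ie_{i+1}$ for all $i$; $q_i^2=q_i$ for all $i$; $q_iq_j=q_jq_i$ for distinct $i,j$; $s_iq_j=q_js_i$ if $|i-j|>1$; $s_is_jq_i=q_js_is_j$ if $|i-j|=1$; $q_is_i=s_iq_i=q_i$ for all $i$; $q_ie_j=e_jq_i$ if $j\notin\{i,i+1\}$; $q_ie_jq_i=q_i$ if $j\in\{i,i+1\}$; $e_jq_ie_j=e_j$ if $j\in\{i,i+1\}$; $o_i^2=o_i$ for all $i$; $o_io_j=o_jo_i$ for distinct $i,j$;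 $s_io_j=o_js_i$ if $j\notin\{i,i+1\}$; $s_io_i=o_{i+1}s_i$ for all $i$; $o_io_{i+1}s_i=o_io_{i+1}$ for all $i$; $o_ie_j=e_jo_i$ for distinct $i,j$; $o_ie_io_i=o_i$ for all $i$; $e_io_ie_i=e_i$ for all $i$; $q_io_j=o_jq_i$ for all $i,j$; $q_io_i=q_io_{i+1}=o_io_{i+1}$ for all $i$.
   Context: Write $[n]=\{1,\dots,n\}$, $[n]'=\{1',\dots,n'\}$, $[n]''=\{1'',\dots,n''\}$. A rook partition of degree $n$ is a collection of pairwise disjoint non-empty subsets (called blocks) of $[n]\cup[n]'$; elements of $[n]\cup[n]'$ lying in no block are its rook dots. $\mathcal{RP}_n$ is the set of all rook partitions of degree $n$. Product: for $\alpha,\beta\in\mathcal{RP}_n$, relabel each $i'$ of $\alpha$ as $i''$ to get $\alpha_\vee$, and relabel each $i$ of $\beta$ as $i''$ to get $\beta^\wedge$. Let $\Gamma(\alpha,\beta)$ be the graph on $[n]\cup[n]'\cup[n]''$ in which two vertices are adjacent if they lie in a common block of $\alpha_\vee$ or a common block of $\beta^\wedge$; a vertex is white if it is a rook dot of $\alpha_\vee$ or of $\beta^\wedge$, and black otherwise. Then $\alpha\beta$ is the rook partition such that $x\in[n]\cup[n]'$ is a rook dot of $\alpha\beta$ iff $x$ is connected by a (possibly empty) path to a white vertex in $\Gamma(\alpha,\beta)$, and two elements of $[n]\cup[n]'$ that are not rook dots of $\alpha\beta$ are in the same block iff they are connected by a path in $\Gamma(\alpha,\beta)$. This makes $\mathcal{RP}_n$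 a monoid with identity $\{\{1,1'\},\dots,\{n,n'\}\}$. Elements: $\overline s_i$ has blocks $\{i,(i+1)'\},\{i+1,i'\}$ and $\{j,j'\}$ for $j\notin\{i,i+1\}$; $\overline e_i$ has blocks $\{i\},\{i'\}$ and $\{j,j'\}$ for $j\ne i$; $\overline q_i$ has blocks $\{i,i+1,i',(i+1)'\}$ and $\{j,j'\}$ for $j\notin\{i,i+1\}$; $\overline o_i$ has blocks $\{j,j'\}$ for $j\neq i$ and rook dots $i,i'$. $X^*$ is the free monoid on $X$, with empty word $1$. A monoid $M$ has monoid presentation $\langle X:R\rangle$ via $\phi$ if $\phi:X^*\to M$ is a surjective monoid homomorphism whose kernel $\{(u,v):u\phi=v\phi\}$ is the congruence on $X^*$ generated by $R$. *)

theory Defs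
  imports HOL.Hull "HOL-Algebra.Group" "HOL-Library.Disjoint_Sets"
begin

text \<open>\<open>Upper i\<close>, \<open>Lower i\<close> and \<open>Middle i\<close> stand for \<open>i\<close>, \<open>i'\<close> and \<open>i''\<close>.
  A rook partition is represented by its set of blocks, so its rook dots are the points
  not covered by that set and depend on the degree \<open>n\<close>.\<close>

datatype vertex = Upper nat | Lower nat | Middle nat

definition points :: "nat \<Rightarrow> vertex set" where
  "points n = Upper ` {1..n} \<union> Lower ` {1..n}"

definition rook_partitions :: "nat \<Rightarrow> vertex set set set" where
  "rook_partitions n = {\<alpha>. disjoint \<alpha> \<and> {} \<notin> \<alpha> \<and> \<Union>\<alpha> \<subseteq> points n}"

definition rook_dots :: "nat \<Rightarrow> vertex set set \<Rightarrow> vertex set" where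
  "rook_dots n \<alpha> = points n - \<Union>\<alpha>"

fun lower_to_middle :: "vertex \<Rightarrow> vertex" where
  "lower_to_middle (Lower i) = Middle i"
| "lower_to_middle v = v"

fun upper_to_middle :: "vertex \<Rightarrow> vertex" where
  "upper_to_middle (Upper i) = Middle i"
| "upper_to_middle v = v"

text \<open>The edges of \<open>\<Gamma>(\<alpha>,\<beta>)\<close>, as a symmetric relation. Every vertex lying in a block
  also gets a loop, which has no effect on connectedness.\<close>

definition product_edges :: "vertex set set \<Rightarrow> vertex set set \<Rightarrow> (vertex \<times> vertex) set" where
  "product_edges \<alpha> \<beta> =
     {(u, v). \<exists>B \<in> (`) lower_to_middle ` \<alpha> \<union> (`) upper_to_middle ` \<beta>. u \<in> B \<and> v \<in> B}"

definition white :: "nat \<Rightarrow> vertex set set \<Rightarrow> vertex set set \<Rightarrow> vertex set" where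
  "white n \<alpha> \<beta> = lower_to_middle ` rook_dots n \<alpha> \<union> upper_to_middle ` rook_dots n \<beta>"

definition product_dots :: "nat \<Rightarrow> vertex set set \<Rightarrow> vertex set set \<Rightarrow> vertex set" where
  "product_dots n \<alpha> \<beta> =
     {x \<in> points n. \<exists>w \<in> white n \<alpha> \<beta>. (x, w) \<in> (product_edges \<alpha> \<beta>)\<^sup>*}"

definition rook_product :: "nat \<Rightarrow> vertex set set \<Rightarrow> vertex set set \<Rightarrow> vertex set set" where
  "rook_product n \<alpha> \<beta> =
     (\<lambda>x. {y \<in> points n - product_dots n \<alpha> \<beta>. (x, y) \<in> (product_edges \<alpha> \<beta>)\<^sup>*})
       ` (points n - product_dots n \<alpha> \<beta>)"

definition strand :: "nat \<Rightarrow> vertex set" where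
  "strand j = {Upper j, Lower j}"

definition rook_partition_monoid :: "nat \<Rightarrow> vertex set set monoid" where
  "rook_partition_monoid n =
     \<lparr>carrier = rook_partitions n, mult = rook_product n, one = strand ` {1..n}\<rparr>"

definition free_monoid :: "'a set \<Rightarrow> 'a list monoid" where
  "free_monoid X = \<lparr>carrier = lists X, mult = (@), one = []\<rparr>"

definition monoid_congruence :: "('a, 'b) monoid_scheme \<Rightarrow> ('a \<times> 'a) set \<Rightarrow> bool" where
  "monoid_congruence M C \<longleftrightarrow> equiv (carrier M) C \<and>
     (\<forall>(a, b) \<in> C. \<forall>(c, d) \<in> C. (a \<otimes>\<^bsub>M\<^esub> c, b \<otimes>\<^bsub>M\<^esub> d) \<in> C)"

text \<open>Preservation of the unit is required separately, since \<^const>\<open>hom\<close> only demands that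
  products are preserved. The hull is the intersection of all congruences on the free monoid
  that contain \<open>R\<close>.\<close>

definition monoid_presentation ::
  "('m, 'b) monoid_scheme \<Rightarrow> 'a set \<Rightarrow> ('a list \<times> 'a list) set \<Rightarrow> ('a list \<Rightarrow> 'm) \<Rightarrow> bool" where
  "monoid_presentation M X R \<phi> \<longleftrightarrow>
     monoid M \<and>
     R \<subseteq> carrier (free_monoid X) \<times> carrier (free_monoid X) \<and>
     \<phi> \<in> hom (free_monoid X) M \<and> \<phi> \<one>\<^bsub>free_monoid X\<^esub> = \<one>\<^bsub>M\<^esub> \<and>
     \<phi> ` carrier (free_monoid X) = carrier M \<and>
     {(u, v). u \<in> carrier (free_monoid X) \<and> v \<in> carrier (free_monoid X) \<and> \<phi> u = \<phi> v} =
       monoid_congruence (free_monoid X) hull R"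

definition free_extension :: "('m, 'b) monoid_scheme \<Rightarrow> ('a \<Rightarrow> 'm) \<Rightarrow> 'a list \<Rightarrow> 'm" where
  "free_extension M f w = foldr (\<lambda>x m. f x \<otimes>\<^bsub>M\<^esub> m) w \<one>\<^bsub>M\<^esub>"

datatype letter = Ls nat | Le nat | Lq nat | Lo nat

definition alphabet :: "nat \<Rightarrow> letter set" where
  "alphabet n = Ls ` {1..<n} \<union> Le ` {1..n} \<union> Lq ` {1..<n} \<union> Lo ` {1..n}"

primrec generator :: "nat \<Rightarrow> letter \<Rightarrow> vertex set set" where
  "generator n (Ls i) =
     {{Upper i, Lower (i + 1)}, {Upper (i + 1), Lower i}} \<union> strand ` ({1..n} - {i, i + 1})"
| "generator n (Le i) = {{Upper i}, {Lower i}} \<union> strand ` ({1..n} - {i})"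
| "generator n (Lq i) =
     {{Upper i, Upper (i + 1), Lower i, Lower (i + 1)}} \<union> strand ` ({1..n} - {i, i + 1})"
| "generator n (Lo i) = strand ` ({1..n} - {i})"

definition Psi :: "nat \<Rightarrow> letter list \<Rightarrow> vertex set set" where
  "Psi n = free_extension (rook_partition_monoid n) (generator n)"

abbreviation (input) apart :: "nat \<Rightarrow> nat \<Rightarrow> bool" where
  "apart i j \<equiv> \<bar>int i - int j\<bar> > 1"

abbreviation (input) adjacent :: "nat \<Rightarrow> nat \<Rightarrow> bool" where
  "adjacent i j \<equiv> \<bar>int i - int j\<bar> = 1"

text \<open>Subscripts are unrestricted here; \<open>relations n\<close> below keeps exactly the relations all of
  whose letters are defined. A chain \<open>u = v = w\<close> is recorded as \<open>(u, v)\<close> and \<open>(v, w)\<close>.\<close>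

inductive_set all_relations :: "(letter list \<times> letter list) set" where
  ss: "([Ls i, Ls i], []) \<in> all_relations"
| ss_comm: "apart i j \<Longrightarrow> ([Ls i, Ls j], [Ls j, Ls i]) \<in> all_relations"
| ss_braid: "adjacent i j \<Longrightarrow> ([Ls i, Ls j, Ls i], [Ls j, Ls i, Ls j]) \<in> all_relations"
| ee: "([Le i, Le i], [Le i]) \<in> all_relations"
| ee_comm: "i \<noteq> j \<Longrightarrow> ([Le i, Le j], [Le j, Le i]) \<in> all_relations"
| se_comm: "j \<notin> {i, i + 1} \<Longrightarrow> ([Ls i, Le j], [Le j, Ls i]) \<in> all_relations"
| se: "([Ls i, Le i], [Le (i + 1), Ls i]) \<in> all_relations"
| ees: "([Le i, Le (i + 1), Ls i], [Le i, Le (i + 1)]) \<in> all_relations"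
| qq: "([Lq i, Lq i], [Lq i]) \<in> all_relations"
| qq_comm: "i \<noteq> j \<Longrightarrow> ([Lq i, Lq j], [Lq j, Lq i]) \<in> all_relations"
| sq_comm: "apart i j \<Longrightarrow> ([Ls i, Lq j], [Lq j, Ls i]) \<in> all_relations"
| ssq: "adjacent i j \<Longrightarrow> ([Ls i, Ls j, Lq i], [Lq j, Ls i, Ls j]) \<in> all_relations"
| qs1: "([Lq i, Ls i], [Ls i, Lq i]) \<in> all_relations"
| qs2: "([Ls i, Lq i], [Lq i]) \<in> all_relations"
| qe_comm: "j \<notin> {i, i + 1} \<Longrightarrow> ([Lq i, Le j], [Le j, Lq i]) \<in> all_relations"
| qeq: "j \<in> {i, i + 1} \<Longrightarrow> ([Lq i, Le j, Lq i], [Lq i]) \<in> all_relations"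
| eqe: "j \<in> {i, i + 1} \<Longrightarrow> ([Le j, Lq i, Le j], [Le j]) \<in> all_relations"
| oo: "([Lo i, Lo i], [Lo i]) \<in> all_relations"
| oo_comm: "i \<noteq> j \<Longrightarrow> ([Lo i, Lo j], [Lo j, Lo i]) \<in> all_relations"
| so_comm: "j \<notin> {i, i + 1} \<Longrightarrow> ([Ls i, Lo j], [Lo j, Ls i]) \<in> all_relations"
| so: "([Ls i, Lo i], [Lo (i + 1), Ls i]) \<in> all_relations"
| oos: "([Lo i, Lo (i + 1), Ls i], [Lo i, Lo (i + 1)]) \<in> all_relations"
| oe_comm: "i \<noteq> j \<Longrightarrow> ([Lo i, Le j], [Le j, Lo i]) \<in> all_relations"
| oeo: "([Lo i, Le i, Lo i], [Lo i]) \<in> all_relations"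
| eoe: "([Le i, Lo i, Le i], [Le i]) \<in> all_relations"
| qo_comm: "([Lq i, Lo j], [Lo j, Lq i]) \<in> all_relations"
| qo1: "([Lq i, Lo i], [Lq i, Lo (i + 1)]) \<in> all_relations"
| qo2: "([Lq i, Lo (i + 1)], [Lo i, Lo (i + 1)]) \<in> all_relations"

definition relations :: "nat \<Rightarrow> (letter list \<times> letter list) set" where
  "relations n = all_relations \<inter> lists (alphabet n) \<times> lists (alphabet n)"

end

theory Submission
  imports Defs "HOL-Combinatorics.Permutations"
begin

text \<open>
  A rook partition \<open>\<alpha>\<close> is determined by the relation between subsets \<open>X\<close> of the upper and \<open>Y\<close> of the
  lower row saying that \<open>X \<union> Y'\<close> is a union of blocks of \<open>\<alpha>\<close>, and products of rook partitions become
  compositions of relations. This makes associativity and the soundness of the relations immediate.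

  For completeness, think of the rook dots as lying in the block of an extra strand numbered \<open>0\<close>.
  Then \<open>o\<^sub>i\<close> plays the role of a letter \<open>q\<^bsub>0 i\<^esub>\<close>, and conjugating \<open>q\<^sub>1\<close> by words for permutations
  gives elements \<open>q\<^bsub>i j\<^esub>\<close> for all \<open>i, j \<le> n\<close> that generate a commutative monoid of equivalence relations
  on \<open>{0..n}\<close>. Every word is congruent to some \<open>Q\<^sub>k E\<^sub>A \<sigma> Q\<^sub>l\<close>, where \<open>Q\<^sub>k\<close> and \<open>Q\<^sub>l\<close> are products of
  such elements, \<open>E\<^sub>A\<close> is the product of the \<open>e\<^sub>i\<close> with \<open>i \<in> A\<close>, and \<open>\<sigma>\<close> is a permutation. Using
  \<open>q\<^bsub>i j\<^esub> = q\<^bsub>i j\<^esub> e\<^sub>j q\<^bsub>i j\<^esub>\<close>, the set \<open>A\<close> can be enlarged until every block is crossed by at most one strand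
  of \<open>\<sigma>\<close> outside \<open>A\<close>. The equivalence relations can then be read off the rook partition, and the
  remaining freedom in \<open>A\<close> and \<open>\<sigma>\<close> is absorbed by transpositions:
  \<open>q\<^bsub>i j\<^esub> (i j) = q\<^bsub>i j\<^esub>\<close> and \<open>e\<^sub>i e\<^sub>j (i j) = e\<^sub>i e\<^sub>j\<close>.
\<close>

section \<open>Rook partitions as relations between subsets\<close>

text \<open>Rook dots need no separate treatment in a composition: a union of blocks simply avoids
  them. The obstacle to completeness is that a factorisation is far from unique. A pair listed for
  the upper row is carried to the lower row by uncut strands, so the two equivalence relations need
  not be visible while two uncut strands share a class. The relation \<open>q e q = q\<close> cuts
  one of the two and records the pair in the other row. Once nothing is left to cut, the first
  components of the relation are exactly the closed sets of the upper row, and likewise below. The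
  class of 0 is no exception: a strand that meets it is cut as well, while 0 itself is never cut.
  The argument takes place in an arbitrary monoid that satisfies the relations and is fine enough to
  determine the relation of a word. The free monoid modulo the generated congruence is one, realised
  by its action on its own classes. As each rook partition has the relation of some normal form,
  normal forms settle surjectivity as well.\<close>

definition saturated :: "'a set set \<Rightarrow> 'a set \<Rightarrow> bool" where
  "saturated \<alpha> S \<longleftrightarrow> S \<subseteq> \<Union>\<alpha> \<and> (\<forall>B\<in>\<alpha>. B \<subseteq> S \<or> B \<inter> S = {})"

definition diag_rel :: "vertex set set \<Rightarrow> (nat set \<times> nat set) set" where
  "diag_rel \<alpha> = {(X, Y). saturated \<alpha> (Upper ` X \<union> Lower ` Y)}"

lemma points_split:
  assumes "S \<subseteq> points n"
  shows "S = Upper ` {i. Upper i \<in> S} \<union> Lower ` {i. Lower i \<in> S}"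
  using assms by (auto simp: points_def)

lemma saturated_block: "disjoint \<alpha> \<Longrightarrow> B \<in> \<alpha> \<Longrightarrow> saturated \<alpha> B"
  by (auto simp: saturated_def disjoint_def)

text \<open>The blocks are the minimal non-empty saturated sets. A block B of \<alpha> through a
  point x is a union of blocks of \<beta>, so it contains the block of \<beta> through x, and that
  block contains B by the same argument.\<close>

lemma subset_if_saturated_iff:
  assumes "disjoint \<alpha>" "{} \<notin> \<alpha>" "disjoint \<beta>"
    and eq: "\<And>S. saturated \<alpha> S = saturated \<beta> S"
  shows "\<alpha> \<subseteq> \<beta>"
proof
  fix B assume B: "B \<in> \<alpha>"
  then have sB: "saturated \<beta> B" using saturated_block[OF assms(1)] eq by blast
  obtain x where x: "x \<in> B" using B assms(2) by (metis ex_in_conv)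
  then obtain B' where B': "B' \<in> \<beta>" "x \<in> B'" using sB by (auto simp: saturated_def)
  then have "B' \<subseteq> B" using sB x by (auto simp: saturated_def)
  moreover have "saturated \<alpha> B'" using saturated_block[OF assms(3)] B' eq by blast
  then have "B \<subseteq> B'" using B B' x by (auto simp: saturated_def)
  ultimately show "B \<in> \<beta>" using B' by simp
qed

lemma saturated_subset_points: "\<alpha> \<in> rook_partitions n \<Longrightarrow> saturated \<alpha> S \<Longrightarrow> S \<subseteq> points n"
  unfolding saturated_def rook_partitions_def by (blast intro: order_trans)

lemma diag_rel_inject:
  assumes "\<alpha> \<in> rook_partitions n" "\<beta> \<in> rook_partitions n" "diag_rel \<alpha> = diag_rel \<beta>"
  shows "\<alpha> = \<beta>"
proof -
  have "saturated \<alpha> S = saturated \<beta> S" for S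
  proof (cases "S \<subseteq> points n")
    case True
    define X Y where "X = {i. Upper i \<in> S}" and "Y = {i. Lower i \<in> S}"
    have S: "S = Upper ` X \<union> Lower ` Y" unfolding X_def Y_def using points_split[OF True] .
    have "(X, Y) \<in> diag_rel \<alpha> \<longleftrightarrow> (X, Y) \<in> diag_rel \<beta>" using assms(3) by simp
    then show ?thesis by (simp add: S diag_rel_def)
  next
    case False
    then show ?thesis using saturated_subset_points assms(1,2) by metis
  qed
  then show ?thesis
    using assms(1,2) by (intro equalityI subset_if_saturated_iff) (auto simp: rook_partitions_def)
qed

lemma diag_rel_subset:
  assumes "\<alpha> \<in> rook_partitions n" "(X, Y) \<in> diag_rel \<alpha>"
  shows "X \<subseteq> {1..n}" "Y \<subseteq> {1..n}"
proof -
  have "Upper ` X \<union> Lower ` Y \<subseteq> points n"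
    using assms(2) unfolding diag_rel_def by (auto dest: saturated_subset_points[OF assms(1)])
  then show "X \<subseteq> {1..n}" "Y \<subseteq> {1..n}" by (auto simp: points_def)
qed

section \<open>The product as a composition of relations\<close>

lemma sym_product_edges: "sym (product_edges \<alpha> \<beta>)"
  by (auto simp: sym_def product_edges_def)

lemma sym_product_path: "(x, y) \<in> (product_edges \<alpha> \<beta>)\<^sup>* \<Longrightarrow> (y, x) \<in> (product_edges \<alpha> \<beta>)\<^sup>*"
  by (meson sym_product_edges sym_rtrancl symD)

lemma rook_product_closed: "rook_product n \<alpha> \<beta> \<in> rook_partitions n"
proof -
  let ?r = "(product_edges \<alpha> \<beta>)\<^sup>*"
  have "disjoint (rook_product n \<alpha> \<beta>)"
    unfolding disjoint_def
  proof (intro ballI impI)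
    fix B C assume BC: "B \<in> rook_product n \<alpha> \<beta>" "C \<in> rook_product n \<alpha> \<beta>" "B \<noteq> C"
    then obtain x y where
      x: "B = {z \<in> points n - product_dots n \<alpha> \<beta>. (x, z) \<in> ?r}" and
      y: "C = {z \<in> points n - product_dots n \<alpha> \<beta>. (y, z) \<in> ?r}"
      by (auto simp: rook_product_def)
    show "B \<inter> C = {}"
    proof (rule ccontr)
      assume "B \<inter> C \<noteq> {}"
      then obtain z where "(x, z) \<in> ?r" "(y, z) \<in> ?r" using x y by blast
      then have "(x, y) \<in> ?r" "(y, x) \<in> ?r" by (meson rtrancl_trans sym_product_path)+
      then have "B = C" unfolding x y by (meson rtrancl_trans)
      with BC show False by simp
    qed
  qed
  then show ?thesis by (auto simp: rook_partitions_def rook_product_def)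
qed

text \<open>Blocks of the product are traces of components of the graph on the points that are no
  rook dots, so saturation becomes closure under paths. The composition law is proved in this
  form.\<close>

lemma saturated_rook_product:
  "saturated (rook_product n \<alpha> \<beta>) S \<longleftrightarrow>
     S \<subseteq> points n - product_dots n \<alpha> \<beta> \<and>
     (\<forall>x\<in>S. \<forall>y\<in>points n - product_dots n \<alpha> \<beta>. (x, y) \<in> (product_edges \<alpha> \<beta>)\<^sup>* \<longrightarrow> y \<in> S)"
  (is "_ = (?A \<and> ?B)")
proof
  let ?r = "(product_edges \<alpha> \<beta>)\<^sup>*"
  assume s: "saturated (rook_product n \<alpha> \<beta>) S"
  then have A: ?A by (force simp: saturated_def rook_product_def)
  moreover have ?B
  proof (intro ballI impI)
    fix x y assume xy: "x \<in> S" "y \<in> points n - product_dots n \<alpha> \<beta>" "(x, y) \<in> ?r"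
    let ?C = "{z \<in> points n - product_dots n \<alpha> \<beta>. (x, z) \<in> ?r}"
    have "?C \<in> rook_product n \<alpha> \<beta>" using xy A by (auto simp: rook_product_def)
    then have "?C \<subseteq> S \<or> ?C \<inter> S = {}" using s by (simp add: saturated_def)
    moreover have xC: "x \<in> ?C" "y \<in> ?C" using xy A by auto
    ultimately have "?C \<subseteq> S" using xy(1) by blast
    then show "y \<in> S" using xC(2) by (rule subsetD)
  qed
  ultimately show "?A \<and> ?B" ..
next
  let ?r = "(product_edges \<alpha> \<beta>)\<^sup>*"
  assume AB: "?A \<and> ?B"
  show "saturated (rook_product n \<alpha> \<beta>) S"
    unfolding saturated_def
  proof (intro conjI ballI)
    show "S \<subseteq> \<Union> (rook_product n \<alpha> \<beta>)" using AB by (auto simp: rook_product_def)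
  next
    fix B assume "B \<in> rook_product n \<alpha> \<beta>"
    then obtain x where B: "B = {z \<in> points n - product_dots n \<alpha> \<beta>. (x, z) \<in> ?r}"
      by (auto simp: rook_product_def)
    show "B \<subseteq> S \<or> B \<inter> S = {}"
    proof (rule disjCI)
      assume "B \<inter> S \<noteq> {}"
      then obtain z where z: "z \<in> S" "(z, x) \<in> ?r" using B sym_product_path by blast
      show "B \<subseteq> S"
      proof
        fix y assume y: "y \<in> B"
        then have "(z, y) \<in> ?r" using z B by (auto intro: rtrancl_trans)
        then show "y \<in> S" using AB z y B by auto
      qed
    qed
  qed
qed

text \<open>From left to right, take the components of the graph that meet the given set: they
  contain no white vertex, and their middle vertices form the intermediate set. Conversely, the sets
  X, Y and Z glue to a set closed under edges, because each edge comes from a single factor.\<close>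

lemma diag_rel_rook_product:
  assumes \<alpha>: "\<alpha> \<in> rook_partitions n" and \<beta>: "\<beta> \<in> rook_partitions n"
  shows "diag_rel (rook_product n \<alpha> \<beta>) = diag_rel \<alpha> O diag_rel \<beta>"
proof (intro equalityI subrelI)
  let ?r = "product_edges \<alpha> \<beta>"
  have \<alpha>p: "B \<subseteq> points n" if "B \<in> \<alpha>" for B using \<alpha> that unfolding rook_partitions_def by blast
  have \<beta>p: "B \<subseteq> points n" if "B \<in> \<beta>" for B using \<beta> that unfolding rook_partitions_def by blast
  have edge\<alpha>: "(lower_to_middle x, lower_to_middle y) \<in> ?r" if "x \<in> B" "y \<in> B" "B \<in> \<alpha>" for x y B
    using that by (auto simp: product_edges_def)
  have edge\<beta>: "(upper_to_middle x, upper_to_middle y) \<in> ?r" if "x \<in> B" "y \<in> B" "B \<in> \<beta>" for x y B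
    using that by (auto simp: product_edges_def)
  {
    fix X Z assume "(X, Z) \<in> diag_rel (rook_product n \<alpha> \<beta>)"
    then have sat: "saturated (rook_product n \<alpha> \<beta>) (Upper ` X \<union> Lower ` Z)"
      by (simp add: diag_rel_def)
    define S where "S = Upper ` X \<union> Lower ` Z"
    define T where "T = ?r\<^sup>* `` S"
    have S: "S \<subseteq> points n - product_dots n \<alpha> \<beta>"
      and closed: "\<And>x y. x \<in> S \<Longrightarrow> y \<in> points n - product_dots n \<alpha> \<beta> \<Longrightarrow> (x, y) \<in> ?r\<^sup>* \<Longrightarrow> y \<in> S"
      using sat unfolding saturated_rook_product S_def by blast+
    have nw: "w \<notin> T" if "w \<in> white n \<alpha> \<beta>" for w
      using that S by (auto simp: T_def product_dots_def)
    \<comment> \<open>A further outer point of \<open>T\<close> is connected to a point of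
      \<open>S\<close>, so it is no rook dot of the product either, and then it belongs to
      \<open>S\<close> by saturation.\<close>
    have TS: "T \<inter> points n = S"
    proof
      show "S \<subseteq> T \<inter> points n" using S by (auto simp: T_def)
      show "T \<inter> points n \<subseteq> S"
      proof
        fix y assume y: "y \<in> T \<inter> points n"
        then obtain x where x: "x \<in> S" "(x, y) \<in> ?r\<^sup>*" by (auto simp: T_def)
        have "y \<notin> product_dots n \<alpha> \<beta>"
          using S x by (auto simp: product_dots_def intro: rtrancl_trans)
        then show "y \<in> S" using closed x y by blast
      qed
    qed
    have TS': "x \<in> T \<longleftrightarrow> x \<in> S" if "x \<in> points n" for x
      using TS that by blast
    have step: "y \<in> T" if "x \<in> T" "(x, y) \<in> ?r" for x y
      using that by (auto simp: T_def intro: rtrancl_into_rtrancl)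
    define Y where "Y = {i \<in> {1..n}. Middle i \<in> T}"
    have mem\<alpha>: "x \<in> Upper ` X \<union> Lower ` Y \<longleftrightarrow> lower_to_middle x \<in> T" if "x \<in> points n" for x
      using that TS'[OF that] by (cases x) (auto simp: points_def Y_def S_def image_iff)
    have mem\<beta>: "x \<in> Upper ` Y \<union> Lower ` Z \<longleftrightarrow> upper_to_middle x \<in> T" if "x \<in> points n" for x
      using that TS'[OF that] by (cases x) (auto simp: points_def Y_def S_def image_iff)
    have "saturated \<alpha> (Upper ` X \<union> Lower ` Y)"
      unfolding saturated_def
    proof (intro conjI ballI)
      have XY: "Upper ` X \<union> Lower ` Y \<subseteq> points n"
        using S by (auto simp: S_def Y_def points_def)
      show "Upper ` X \<union> Lower ` Y \<subseteq> \<Union>\<alpha>"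
      proof (rule subsetI, rule ccontr)
        fix x assume x: "x \<in> Upper ` X \<union> Lower ` Y" "x \<notin> \<Union>\<alpha>"
        then have "x \<in> rook_dots n \<alpha>" using XY by (auto simp: rook_dots_def)
        then have "lower_to_middle x \<in> white n \<alpha> \<beta>" by (auto simp: white_def)
        then show False using nw x(1) mem\<alpha> XY by blast
      qed
    next
      fix B assume B: "B \<in> \<alpha>"
      show "B \<subseteq> Upper ` X \<union> Lower ` Y \<or> B \<inter> (Upper ` X \<union> Lower ` Y) = {}"
        using \<alpha>p[OF B] mem\<alpha> step edge\<alpha>[OF _ _ B] by blast
    qed
    moreover have "saturated \<beta> (Upper ` Y \<union> Lower ` Z)"
      unfolding saturated_def
    proof (intro conjI ballI)
      have YZ: "Upper ` Y \<union> Lower ` Z \<subseteq> points n"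
        using S by (auto simp: S_def Y_def points_def)
      show "Upper ` Y \<union> Lower ` Z \<subseteq> \<Union>\<beta>"
      proof (rule subsetI, rule ccontr)
        fix x assume x: "x \<in> Upper ` Y \<union> Lower ` Z" "x \<notin> \<Union>\<beta>"
        then have "x \<in> rook_dots n \<beta>" using YZ by (auto simp: rook_dots_def)
        then have "upper_to_middle x \<in> white n \<alpha> \<beta>" by (auto simp: white_def)
        then show False using nw x(1) mem\<beta> YZ by blast
      qed
    next
      fix B assume B: "B \<in> \<beta>"
      show "B \<subseteq> Upper ` Y \<union> Lower ` Z \<or> B \<inter> (Upper ` Y \<union> Lower ` Z) = {}"
        using \<beta>p[OF B] mem\<beta> step edge\<beta>[OF _ _ B] by blast
    qed
    ultimately show "(X, Z) \<in> diag_rel \<alpha> O diag_rel \<beta>" by (auto simp: diag_rel_def)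
  }
  {
    fix X Z assume "(X, Z) \<in> diag_rel \<alpha> O diag_rel \<beta>"
    then obtain Y where sa: "saturated \<alpha> (Upper ` X \<union> Lower ` Y)"
      and sb: "saturated \<beta> (Upper ` Y \<union> Lower ` Z)" by (auto simp: diag_rel_def)
    define T where "T = Upper ` X \<union> Middle ` Y \<union> Lower ` Z"
    have mem\<alpha>: "x \<in> Upper ` X \<union> Lower ` Y \<longleftrightarrow> lower_to_middle x \<in> T" if "x \<in> points n" for x
      using that by (cases x) (auto simp: points_def T_def image_iff)
    have mem\<beta>: "x \<in> Upper ` Y \<union> Lower ` Z \<longleftrightarrow> upper_to_middle x \<in> T" if "x \<in> points n" for x
      using that by (cases x) (auto simp: points_def T_def image_iff)
    have edge: "y \<in> T" if "x \<in> T" and xy: "(x, y) \<in> ?r" for x y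
    proof -
      consider B x' y' where "B \<in> \<alpha>" "x' \<in> B" "y' \<in> B" "x = lower_to_middle x'" "y = lower_to_middle y'"
        | B x' y' where "B \<in> \<beta>" "x' \<in> B" "y' \<in> B" "x = upper_to_middle x'" "y = upper_to_middle y'"
        using xy unfolding product_edges_def by blast
      then show ?thesis
      proof cases
        case 1
        have "B \<subseteq> Upper ` X \<union> Lower ` Y \<or> B \<inter> (Upper ` X \<union> Lower ` Y) = {}"
          using sa 1(1) by (simp add: saturated_def)
        then have "x' \<in> Upper ` X \<union> Lower ` Y \<longleftrightarrow> y' \<in> Upper ` X \<union> Lower ` Y"
          using 1(2,3) by blast
        then show ?thesis using mem\<alpha> \<alpha>p[OF 1(1)] 1 \<open>x \<in> T\<close> by (metis subsetD)
      next
        case 2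
        have "B \<subseteq> Upper ` Y \<union> Lower ` Z \<or> B \<inter> (Upper ` Y \<union> Lower ` Z) = {}"
          using sb 2(1) by (simp add: saturated_def)
        then have "x' \<in> Upper ` Y \<union> Lower ` Z \<longleftrightarrow> y' \<in> Upper ` Y \<union> Lower ` Z"
          using 2(2,3) by blast
        then show ?thesis using mem\<beta> \<beta>p[OF 2(1)] 2 \<open>x \<in> T\<close> by (metis subsetD)
      qed
    qed
    have path: "y \<in> T" if "(x, y) \<in> ?r\<^sup>*" "x \<in> T" for x y
      using that by (induction rule: rtrancl_induct) (auto intro: edge)
    have nw: "w \<notin> T" if ww: "w \<in> white n \<alpha> \<beta>" for w
    proof
      assume w: "w \<in> T"
      have "x \<notin> rook_dots n \<alpha>" if "w = lower_to_middle x" for x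
        using that w mem\<alpha>[of x] sa unfolding rook_dots_def saturated_def by (metis DiffD1 DiffD2 subsetD)
      moreover have "x \<notin> rook_dots n \<beta>" if "w = upper_to_middle x" for x
        using that w mem\<beta>[of x] sb unfolding rook_dots_def saturated_def by (metis DiffD1 DiffD2 subsetD)
      ultimately show False using ww by (auto simp: white_def)
    qed
    have "(X, Y) \<in> diag_rel \<alpha>" "(Y, Z) \<in> diag_rel \<beta>" using sa sb by (auto simp: diag_rel_def)
    then have "X \<subseteq> {1..n}" "Z \<subseteq> {1..n}" using diag_rel_subset \<alpha> \<beta> by blast+
    then have sub: "Upper ` X \<union> Lower ` Z \<subseteq> points n" unfolding points_def by blast
    have memS: "x \<in> Upper ` X \<union> Lower ` Z \<longleftrightarrow> x \<in> T" if "x \<in> points n" for x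
      using that by (auto simp: T_def points_def)
    have "saturated (rook_product n \<alpha> \<beta>) (Upper ` X \<union> Lower ` Z)"
      unfolding saturated_rook_product
    proof (intro conjI ballI impI subsetI)
      fix x assume x: "x \<in> Upper ` X \<union> Lower ` Z"
      then have "x \<notin> product_dots n \<alpha> \<beta>"
        using memS sub path nw unfolding product_dots_def by blast
      then show "x \<in> points n - product_dots n \<alpha> \<beta>" using x sub by blast
    next
      fix x y assume xy: "x \<in> Upper ` X \<union> Lower ` Z" "y \<in> points n - product_dots n \<alpha> \<beta>"
        "(x, y) \<in> ?r\<^sup>*"
      have "x \<in> T" using xy(1) memS[OF subsetD[OF sub xy(1)]] by simp
      with xy(3) have "y \<in> T" by (rule path)
      then show "y \<in> Upper ` X \<union> Lower ` Z" using memS[of y] xy(2) by simp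
    qed
    then show "(X, Z) \<in> diag_rel (rook_product n \<alpha> \<beta>)" by (simp add: diag_rel_def)
  }
qed

section \<open>The generators as relations between subsets\<close>

lemma strand_iff [simp]:
  "Upper i \<in> strand j \<longleftrightarrow> i = j" "Lower i \<in> strand j \<longleftrightarrow> i = j" "Middle i \<notin> strand j"
  by (auto simp: strand_def)

text \<open>The common shape of the unit and of all generators: a few special blocks, and vertical
  strands elsewhere. For the unit and for \<open>Lo\<close> there are no special blocks.\<close>

lemma in_rook_partitions_Un_strands:
  assumes "\<A> \<in> rook_partitions n" "J \<subseteq> {1..n}"
    and "\<And>B j. B \<in> \<A> \<Longrightarrow> j \<in> J \<Longrightarrow> Upper j \<notin> B \<and> Lower j \<notin> B"
  shows "\<A> \<union> strand ` J \<in> rook_partitions n"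
proof -
  have "B \<inter> C = {}" if BC: "B \<in> \<A> \<union> strand ` J" "C \<in> \<A> \<union> strand ` J" "B \<noteq> C" for B C
  proof -
    have *: "B \<inter> strand j = {}" if "B \<in> \<A>" "j \<in> J" for B j
      using assms(3)[OF that] by (auto simp: strand_def)
    consider "B \<in> \<A>" "C \<in> \<A>" | j where "B \<in> \<A>" "j \<in> J" "C = strand j"
      | j where "C \<in> \<A>" "j \<in> J" "B = strand j" | i j where "B = strand i" "C = strand j"
      using BC by blast
    then show ?thesis
    proof cases
      case 1
      then show ?thesis using assms(1) BC by (auto simp: rook_partitions_def disjoint_def)
    next
      case 2
      then show ?thesis using * by simp
    next
      case 3
      then show ?thesis using * by blast
    next
      case 4
      then show ?thesis using BC(3) by (auto simp: strand_def)
    qed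
  qed
  moreover have "strand j \<subseteq> points n" if "j \<in> J" for j
    using that assms(2) by (auto simp: strand_def points_def)
  then have "\<Union>(\<A> \<union> strand ` J) \<subseteq> points n"
    using assms(1) by (simp add: rook_partitions_def UN_subset_iff)
  moreover have "{} \<notin> strand ` J" by (auto simp: strand_def)
  ultimately show ?thesis using assms(1) by (simp add: rook_partitions_def disjoint_def)
qed

lemma saturated_Un_strands:
  "saturated (\<A> \<union> strand ` J) (Upper ` X \<union> Lower ` Y) \<longleftrightarrow>
     (\<forall>i\<in>X. Upper i \<in> \<Union>\<A> \<or> i \<in> J) \<and> (\<forall>i\<in>Y. Lower i \<in> \<Union>\<A> \<or> i \<in> J) \<and>
     (\<forall>B\<in>\<A>. B \<subseteq> Upper ` X \<union> Lower ` Y \<or> B \<inter> (Upper ` X \<union> Lower ` Y) = {}) \<and>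
     (\<forall>j\<in>J. j \<in> X \<longleftrightarrow> j \<in> Y)"
proof -
  have "Upper ` X \<union> Lower ` Y \<subseteq> \<Union>(\<A> \<union> strand ` J) \<longleftrightarrow>
      (\<forall>i\<in>X. Upper i \<in> \<Union>\<A> \<or> i \<in> J) \<and> (\<forall>i\<in>Y. Lower i \<in> \<Union>\<A> \<or> i \<in> J)"
    by (simp add: image_subset_iff)
  moreover have "strand j \<subseteq> Upper ` X \<union> Lower ` Y \<or> strand j \<inter> (Upper ` X \<union> Lower ` Y) = {} \<longleftrightarrow>
      (j \<in> X \<longleftrightarrow> j \<in> Y)" for j
    by (auto simp: strand_def)
  ultimately show ?thesis
    unfolding saturated_def ball_Un ball_simps by simp
qed

lemma one_in_rook_partitions: "strand ` {1..n} \<in> rook_partitions n"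
  using in_rook_partitions_Un_strands[of "{}" n "{1..n}"] by (simp add: rook_partitions_def)

lemma diag_rel_one: "diag_rel (strand ` {1..n}) = Id_on (Pow {1..n})"
proof -
  have "(X, Y) \<in> diag_rel ({} \<union> strand ` {1..n}) \<longleftrightarrow> X = Y \<and> X \<subseteq> {1..n}" for X Y
    unfolding diag_rel_def mem_Collect_eq case_prod_conv saturated_Un_strands by blast
  then show ?thesis by auto
qed

text \<open>\<open>Lq\<close> and \<open>Lo\<close> give restrictions of the identity. Since 0 never
  lies in X, \<open>Lo i\<close> restricts to the sets that do not separate 0 from \<open>i\<close>,
  just as \<open>Lq i\<close> does for \<open>i\<close> and \<open>i + 1\<close>. For
  \<open>Le i\<close> the two singleton blocks are chosen independently, so X and Y are unrelated at
  \<open>i\<close>.\<close>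

primrec letter_rel :: "nat \<Rightarrow> letter \<Rightarrow> (nat set \<times> nat set) set" where
  "letter_rel n (Ls i) = {(X, Y). Y \<subseteq> {1..n} \<and> X = transpose i (i + 1) -` Y}"
| "letter_rel n (Le i) = {(X, Y). X \<subseteq> {1..n} \<and> Y \<subseteq> {1..n} \<and> X - {i} = Y - {i}}"
| "letter_rel n (Lq i) = {(X, Y). Y \<subseteq> {1..n} \<and> X = Y \<and> (i \<in> X \<longleftrightarrow> i + 1 \<in> X)}"
| "letter_rel n (Lo i) = {(X, Y). Y \<subseteq> {1..n} \<and> X = Y \<and> i \<notin> X}"

definition word_rel :: "nat \<Rightarrow> letter list \<Rightarrow> (nat set \<times> nat set) set" where
  "word_rel n w = foldr (\<lambda>x r. letter_rel n x O r) w (Id_on (Pow {1..n}))"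

lemma generator_in_rook_partitions:
  assumes "x \<in> alphabet n"
  shows "generator n x \<in> rook_partitions n"
proof (cases x)
  case (Ls i)
  then show ?thesis using assms unfolding Ls generator.simps
    by (intro in_rook_partitions_Un_strands)
      (auto simp: alphabet_def rook_partitions_def points_def disjoint_def)
next
  case (Le i)
  then show ?thesis using assms unfolding Le generator.simps
    by (intro in_rook_partitions_Un_strands)
      (auto simp: alphabet_def rook_partitions_def points_def disjoint_def)
next
  case (Lq i)
  then show ?thesis using assms unfolding Lq generator.simps
    by (intro in_rook_partitions_Un_strands)
      (auto simp: alphabet_def rook_partitions_def points_def disjoint_def)
next
  case (Lo i)
  then show ?thesis
    using in_rook_partitions_Un_strands[of "{}" n "{1..n} - {i}"] by (simp add: rook_partitions_def)
qed

lemma diag_rel_generator: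
  assumes "x \<in> alphabet n"
  shows "diag_rel (generator n x) = letter_rel n x"
proof -
  have "(X, Y) \<in> diag_rel (generator n x) \<longleftrightarrow> (X, Y) \<in> letter_rel n x" for X Y
  proof (cases x)
    case (Ls i)
    then have i: "i \<in> {1..n}" "i + 1 \<in> {1..n}" using assms by (auto simp: alphabet_def)
    have "(X, Y) \<in> diag_rel (generator n (Ls i)) \<longleftrightarrow>
       X \<subseteq> {1..n} \<and> Y \<subseteq> {1..n} \<and> (i \<in> X \<longleftrightarrow> i + 1 \<in> Y) \<and> (i + 1 \<in> X \<longleftrightarrow> i \<in> Y) \<and>
       (\<forall>j \<in> {1..n} - {i, i + 1}. j \<in> X \<longleftrightarrow> j \<in> Y)"
      unfolding diag_rel_def mem_Collect_eq case_prod_conv saturated_Un_strands generator.simps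
      using i by (simp add: image_iff subset_iff) auto?
    also have "\<dots> \<longleftrightarrow> Y \<subseteq> {1..n} \<and> (i \<in> X \<longleftrightarrow> i + 1 \<in> Y) \<and> (i + 1 \<in> X \<longleftrightarrow> i \<in> Y) \<and>
       (\<forall>j. j \<notin> {i, i + 1} \<longrightarrow> (j \<in> X \<longleftrightarrow> j \<in> Y))"
      (is "?L \<longleftrightarrow> ?R")
    proof
      assume L: ?L
      have "j \<in> X \<longleftrightarrow> j \<in> Y" if "j \<notin> {i, i + 1}" for j
        using L that by (cases "j \<in> {1..n}") auto
      then show ?R using L by simp
    next
      assume R: ?R
      have "x \<in> {1..n}" if "x \<in> X" for x
        using R i that by (cases "x \<in> {i, i + 1}") auto
      then have "X \<subseteq> {1..n}" by (rule subsetI)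
      then show ?L using R by simp
    qed
    also have "\<dots> \<longleftrightarrow> Y \<subseteq> {1..n} \<and> (\<forall>j. j \<in> X \<longleftrightarrow> transpose i (i + 1) j \<in> Y)"
    proof -
      have "(\<forall>j. j \<in> X \<longleftrightarrow> transpose i (i + 1) j \<in> Y) \<longleftrightarrow>
        (i \<in> X \<longleftrightarrow> i + 1 \<in> Y) \<and> (i + 1 \<in> X \<longleftrightarrow> i \<in> Y) \<and> (\<forall>j. j \<notin> {i, i + 1} \<longrightarrow> (j \<in> X \<longleftrightarrow> j \<in> Y))"
        (is "?A \<longleftrightarrow> ?B")
      proof
        assume A: ?A
        show ?B using A[THEN spec, of i] A[THEN spec, of "i + 1"] A[THEN spec] by simp
      next
        assume ?B
        then show ?A by (simp add: transpose_def)
      qed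
      then show ?thesis by simp
    qed
    finally show ?thesis by (simp add: Ls set_eq_iff)
  next
    case (Le i)
    then have i: "i \<in> {1..n}" using assms by (auto simp: alphabet_def)
    then show ?thesis unfolding Le generator.simps diag_rel_def mem_Collect_eq case_prod_conv saturated_Un_strands letter_rel.simps
      by (simp add: image_iff subset_iff) auto?
  next
    case (Lq i)
    then have i: "i \<in> {1..n}" "i + 1 \<in> {1..n}" using assms by (auto simp: alphabet_def)
    then show ?thesis unfolding Lq generator.simps diag_rel_def mem_Collect_eq case_prod_conv saturated_Un_strands letter_rel.simps
      by (simp add: image_iff subset_iff) auto?
  next
    case (Lo i)
    have "(X, Y) \<in> diag_rel ({} \<union> strand ` ({1..n} - {i})) \<longleftrightarrow> (X, Y) \<in> letter_rel n (Lo i)"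
      unfolding diag_rel_def mem_Collect_eq case_prod_conv saturated_Un_strands letter_rel.simps
      by blast
    then show ?thesis by (simp add: Lo)
  qed
  then show ?thesis by auto
qed

section \<open>Soundness of the defining relations\<close>

lemma word_rel_Nil [simp]: "word_rel n [] = Id_on (Pow {1..n})"
  and word_rel_Cons: "word_rel n (x # w) = letter_rel n x O word_rel n w"
  by (simp_all add: word_rel_def)

lemma transpose_Suc_mem_iff: "i \<in> {1..<n} \<Longrightarrow> transpose i (Suc i) j \<in> {1..n} \<longleftrightarrow> j \<in> {1..n}"
  by (auto simp: transpose_def)

lemma vimage_transpose_subset:
  assumes "i \<in> {1..<n}"
  shows "transpose i (Suc i) -` X \<subseteq> {1..n} \<longleftrightarrow> X \<subseteq> {1..n}"
  using transpose_Suc_mem_iff[OF assms] unfolding subset_iff vimage_eq by (metis transpose_involutory)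

text \<open>Together with its companions for the other letters, this evaluates a word letter by
  letter at the first set, so that a defining relation becomes a comparison of preimages of X under
  transpositions.\<close>

lemma word_rel_Ls:
  assumes "i \<in> {1..<n}"
  shows "(X, Z) \<in> word_rel n (Ls i # w) \<longleftrightarrow> X \<subseteq> {1..n} \<and> (transpose i (i + 1) -` X, Z) \<in> word_rel n w"
proof -
  let ?t = "transpose i (i + 1) :: nat \<Rightarrow> nat"
  have *: "X = ?t -` Y \<longleftrightarrow> Y = ?t -` X" for X Y by auto
  then show ?thesis using vimage_transpose_subset[OF assms]
    by (simp add: word_rel_Cons relcomp_unfold)
qed

lemma word_rel_Le:
  "(X, Z) \<in> word_rel n (Le i # w) \<longleftrightarrow>
     X \<subseteq> {1..n} \<and> ((insert i X, Z) \<in> word_rel n w \<or> (X - {i}, Z) \<in> word_rel n w)"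
  if "i \<in> {1..n}"
proof -
  have *: "Y \<subseteq> {1..n} \<and> X - {i} = Y - {i} \<longleftrightarrow> Y = insert i X \<or> Y = X - {i}" if "X \<subseteq> {1..n}" for Y
    using that \<open>i \<in> {1..n}\<close> by blast
  show ?thesis
  proof (cases "X \<subseteq> {1..n}")
    case True
    have "(X, Z) \<in> word_rel n (Le i # w) \<longleftrightarrow>
        (\<exists>Y. (Y \<subseteq> {1..n} \<and> X - {i} = Y - {i}) \<and> (Y, Z) \<in> word_rel n w)"
      using True by (auto simp: word_rel_Cons)
    then show ?thesis using True unfolding *[OF True] by blast
  qed (simp add: word_rel_Cons relcomp_unfold)
qed

lemma word_rel_Lq:
  "(X, Z) \<in> word_rel n (Lq i # w) \<longleftrightarrow>
     X \<subseteq> {1..n} \<and> (i \<in> X \<longleftrightarrow> i + 1 \<in> X) \<and> (X, Z) \<in> word_rel n w"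
  by (auto simp: word_rel_Cons)

lemma word_rel_Lo:
  "(X, Z) \<in> word_rel n (Lo i # w) \<longleftrightarrow> X \<subseteq> {1..n} \<and> i \<notin> X \<and> (X, Z) \<in> word_rel n w"
  by (auto simp: word_rel_Cons)

lemma vimage_transpose:
  "transpose a b -` insert j X = insert (transpose a b j) (transpose a b -` X)"
  "transpose a b -` (X - {j}) = transpose a b -` X - {transpose a b j}"
  by (auto simp: transpose_def split: if_splits)

lemma word_rel_domain:
  assumes "set w \<subseteq> alphabet n" "(X, Z) \<in> word_rel n w"
  shows "X \<subseteq> {1..n}"
proof (cases w)
  case (Cons x v)
  have "i \<in> {1..n}" if "Le i \<in> alphabet n" for i using that by (auto simp: alphabet_def)
  moreover have "i \<in> {1..<n}" if "Ls i \<in> alphabet n" for i using that by (auto simp: alphabet_def)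
  ultimately show ?thesis using assms Cons
    by (cases x) (auto simp: word_rel_Ls word_rel_Le word_rel_Lq word_rel_Lo)
qed (use assms in auto)

lemma vimage_transpose_same:
  "a \<in> X \<longleftrightarrow> b \<in> X \<Longrightarrow> transpose a b -` X = X"
  by (auto simp: transpose_def split: if_splits)

lemma vimage_transpose_both:
  "insert a (insert b (transpose a b -` X)) = insert b (insert a X)"
  "insert b (transpose a b -` X) - {a} = insert b (X - {a})"
  "insert a (transpose a b -` X - {b}) = insert a X - {b}"
  "transpose a b -` X - {b} - {a} = X - {a} - {b}" if "a \<noteq> b"
  using that by (auto simp: transpose_def split: if_splits)

lemma vimage_transpose_commute:
  assumes "{a, b} \<inter> {c, d} = {}"
  shows "transpose a b -` transpose c d -` X = transpose c d -` transpose a b -` X"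
proof -
  have "transpose c d (transpose a b x) = transpose a b (transpose c d x)" for x
    using assms by (auto simp: transpose_def)
  then show ?thesis by auto
qed

lemma vimage_transpose_braid:
  assumes "\<bar>int i - int j\<bar> = 1"
  shows "transpose i (i + 1) -` transpose j (j + 1) -` transpose i (i + 1) -` X =
    transpose j (j + 1) -` transpose i (i + 1) -` transpose j (j + 1) -` X"
proof -
  have "j = i + 1 \<or> i = j + 1" using assms by linarith
  then have "transpose i (i + 1) (transpose j (j + 1) (transpose i (i + 1) x)) =
      transpose j (j + 1) (transpose i (i + 1) (transpose j (j + 1) x))" for x
    by (auto simp: transpose_def)
  then show ?thesis by (auto simp: vimage_def)
qed

text \<open>Both sides are evaluated at an arbitrary X. Braid and commutation relations come down to
  identities between transpositions. Where s is absorbed by q or by two letters o, the transposition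
  fixes X because its two points lie both inside or both outside X.\<close>

lemma word_rel_eq_if_relations:
  assumes "(u, v) \<in> relations n"
  shows "word_rel n u = word_rel n v"
proof -
  have rel: "(u, v) \<in> all_relations" and subs: "set u \<subseteq> alphabet n" "set v \<subseteq> alphabet n"
    using assms by (auto simp: relations_def)
  then have uv: "\<forall>x \<in> set u. x \<in> alphabet n" "\<forall>x \<in> set v. x \<in> alphabet n" by auto
  define N where "N = {1..n}"
  have "(X, Z) \<in> word_rel n u \<longleftrightarrow> (X, Z) \<in> word_rel n v" for X Z
  proof (cases "X \<subseteq> N")
    case True
    have *: "B - A \<subseteq> N" if "B \<subseteq> N" for A B
      using that by blast
    have Nil: "(X, Z) \<in> word_rel n [] \<longleftrightarrow> X \<subseteq> N \<and> X = Z" for X Z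
      by (auto simp: N_def)
    have NI: "1 \<le> i \<Longrightarrow> i \<le> n \<Longrightarrow> i \<in> N" "1 \<le> i \<Longrightarrow> i < n \<Longrightarrow> i \<in> N" "1 \<le> i \<Longrightarrow> i < n \<Longrightarrow> i + 1 \<in> N" for i
      by (auto simp: N_def)
    note [simp del] = word_rel_Nil One_nat_def
    note rules = alphabet_def image_iff word_rel_Ls[where n=n, folded N_def]
      word_rel_Le[where n=n, folded N_def] word_rel_Lq[where n=n, folded N_def]
      word_rel_Lo[where n=n, folded N_def] vimage_transpose vimage_transpose_subset[where n=n, unfolded Suc_eq_plus1, folded N_def] Nil NI *
    have trans [simp]: "transpose i (i + 1) i = i + 1" "transpose i (i + 1) (i + 1) = i" for i :: nat
      by auto
    show ?thesis
      using rel
    proof (cases rule: all_relations.cases)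
      case (ss i)
      have "transpose i (i + 1) -` transpose i (i + 1) -` X = X" by auto
      then show ?thesis using ss uv True by (simp add: rules)
    next
      case (ss_comm i j)
      have "transpose i (i + 1) -` transpose j (j + 1) -` X = transpose j (j + 1) -` transpose i (i + 1) -` X"
        using ss_comm by (intro vimage_transpose_commute) auto
      then show ?thesis using ss_comm uv True by (simp add: rules)
    next
      case (ss_braid i j)
      show ?thesis using ss_braid uv True by (simp add: rules vimage_transpose_braid[OF ss_braid(3)])
    next
      case (ees i)
      then show ?thesis using uv True by (simp add: rules vimage_transpose_both) blast
    next
      case (oos i)
      have "i \<notin> X \<Longrightarrow> i + 1 \<notin> X \<Longrightarrow> transpose i (i + 1) -` X = X"
        by (rule vimage_transpose_same) simp
      then show ?thesis using oos uv True by (simp add: rules) blast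
    next
      case (ssq i j)
      then have "j = i + 1 \<or> i = j + 1" by linarith
      then show ?thesis using ssq uv True by (elim disjE; simp add: rules; (simp add: transpose_def)?)
    next
      case (sq_comm i j)
      then have "j \<noteq> i" "j \<noteq> i + 1" "i \<noteq> j + 1" by auto
      then show ?thesis using sq_comm uv True by (simp add: rules transpose_def)
    next
      case (qs1 i)
      then show ?thesis using uv True by (simp add: rules) blast
    next
      case (qs2 i)
      have "(i \<in> X \<longleftrightarrow> i + 1 \<in> X) \<Longrightarrow> transpose i (i + 1) -` X = X"
        by (rule vimage_transpose_same)
      then show ?thesis using qs2 uv True by (simp add: rules) blast
    qed (use uv True in \<open>simp add: rules; auto?\<close>)+
  next
    case False
    then have "(X, Z) \<notin> word_rel n u" "(X, Z) \<notin> word_rel n v"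
      using word_rel_domain[of u n X Z] word_rel_domain[of v n X Z] subs unfolding N_def by blast+
    then show ?thesis by simp
  qed
  then show ?thesis by auto
qed

section \<open>The monoid laws and the evaluation of words\<close>

lemma Id_on_O: "(\<And>x y. (x, y) \<in> r \<Longrightarrow> x \<in> A) \<Longrightarrow> Id_on A O r = r"
  and O_Id_on: "(\<And>x y. (x, y) \<in> r \<Longrightarrow> y \<in> A) \<Longrightarrow> r O Id_on A = r"
  by auto

lemma monoid_rook_partition_monoid: "monoid (rook_partition_monoid n)"
proof -
  let ?one = "strand ` {1..n}"
  note one = one_in_rook_partitions[of n]
  have eqI: "\<alpha> = \<beta>" if "\<alpha> \<in> rook_partitions n" "\<beta> \<in> rook_partitions n" "diag_rel \<alpha> = diag_rel \<beta>" for \<alpha> \<beta>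
    using that by (rule diag_rel_inject)
  have unit: "Id_on (Pow {1..n}) O diag_rel \<alpha> = diag_rel \<alpha>" "diag_rel \<alpha> O Id_on (Pow {1..n}) = diag_rel \<alpha>"
    if "\<alpha> \<in> rook_partitions n" for \<alpha>
    using diag_rel_subset[OF that] by (intro Id_on_O O_Id_on PowI; simp only:)+
  show ?thesis
  proof (rule monoidI)
    fix \<alpha> \<beta> \<gamma>
    assume "\<alpha> \<in> carrier (rook_partition_monoid n)" "\<beta> \<in> carrier (rook_partition_monoid n)"
      "\<gamma> \<in> carrier (rook_partition_monoid n)"
    then have "\<alpha> \<in> rook_partitions n" "\<beta> \<in> rook_partitions n" "\<gamma> \<in> rook_partitions n"
      by (simp_all add: rook_partition_monoid_def)
    then have "rook_product n (rook_product n \<alpha> \<beta>) \<gamma> = rook_product n \<alpha> (rook_product n \<beta> \<gamma>)"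
      by (intro eqI) (simp_all add: rook_product_closed diag_rel_rook_product O_assoc)
    then show "\<alpha> \<otimes>\<^bsub>rook_partition_monoid n\<^esub> \<beta> \<otimes>\<^bsub>rook_partition_monoid n\<^esub> \<gamma> =
        \<alpha> \<otimes>\<^bsub>rook_partition_monoid n\<^esub> (\<beta> \<otimes>\<^bsub>rook_partition_monoid n\<^esub> \<gamma>)"
      by (simp add: rook_partition_monoid_def)
  next
    fix \<alpha> assume "\<alpha> \<in> carrier (rook_partition_monoid n)"
    then have "\<alpha> \<in> rook_partitions n" by (simp add: rook_partition_monoid_def)
    then have "rook_product n ?one \<alpha> = \<alpha>" "rook_product n \<alpha> ?one = \<alpha>"
      by (intro eqI; simp only: rook_product_closed diag_rel_rook_product one diag_rel_one unit)+
    then show "\<one>\<^bsub>rook_partition_monoid n\<^esub> \<otimes>\<^bsub>rook_partition_monoid n\<^esub> \<alpha> = \<alpha>"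
      "\<alpha> \<otimes>\<^bsub>rook_partition_monoid n\<^esub> \<one>\<^bsub>rook_partition_monoid n\<^esub> = \<alpha>"
      by (simp_all add: rook_partition_monoid_def)
  qed (simp_all add: rook_partition_monoid_def rook_product_closed one[simplified])
qed

lemma Psi_Nil: "Psi n [] = strand ` {1..n}"
  and Psi_Cons: "Psi n (x # w) = rook_product n (generator n x) (Psi n w)"
  by (simp_all add: Psi_def free_extension_def rook_partition_monoid_def)

lemma Psi_in_rook_partitions: "Psi n w \<in> rook_partitions n"
  by (cases w) (simp_all only: Psi_Nil Psi_Cons one_in_rook_partitions rook_product_closed)

lemma diag_rel_Psi: "set w \<subseteq> alphabet n \<Longrightarrow> diag_rel (Psi n w) = word_rel n w"
proof (induction w)
  case (Cons x w)
  then have x: "x \<in> alphabet n" by simp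
  then show ?case
    using Cons diag_rel_rook_product[OF generator_in_rook_partitions[OF x] Psi_in_rook_partitions]
    by (simp only: Psi_Cons word_rel_Cons diag_rel_generator[OF x]) simp
qed (simp only: Psi_Nil diag_rel_one word_rel_Nil)

lemma Psi_eq_iff_word_rel_eq:
  assumes "set u \<subseteq> alphabet n" "set v \<subseteq> alphabet n"
  shows "Psi n u = Psi n v \<longleftrightarrow> word_rel n u = word_rel n v"
  using diag_rel_Psi[OF assms(1)] diag_rel_Psi[OF assms(2)] diag_rel_inject[OF Psi_in_rook_partitions Psi_in_rook_partitions]
  by metis

lemma Psi_append:
  "set u \<subseteq> alphabet n \<Longrightarrow> Psi n (u @ v) = rook_product n (Psi n u) (Psi n v)"
proof (induction u)
  interpret monoid "rook_partition_monoid n" by (rule monoid_rook_partition_monoid)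
  case Nil
  show ?case using l_one[of "Psi n v"] Psi_in_rook_partitions[of n v]
    by (simp add: rook_partition_monoid_def Psi_Nil)
next
  interpret monoid "rook_partition_monoid n" by (rule monoid_rook_partition_monoid)
  case (Cons x u)
  then show ?case
    using m_assoc[of "generator n x" "Psi n u" "Psi n v"] Psi_in_rook_partitions[of n]
      generator_in_rook_partitions[of x n]
    by (simp add: rook_partition_monoid_def Psi_Cons)
qed

section \<open>Words in the transpositions\<close>

text \<open>Words act from top to bottom, first letter first: \<open>perm_of is\<close> sends the upper end of a strand
  to its lower end. Hence concatenation reverses the order of composition.\<close>

fun perm_of :: "nat list \<Rightarrow> nat \<Rightarrow> nat" where
  "perm_of [] = id"
| "perm_of (i # is) = perm_of is \<circ> transpose i (i + 1)"

lemma perm_of_append: "perm_of (u @ v) = perm_of v \<circ> perm_of u"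
  by (induction u) (simp_all add: fun_eq_iff)

lemma perm_of_permutes: "set is \<subseteq> {a..<b} \<Longrightarrow> perm_of is permutes {a..b}"
proof (induction "is")
  case Nil
  show ?case by (simp add: permutes_def)
next
  case (Cons i "is")
  then have "transpose i (i + 1) permutes {a..b}" by (intro permutes_swap_id) auto
  moreover have "perm_of is permutes {a..b}" using Cons by simp
  ultimately show ?case unfolding perm_of.simps by (rule permutes_compose)
qed

text \<open>Read from the front, the word moves \<open>m\<close> to m - 1, then to m - 2, and so on
  down to \<open>k\<close>. Such descending words represent the cosets of the stabiliser of the last
  point.\<close>

lemma perm_of_rev_upt: "k \<le> m \<Longrightarrow> perm_of (rev [k..<m]) m = k"
proof (induction m)
  case (Suc m)
  then show ?case by (cases "k = Suc m") auto
qed simp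

text \<open>Induction on the right end: the descending word for the image of the last point is split
  off, and the rest fixes that point. The left end is kept arbitrary because permutations of {3..n}
  have to be written without \<open>s 1\<close> and \<open>s 2\<close>.\<close>

lemma permutes_interval_obtains_word:
  assumes "\<sigma> permutes {a..b}"
  obtains "is" where "set is \<subseteq> {a..<b}" "perm_of is = \<sigma>"
proof -
  have "\<exists>is. set is \<subseteq> {a..<b} \<and> perm_of is = \<sigma>"
    using assms
  proof (induction b arbitrary: \<sigma>)
    case 0
    then have "\<sigma> = id"
      by (cases "a = 0") auto
    then show ?case by (intro exI[of _ "[]"]) auto
  next
    case (Suc b)
    show ?case
    proof (cases "a \<le> Suc b")
      case False
      then have "\<sigma> = id" using Suc.prems by simp
      then show ?thesis by (intro exI[of _ "[]"]) auto
    next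
      case True
      define k where "k = \<sigma> (Suc b)"
      have k: "a \<le> k" "k \<le> Suc b"
        using permutes_in_image[OF Suc.prems, of "Suc b"] True by (auto simp: k_def)
      define D where "D = rev [k..<Suc b]"
      have D: "set D \<subseteq> {a..<Suc b}" using k by (auto simp: D_def)
      have Dp: "perm_of D permutes {a..Suc b}" by (rule perm_of_permutes[OF D])
      have Dk: "perm_of D (Suc b) = k" unfolding D_def by (rule perm_of_rev_upt[OF k(2)])
      define \<tau> where "\<tau> = inv_into UNIV (perm_of D) \<circ> \<sigma>"
      have \<tau>: "\<tau> permutes {a..Suc b}"
        unfolding \<tau>_def by (rule permutes_compose[OF Suc.prems permutes_inv[OF Dp]])
      have "\<tau> (Suc b) = Suc b"
        unfolding \<tau>_def using Dk by (simp add: k_def[symmetric] permutes_inv_eq[OF Dp])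
      have "\<tau> permutes {a..b}"
      proof (rule permutes_superset[OF \<tau>])
        fix x assume "x \<in> {a..Suc b} - {a..b}"
        then have "x = Suc b" by auto
        then show "\<tau> x = x" using \<open>\<tau> (Suc b) = Suc b\<close> by simp
      qed
      then obtain u where u: "set u \<subseteq> {a..<b}" "perm_of u = \<tau>" using Suc.IH by blast
      have "perm_of D \<circ> \<tau> = \<sigma>"
        unfolding \<tau>_def by (simp add: fun_eq_iff permutes_inverses[OF Dp])
      then have "perm_of (u @ D) = \<sigma>" by (simp add: perm_of_append u)
      moreover have "set (u @ D) \<subseteq> {a..<Suc b}" using u D by auto
      ultimately show ?thesis by blast
    qed
  qed
  then show ?thesis using that by blast
qed

lemma word_rel_map_Ls:
  assumes "set is \<subseteq> {1..<n}"
  shows "(X, Z) \<in> word_rel n (map Ls is) \<longleftrightarrow> Z \<subseteq> {1..n} \<and> X = perm_of is -` Z"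
  using assms
proof (induction "is" arbitrary: X)
  case Nil
  then show ?case by auto
next
  case (Cons i "is")
  let ?t = "transpose i (i + 1) :: nat \<Rightarrow> nat"
  have i: "i \<in> {1..<n}" using Cons by simp
  have eq: "?t -` X = Y \<longleftrightarrow> X = ?t -` Y" for Y by auto
  have sub: "?t -` Y \<subseteq> {1..n} \<longleftrightarrow> Y \<subseteq> {1..n}" for Y using vimage_transpose_subset[OF i] by simp
  have p: "perm_of is -` Z \<subseteq> {1..n}" if "Z \<subseteq> {1..n}"
    using that permutes_in_image[OF perm_of_permutes[of "is" 1 n]] Cons.prems by (auto simp: subset_iff)
  show ?case
    using Cons.IH[of "?t -` X"] Cons.prems p sub[of "perm_of is -` Z"]
    by (simp only: list.map word_rel_Ls[OF i] eq perm_of.simps vimage_comp) auto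
qed

text \<open>The complements of A and of its image have equally many elements, and any bijection
  between them fills the gap. This serves to send small indices to prescribed ones and to complete a
  matching of transversal blocks.\<close>

lemma extend_to_permutation:
  assumes "finite S" "A \<subseteq> S" "f ` A \<subseteq> S" "inj_on f A"
  obtains \<sigma> where "\<sigma> permutes S" "\<And>a. a \<in> A \<Longrightarrow> \<sigma> a = f a"
proof -
  have "card (S - A) = card (S - f ` A)"
    using assms by (simp add: card_Diff_subset finite_subset card_image)
  then obtain h where h: "bij_betw h (S - A) (S - f ` A)"
    using assms(1) finite_same_card_bij by blast
  define \<sigma> where "\<sigma> x = (if x \<in> A then f x else if x \<in> S then h x else x)" for x
  have "bij_betw \<sigma> A (f ` A)"
    using assms(4) by (simp add: \<sigma>_def bij_betw_def inj_on_def)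
  moreover have "bij_betw \<sigma> (S - A) (S - f ` A)"
    by (rule iffD1[OF bij_betw_cong h]) (simp add: \<sigma>_def)
  ultimately have "bij_betw \<sigma> (A \<union> (S - A)) (f ` A \<union> (S - f ` A))"
    by (intro bij_betw_combine) auto
  moreover have "A \<union> (S - A) = S" "f ` A \<union> (S - f ` A) = S" using assms by auto
  ultimately have "\<sigma> permutes S"
    using assms(2) by (intro bij_imp_permutes) (auto simp: \<sigma>_def)
  then show thesis using that by (simp add: \<sigma>_def)
qed

lemma permutation_of_distinct:
  assumes "distinct xs" "set xs \<subseteq> {1..n}"
  obtains \<sigma> where "\<sigma> permutes {1..n}" "\<And>t. t < length xs \<Longrightarrow> \<sigma> (Suc t) = xs ! t"
proof -
  have "length xs \<le> n"
    using card_mono[OF _ assms(2)] distinct_card[OF assms(1)] by simp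
  then have "Suc ` {..<length xs} \<subseteq> {1..n}" by auto
  moreover have "(\<lambda>a. xs ! (a - 1)) ` Suc ` {..<length xs} \<subseteq> {1..n}"
    using assms(2) by (auto simp: subset_iff in_set_conv_nth)
  moreover have "inj_on (\<lambda>a. xs ! (a - 1)) (Suc ` {..<length xs})"
    using assms(1) by (auto simp: inj_on_def nth_eq_iff_index_eq)
  ultimately obtain \<sigma> where "\<sigma> permutes {1..n}" "\<And>a. a \<in> Suc ` {..<length xs} \<Longrightarrow> \<sigma> a = xs ! (a - 1)"
    using extend_to_permutation[of "{1..n}" "Suc ` {..<length xs}" "\<lambda>a. xs ! (a - 1)"] by blast
  then show thesis using that by simp
qed

section \<open>Factorisations of a rook partition\<close>

definition closed_under :: "(nat \<times> nat) list \<Rightarrow> nat set \<Rightarrow> bool" where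
  "closed_under l X \<longleftrightarrow> (\<forall>(a, b) \<in> set l. a \<in> X \<longleftrightarrow> b \<in> X)"

text \<open>The equivalence relation generated by the pairs, described by its closed sets instead of
  chains of pairs: closed sets are what a relation between subsets can see.\<close>

definition sim :: "(nat \<times> nat) list \<Rightarrow> nat \<Rightarrow> nat \<Rightarrow> bool" where
  "sim l i j \<longleftrightarrow> (\<forall>X. closed_under l X \<longrightarrow> (i \<in> X \<longleftrightarrow> j \<in> X))"

definition pairs_upto :: "nat \<Rightarrow> (nat \<times> nat) list \<Rightarrow> bool" where
  "pairs_upto n l \<longleftrightarrow> set l \<subseteq> {..n} \<times> {..n}"

lemma pairs_upto_simps [simp]:
  "pairs_upto n []"
  "pairs_upto n (p # l) \<longleftrightarrow> fst p \<le> n \<and> snd p \<le> n \<and> pairs_upto n l"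
  "pairs_upto n (l @ l') \<longleftrightarrow> pairs_upto n l \<and> pairs_upto n l'"
  by (auto simp: pairs_upto_def mem_Times_iff)

lemma sim_refl [simp]: "sim l i i"
  by (simp add: sim_def)

lemma sim_sym: "sim l i j \<Longrightarrow> sim l j i"
  by (simp add: sim_def)

lemma sim_trans: "sim l i j \<Longrightarrow> sim l j k \<Longrightarrow> sim l i k"
  by (simp add: sim_def)

lemma sim_mem: "(i, j) \<in> set l \<Longrightarrow> sim l i j"
  by (auto simp: sim_def closed_under_def)

lemma simI:
  assumes "pairs_upto n l" "i \<le> n" "j \<le> n"
    and "\<And>X. X \<subseteq> {1..n} \<Longrightarrow> closed_under l X \<Longrightarrow> i \<in> X \<longleftrightarrow> j \<in> X"
  shows "sim l i j"
  unfolding sim_def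
proof (intro allI impI)
  fix X assume X: "closed_under l X"
  \<comment> \<open>Complements of closed sets are closed, so sets avoiding \<open>0\<close> suffice.\<close>
  define Y where "Y = (if 0 \<in> X then {1..n} - X else {1..n} \<inter> X)"
  have mem: "a \<in> Y \<longleftrightarrow> (a \<in> X \<longleftrightarrow> 0 \<notin> X)" if "a \<le> n" for a
    using that by (cases "a = 0") (auto simp: Y_def)
  have "closed_under l Y"
    using X assms(1) mem by (fastforce simp: closed_under_def pairs_upto_def)
  moreover have "Y \<subseteq> {1..n}" by (auto simp: Y_def)
  ultimately show "i \<in> X \<longleftrightarrow> j \<in> X" using assms(4)[of Y] mem assms(2,3) by blast
qed

text \<open>In a normal form, the pairs in \<open>k\<close> and \<open>l\<close> generate the equivalence relations of the upper and
  the lower row, where \<open>0\<close> is equivalent to the rook dots, and \<open>xs\<close> lists the strands that are cut.\<close>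

definition nf_rel :: "nat \<Rightarrow> (nat \<times> nat) list \<Rightarrow> nat list \<Rightarrow> (nat \<Rightarrow> nat) \<Rightarrow> (nat \<times> nat) list \<Rightarrow>
    (nat set \<times> nat set) set" where
  "nf_rel n k xs \<sigma> l = {(X, Y). X \<subseteq> {1..n} \<and> Y \<subseteq> {1..n} \<and> closed_under k X \<and> closed_under l Y \<and>
     (\<forall>i \<in> {1..n} - set xs. i \<in> X \<longleftrightarrow> \<sigma> i \<in> Y)}"

definition nf_ok :: "nat \<Rightarrow> (nat \<times> nat) list \<Rightarrow> nat list \<Rightarrow> (nat \<Rightarrow> nat) \<Rightarrow> (nat \<times> nat) list \<Rightarrow> bool" where
  "nf_ok n k xs \<sigma> l \<longleftrightarrow> pairs_upto n k \<and> set xs \<subseteq> {1..n} \<and> \<sigma> permutes {1..n} \<and> pairs_upto n l"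

text \<open>The index 0 takes part here. It is never in \<open>xs\<close> and is fixed by \<sigma>,
  so an uncut strand may neither start nor end in the class of the rook dots.\<close>

definition nf_reduced :: "nat \<Rightarrow> (nat \<times> nat) list \<Rightarrow> nat list \<Rightarrow> (nat \<Rightarrow> nat) \<Rightarrow> (nat \<times> nat) list \<Rightarrow> bool" where
  "nf_reduced n k xs \<sigma> l \<longleftrightarrow> nf_ok n k xs \<sigma> l \<and>
     (\<forall>i j. i \<le> n \<longrightarrow> j \<le> n \<longrightarrow> i \<notin> set xs \<longrightarrow> j \<notin> set xs \<longrightarrow> sim k i j \<or> sim l (\<sigma> i) (\<sigma> j) \<longrightarrow> i = j)"

lemma nf_reduced_upper:
  "nf_reduced n k xs \<sigma> l \<Longrightarrow> sim k i j \<Longrightarrow> i \<le> n \<Longrightarrow> j \<le> n \<Longrightarrow> i \<notin> set xs \<Longrightarrow> j \<notin> set xs \<Longrightarrow> i = j"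
  by (auto simp: nf_reduced_def)

lemma nf_reduced_lower:
  "nf_reduced n k xs \<sigma> l \<Longrightarrow> sim l (\<sigma> i) (\<sigma> j) \<Longrightarrow> i \<le> n \<Longrightarrow> j \<le> n \<Longrightarrow> i \<notin> set xs \<Longrightarrow> j \<notin> set xs \<Longrightarrow> i = j"
  by (auto simp: nf_reduced_def)

text \<open>By the symmetry of \<open>sim\<close>, closure in one direction is enough.\<close>

lemma closed_under_simI:
  assumes "pairs_upto n l" "\<And>a b. a \<in> X \<Longrightarrow> a \<le> n \<Longrightarrow> b \<le> n \<Longrightarrow> sim l a b \<Longrightarrow> b \<in> X"
  shows "closed_under l X"
proof -
  have "a \<in> X \<longleftrightarrow> b \<in> X" if ab: "(a, b) \<in> set l" for a b
  proof -
    have "a \<le> n" "b \<le> n" "sim l a b" "sim l b a"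
      using ab assms(1) sim_mem[OF ab] sim_sym by (auto simp: pairs_upto_def)
    then show ?thesis using assms(2) by blast
  qed
  then show ?thesis by (auto simp: closed_under_def)
qed

lemma nf_ok_permutes: "nf_ok n k xs \<sigma> l \<Longrightarrow> \<sigma> permutes {1..n}"
  by (simp add: nf_ok_def)

lemma permutes_zero: "\<sigma> permutes {1..n} \<Longrightarrow> \<sigma> 0 = (0::nat)"
  using permutes_not_in[of \<sigma> "{1..n}" 0] by simp

lemma permutes_le: "\<sigma> permutes {1..n} \<Longrightarrow> i \<le> n \<Longrightarrow> \<sigma> i \<le> (n::nat)"
  using permutes_in_image[of \<sigma> "{1..n}" i] permutes_zero[of \<sigma> n] by (cases "i = 0") auto

lemma permutes_pos: "\<sigma> permutes {1..n} \<Longrightarrow> i \<in> {1..n} \<Longrightarrow> \<sigma> i \<in> {1..(n::nat)}"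
  using permutes_in_image[of \<sigma> "{1..n}" i] by simp

lemma zero_not_in_xs: "nf_ok n k xs \<sigma> l \<Longrightarrow> 0 \<notin> set xs"
  by (auto simp: nf_ok_def)

text \<open>The partner of X is the closure of the lower ends of its uncut strands. Reducedness
  makes it admissible: the class of such an end contains neither 0 nor the end of another uncut
  strand. Hence the closed sets of the upper row form exactly the domain of the relation.\<close>

lemma nf_rel_domain:
  assumes red: "nf_reduced n k xs \<sigma> l" and X: "X \<subseteq> {1..n}" "closed_under k X"
  shows "(X, {y \<in> {1..n}. \<exists>i \<in> X - set xs. sim l (\<sigma> i) y}) \<in> nf_rel n k xs \<sigma> l"
proof -
  define Y where "Y = {y \<in> {1..n}. \<exists>i \<in> X - set xs. sim l (\<sigma> i) y}"
  have ok: "nf_ok n k xs \<sigma> l" and l: "pairs_upto n l" using red by (auto simp: nf_reduced_def nf_ok_def)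
  note \<sigma> = nf_ok_permutes[OF ok]
  have "closed_under l Y"
  proof (rule closed_under_simI[OF l])
    fix a b assume ab: "a \<in> Y" "a \<le> n" "b \<le> n" "sim l a b"
    then obtain i where i: "i \<in> X" "i \<notin> set xs" "sim l (\<sigma> i) a" by (auto simp: Y_def)
    then have ib: "sim l (\<sigma> i) b" using ab(4) sim_trans by blast
    have iN: "i \<in> {1..n}" using i(1) X by blast
    have "b \<noteq> 0"
    proof
      assume "b = 0"
      then have "sim l (\<sigma> i) (\<sigma> 0)" using ib permutes_zero[OF \<sigma>] by simp
      then have "i = 0" using nf_reduced_lower[OF red, of i 0] iN i(2) zero_not_in_xs[OF ok] by simp
      then show False using iN by simp
    qed
    then show "b \<in> Y" using ib i(1,2) ab(3) by (auto simp: Y_def)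
  qed
  moreover have "i \<in> X \<longleftrightarrow> \<sigma> i \<in> Y" if i: "i \<in> {1..n} - set xs" for i
  proof
    assume "i \<in> X"
    then have "i \<in> X - set xs" using i by simp
    then show "\<sigma> i \<in> Y" using permutes_pos[OF \<sigma>, of i] i sim_refl unfolding Y_def by blast
  next
    assume "\<sigma> i \<in> Y"
    then obtain j where j: "j \<in> X" "j \<notin> set xs" "sim l (\<sigma> j) (\<sigma> i)" by (auto simp: Y_def)
    moreover have "j \<in> {1..n}" using j(1) X by blast
    ultimately have "j = i" using nf_reduced_lower[OF red, of j i] i by simp
    then show "i \<in> X" using j(1) by simp
  qed
  moreover have "Y \<subseteq> {1..n}" by (auto simp: Y_def)
  ultimately show ?thesis using X unfolding Y_def[symmetric] by (simp add: nf_rel_def)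
qed

text \<open>The same construction upwards: X is the closure of the uncut strands that end in
  Y.\<close>

lemma nf_rel_range:
  assumes red: "nf_reduced n k xs \<sigma> l" and Y: "Y \<subseteq> {1..n}" "closed_under l Y"
  shows "\<exists>X. (X, Y) \<in> nf_rel n k xs \<sigma> l"
proof -
  define X where "X = {x \<in> {1..n}. \<exists>i \<in> {1..n} - set xs. \<sigma> i \<in> Y \<and> sim k i x}"
  have ok: "nf_ok n k xs \<sigma> l" and k: "pairs_upto n k" using red by (auto simp: nf_reduced_def nf_ok_def)
  have "closed_under k X"
  proof (rule closed_under_simI[OF k])
    fix a b assume ab: "a \<in> X" "a \<le> n" "b \<le> n" "sim k a b"
    then obtain i where i: "i \<in> {1..n}" "i \<notin> set xs" "\<sigma> i \<in> Y" "sim k i a" by (auto simp: X_def)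
    then have ib: "sim k i b" using ab(4) sim_trans by blast
    have "b \<noteq> 0"
    proof
      assume "b = 0"
      then show False
        using nf_reduced_upper[OF red, of i 0] ib i(1,2) zero_not_in_xs[OF ok] by simp
    qed
    then show "b \<in> X" using ib i ab(3) by (auto simp: X_def)
  qed
  moreover have "i \<in> X \<longleftrightarrow> \<sigma> i \<in> Y" if i: "i \<in> {1..n} - set xs" for i
  proof
    assume "\<sigma> i \<in> Y"
    then show "i \<in> X" using i sim_refl unfolding X_def by blast
  next
    assume "i \<in> X"
    then obtain j where j: "j \<in> {1..n}" "j \<notin> set xs" "\<sigma> j \<in> Y" "sim k j i" by (auto simp: X_def)
    then have "j = i" using nf_reduced_upper[OF red, of j i] i by simp
    then show "\<sigma> i \<in> Y" using j(3) by simp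
  qed
  moreover have "X \<subseteq> {1..n}" by (auto simp: X_def)
  ultimately have "(X, Y) \<in> nf_rel n k xs \<sigma> l" using Y by (simp add: nf_rel_def)
  then show ?thesis ..
qed

text \<open>The classes are recovered from domain and range. A set closed under \<open>k'\<close>
  lies in the common domain, hence is closed under \<open>k\<close>, and an inclusion between
  families of closed sets reverses to one between the equivalence relations.\<close>

lemma nf_rel_sim_eq:
  assumes red: "nf_reduced n k xs \<sigma> l" "nf_reduced n k' xs' \<sigma>' l'"
    and eq: "nf_rel n k xs \<sigma> l = nf_rel n k' xs' \<sigma>' l'"
  shows "i \<le> n \<Longrightarrow> j \<le> n \<Longrightarrow> sim k i j \<Longrightarrow> sim k' i j"
    "i \<le> n \<Longrightarrow> j \<le> n \<Longrightarrow> sim l i j \<Longrightarrow> sim l' i j"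
proof -
  have p: "pairs_upto n k'" "pairs_upto n l'" using red(2) by (auto simp: nf_reduced_def nf_ok_def)
  show "sim k' i j" if "i \<le> n" "j \<le> n" "sim k i j"
  proof (rule simI[OF p(1) that(1,2)])
    fix X assume "X \<subseteq> {1..n}" "closed_under k' X"
    then have "closed_under k X" using nf_rel_domain[OF red(2)] unfolding eq[symmetric] by (auto simp: nf_rel_def)
    then show "i \<in> X \<longleftrightarrow> j \<in> X" using that(3) by (simp add: sim_def)
  qed
  show "sim l' i j" if "i \<le> n" "j \<le> n" "sim l i j"
  proof (rule simI[OF p(2) that(1,2)])
    fix X assume "X \<subseteq> {1..n}" "closed_under l' X"
    then have "closed_under l X" using nf_rel_range[OF red(2)] unfolding eq[symmetric] by (auto simp: nf_rel_def)
    then show "i \<in> X \<longleftrightarrow> j \<in> X" using that(3) by (simp add: sim_def)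
  qed
qed

text \<open>The relation is tested on the upper class of \<open>i\<close>. The partner given by
  \<open>nf_rel_domain\<close> consists of the lower classes of uncut strands from that class, and
  it must contain \<sigma>' i because the second form leaves strand \<open>i\<close> uncut.\<close>

lemma nf_rel_match:
  assumes red: "nf_reduced n k xs \<sigma> l" "nf_reduced n k' xs' \<sigma>' l'"
    and eq: "nf_rel n k xs \<sigma> l = nf_rel n k' xs' \<sigma>' l'" and i: "i \<in> {1..n} - set xs'"
  shows "\<exists>j \<in> {1..n} - set xs. sim k j i \<and> sim l (\<sigma> j) (\<sigma>' i)"
proof -
  have ok: "nf_ok n k xs \<sigma> l" and k: "pairs_upto n k" and ok': "nf_ok n k' xs' \<sigma>' l'"
    using red by (auto simp: nf_reduced_def nf_ok_def)
  define X where "X = {x \<in> {1..n}. sim k i x}"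
  define Y where "Y = {y \<in> {1..n}. \<exists>j \<in> X - set xs. sim l (\<sigma> j) y}"
  have "closed_under k X"
  proof (rule closed_under_simI[OF k])
    fix a b assume ab: "a \<in> X" "a \<le> n" "b \<le> n" "sim k a b"
    then have ib: "sim k i b" using sim_trans unfolding X_def by blast
    have "b \<noteq> 0"
    proof
      assume "b = 0"
      then have "sim k' i 0" using nf_rel_sim_eq(1)[OF red eq, of i 0] ib i by simp
      then show False
        using nf_reduced_upper[OF red(2), of i 0] i zero_not_in_xs[OF ok'] by simp
    qed
    then show "b \<in> X" using ib ab(3) by (simp add: X_def)
  qed
  moreover have XN: "X \<subseteq> {1..n}" by (auto simp: X_def)
  ultimately have "(X, Y) \<in> nf_rel n k xs \<sigma> l" unfolding Y_def by (intro nf_rel_domain[OF red(1)])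
  then have "(X, Y) \<in> nf_rel n k' xs' \<sigma>' l'" using eq by simp
  then have "i \<in> X \<longleftrightarrow> \<sigma>' i \<in> Y" using i unfolding nf_rel_def by blast
  moreover have "i \<in> X" using i by (simp add: X_def)
  ultimately obtain j where "j \<in> X" "j \<notin> set xs" "sim l (\<sigma> j) (\<sigma>' i)" by (auto simp: Y_def)
  moreover from this(1) have "j \<in> {1..n}" "sim k j i" using sim_sym by (auto simp: X_def)
  ultimately show ?thesis by blast
qed

lemma sim_transpose: "sim l a b \<Longrightarrow> sim l (transpose a b x) x"
  using sim_sym[of l a b] by (auto simp: transpose_def)

lemma saturated_alt:
  "saturated \<alpha> S \<longleftrightarrow> S \<subseteq> \<Union>\<alpha> \<and> (\<forall>B\<in>\<alpha>. \<forall>x\<in>B. \<forall>y\<in>B. x \<in> S \<longleftrightarrow> y \<in> S)"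
  unfolding saturated_def by (intro conj_cong refl ball_cong) blast

text \<open>Each transversal block keeps one strand, from a chosen upper point to a chosen lower
  point, and all other strands are cut. Pairs within a row attach the remaining points of a block,
  and pairs with 0 mark the rook dots.\<close>

lemma diag_rel_eq_nf_rel:
  assumes \<alpha>: "\<alpha> \<in> rook_partitions n"
  shows "\<exists>k xs \<sigma> l. nf_ok n k xs \<sigma> l \<and> nf_rel n k xs \<sigma> l = diag_rel \<alpha>"
proof -
  have disj: "B = C" if "B \<in> \<alpha>" "C \<in> \<alpha>" "x \<in> B" "x \<in> C" for B C x
    using \<alpha> that by (auto simp: rook_partitions_def disjoint_def)
  have bounds: "i \<in> {1..n}" if "B \<in> \<alpha>" "Upper i \<in> B \<or> Lower i \<in> B" for B i
  proof -
    have "B \<subseteq> points n" using \<alpha> that(1) by (simp add: rook_partitions_def Sup_le_iff)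
    then show ?thesis using that(2) by (auto simp: points_def)
  qed
  have kernel: "\<exists>k. pairs_upto n k \<and> (\<forall>X. X \<subseteq> {1..n} \<longrightarrow> closed_under k X \<longleftrightarrow>
      (\<forall>i \<in> X. f i \<in> \<Union>\<alpha>) \<and> (\<forall>B \<in> \<alpha>. \<forall>i j. f i \<in> B \<longrightarrow> f j \<in> B \<longrightarrow> i \<in> X \<longrightarrow> j \<in> X))"
    if f: "f = Upper \<or> f = Lower" for f
  proof -
    \<comment> \<open>A closed subset of {1..n} never contains 0, so the pairs with 0 keep it away
      from the rook dots.\<close>
    define U where "U = {(i, j) \<in> {1..n} \<times> {1..n}. \<exists>B \<in> \<alpha>. f i \<in> B \<and> f j \<in> B} \<union> {0} \<times> {i \<in> {1..n}. f i \<notin> \<Union>\<alpha>}"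
    have "U \<subseteq> {..n} \<times> {..n}" by (auto simp: U_def)
    moreover from this have "finite U" by (rule finite_subset) simp
    then obtain k where k: "set k = U" using finite_list by blast
    ultimately have "pairs_upto n k" by (simp add: pairs_upto_def)
    moreover have "closed_under k X \<longleftrightarrow>
      (\<forall>i \<in> X. f i \<in> \<Union>\<alpha>) \<and> (\<forall>B \<in> \<alpha>. \<forall>i j. f i \<in> B \<longrightarrow> f j \<in> B \<longrightarrow> i \<in> X \<longrightarrow> j \<in> X)" (is "?L \<longleftrightarrow> ?R")
      if X: "X \<subseteq> {1..n}" for X
    proof
      assume L: ?L
      then have mem: "a \<in> X \<longleftrightarrow> b \<in> X" if "(a, b) \<in> U" for a b using that k by (auto simp: closed_under_def)
      have "f i \<in> \<Union>\<alpha>" if "i \<in> X" for i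
      proof (rule ccontr)
        assume "f i \<notin> \<Union>\<alpha>"
        then have "(0, i) \<in> U" using that X by (auto simp: U_def)
        then have "0 \<in> X" using mem that by blast
        then show False using X by auto
      qed
      moreover have "j \<in> X" if "B \<in> \<alpha>" "f i \<in> B" "f j \<in> B" "i \<in> X" for B i j
      proof -
        have "i \<in> {1..n}" "j \<in> {1..n}" using bounds[OF that(1)] that(2,3) f by auto
        then have "(i, j) \<in> U" using that by (auto simp: U_def)
        then show ?thesis using mem that(4) by blast
      qed
      ultimately show ?R by blast
    next
      assume R: ?R
      have "a \<in> X \<longleftrightarrow> b \<in> X" if "(a, b) \<in> U" for a b
      proof -
        consider B where "B \<in> \<alpha>" "f a \<in> B" "f b \<in> B" | "a = 0" "f b \<notin> \<Union>\<alpha>"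
          using \<open>(a, b) \<in> U\<close> unfolding U_def by blast
        then show ?thesis
        proof cases
          case 1
          then show ?thesis using R by blast
        next
          case 2
          then have "0 \<notin> X" "b \<notin> X" using R X by auto
          then show ?thesis using 2(1) by simp
        qed
      qed
      then show ?L using k by (auto simp: closed_under_def)
    qed
    ultimately show ?thesis by blast
  qed
  obtain k where k: "pairs_upto n k"
    "\<And>X. X \<subseteq> {1..n} \<Longrightarrow> closed_under k X \<longleftrightarrow> (\<forall>i \<in> X. Upper i \<in> \<Union>\<alpha>) \<and>
       (\<forall>B \<in> \<alpha>. \<forall>i j. Upper i \<in> B \<longrightarrow> Upper j \<in> B \<longrightarrow> i \<in> X \<longrightarrow> j \<in> X)"
    using kernel[of Upper] by blast
  obtain l where l: "pairs_upto n l"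
    "\<And>X. X \<subseteq> {1..n} \<Longrightarrow> closed_under l X \<longleftrightarrow> (\<forall>i \<in> X. Lower i \<in> \<Union>\<alpha>) \<and>
       (\<forall>B \<in> \<alpha>. \<forall>i j. Lower i \<in> B \<longrightarrow> Lower j \<in> B \<longrightarrow> i \<in> X \<longrightarrow> j \<in> X)"
    using kernel[of Lower] by blast
  define T where "T = {B \<in> \<alpha>. (\<exists>i. Upper i \<in> B) \<and> (\<exists>j. Lower j \<in> B)}"
  define f h where "f B = (SOME i. Upper i \<in> B)" and "h B = (SOME j. Lower j \<in> B)" for B
  have fh: "Upper (f B) \<in> B" "Lower (h B) \<in> B" "B \<in> \<alpha>" if "B \<in> T" for B
    using that someI_ex[of "\<lambda>i. Upper i \<in> B"] someI_ex[of "\<lambda>i. Lower i \<in> B"]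
    by (auto simp: T_def f_def h_def)
  have fN: "f B \<in> {1..n}" "h B \<in> {1..n}" if "B \<in> T" for B
    using bounds[OF fh(3)[OF that]] fh[OF that] by blast+
  have "inj_on f T" using fh disj by (intro inj_onI) metis
  then have inv: "inv_into T f (f B) = B" if "B \<in> T" for B using that by simp
  have "inj_on h T" using fh disj by (intro inj_onI) metis
  then have "inj_on (h \<circ> inv_into T f) (f ` T)"
    using inv by (auto simp: inj_on_def)
  moreover have "f ` T \<subseteq> {1..n}" "(h \<circ> inv_into T f) ` f ` T \<subseteq> {1..n}"
    using fN inv by (auto simp only: o_apply image_iff subset_iff)
  \<comment> \<open>Only the values at the chosen upper points are prescribed. They are distinct
    because the blocks are disjoint, and the values at cut strands are arbitrary.\<close>
  ultimately obtain \<sigma> where \<sigma>: "\<sigma> permutes {1..n}" "\<And>a. a \<in> f ` T \<Longrightarrow> \<sigma> a = (h \<circ> inv_into T f) a"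
    using extend_to_permutation[of "{1..n}" "f ` T" "h \<circ> inv_into T f"] by blast
  then have \<sigma>f: "\<sigma> (f B) = h B" if "B \<in> T" for B using that inv by simp
  obtain xs where xs: "set xs = {1..n} - f ` T" using finite_list[of "{1..n} - f ` T"] by auto
  have alive: "i \<in> {1..n} - set xs \<longleftrightarrow> (\<exists>B \<in> T. i = f B)" for i
    using xs fN(1) by auto
  have "(X, Y) \<in> nf_rel n k xs \<sigma> l \<longleftrightarrow> (X, Y) \<in> diag_rel \<alpha>" for X Y
  proof (cases "X \<subseteq> {1..n} \<and> Y \<subseteq> {1..n}")
    case False
    then show ?thesis using diag_rel_subset[OF \<alpha>, of X Y] by (auto simp: nf_rel_def)
  next
    case True
    define S where "S = Upper ` X \<union> Lower ` Y"
    have S: "Upper i \<in> S \<longleftrightarrow> i \<in> X" "Lower i \<in> S \<longleftrightarrow> i \<in> Y" for i by (auto simp: S_def)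
    have nf: "(X, Y) \<in> nf_rel n k xs \<sigma> l \<longleftrightarrow> closed_under k X \<and> closed_under l Y \<and>
        (\<forall>B \<in> T. f B \<in> X \<longleftrightarrow> h B \<in> Y)"
      using True alive \<sigma>f unfolding nf_rel_def mem_Collect_eq case_prod_conv by metis
    show ?thesis
    proof
      assume "(X, Y) \<in> diag_rel \<alpha>"
      then have s: "saturated \<alpha> S" by (simp add: diag_rel_def S_def)
      then have sub: "S \<subseteq> \<Union>\<alpha>" by (simp add: saturated_alt)
      have sat: "x \<in> S \<longleftrightarrow> y \<in> S" if "B \<in> \<alpha>" "x \<in> B" "y \<in> B" for B x y
        using s that unfolding saturated_alt by blast
      have "Upper i \<in> \<Union>\<alpha>" if "i \<in> X" for i using subsetD[OF sub, of "Upper i"] that S by simp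
      moreover have "j \<in> X" if "B \<in> \<alpha>" "Upper i \<in> B" "Upper j \<in> B" "i \<in> X" for B i j
        using sat[OF that(1-3)] that(4) S by simp
      ultimately have "closed_under k X" using True k(2)[of X] by blast
      moreover have "Lower i \<in> \<Union>\<alpha>" if "i \<in> Y" for i using subsetD[OF sub, of "Lower i"] that S by simp
      moreover have "j \<in> Y" if "B \<in> \<alpha>" "Lower i \<in> B" "Lower j \<in> B" "i \<in> Y" for B i j
        using sat[OF that(1-3)] that(4) S by simp
      ultimately have "closed_under k X" "closed_under l Y" using True l(2)[of Y] by blast+
      moreover have "f B \<in> X \<longleftrightarrow> h B \<in> Y" if "B \<in> T" for B
        using sat[OF fh(3)[OF that] fh(1)[OF that] fh(2)[OF that]] S by simp
      ultimately show "(X, Y) \<in> nf_rel n k xs \<sigma> l" unfolding nf by blast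
    next
      assume "(X, Y) \<in> nf_rel n k xs \<sigma> l"
      then have cl: "closed_under k X" "closed_under l Y" and t: "\<And>B. B \<in> T \<Longrightarrow> f B \<in> X \<longleftrightarrow> h B \<in> Y"
        unfolding nf by blast+
      have kX: "\<And>i. i \<in> X \<Longrightarrow> Upper i \<in> \<Union>\<alpha>"
        "\<And>B i j. B \<in> \<alpha> \<Longrightarrow> Upper i \<in> B \<Longrightarrow> Upper j \<in> B \<Longrightarrow> i \<in> X \<longleftrightarrow> j \<in> X"
        using k(2)[of X] True cl by blast+
      have lY: "\<And>i. i \<in> Y \<Longrightarrow> Lower i \<in> \<Union>\<alpha>"
        "\<And>B i j. B \<in> \<alpha> \<Longrightarrow> Lower i \<in> B \<Longrightarrow> Lower j \<in> B \<Longrightarrow> i \<in> Y \<longleftrightarrow> j \<in> Y"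
        using l(2)[of Y] True cl by blast+
      \<comment> \<open>The strand of a transversal block compares its two representatives only;
        closure within each row spreads this to the whole block.\<close>
      have mixed: "i \<in> X \<longleftrightarrow> j \<in> Y" if B: "B \<in> \<alpha>" "Upper i \<in> B" "Lower j \<in> B" for B i j
      proof -
        have "B \<in> T" using B by (auto simp: T_def)
        then show ?thesis using fh[of B] kX(2)[OF B(1,2)] lY(2)[OF B(1,3)] t[of B] by blast
      qed
      have "x \<in> S \<longleftrightarrow> y \<in> S" if B: "B \<in> \<alpha>" "x \<in> B" "y \<in> B" for B x y
      proof -
        have "B \<subseteq> points n" using \<alpha> B(1) by (simp add: rook_partitions_def Sup_le_iff)
        then have pts: "x \<in> range Upper \<union> range Lower" "y \<in> range Upper \<union> range Lower"
          using B(2,3) by (auto simp: points_def)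
        consider i j where "x = Upper i" "y = Upper j" | i j where "x = Upper i" "y = Lower j"
          | i j where "x = Lower i" "y = Upper j" | i j where "x = Lower i" "y = Lower j"
          using pts by blast
        then show ?thesis
        proof cases
          case 1
          then show ?thesis using kX(2)[of B i j] B S by simp
        next
          case 2
          then show ?thesis using mixed[of B i j] B S by simp
        next
          case 3
          then show ?thesis using mixed[of B j i] B S by simp
        next
          case 4
          then show ?thesis using lY(2)[of B i j] B S by simp
        qed
      qed
      moreover have "S \<subseteq> \<Union>\<alpha>" using kX(1) lY(1) by (auto simp: S_def)
      ultimately have "saturated \<alpha> S" unfolding saturated_alt by blast
      then show "(X, Y) \<in> diag_rel \<alpha>" by (simp add: diag_rel_def S_def)
    qed
  qed
  then have "nf_rel n k xs \<sigma> l = diag_rel \<alpha>" by (intro Set.set_eqI) (simp only: split_paired_all)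
  moreover have "nf_ok n k xs \<sigma> l" using k(1) l(1) \<sigma>(1) xs by (auto simp: nf_ok_def)
  ultimately show ?thesis by blast
qed

section \<open>Consequences of the relations\<close>

text \<open>The first assumption says that the monoid is a quotient of the presented one, the second
  that it is fine enough to determine \<open>word_rel\<close>. The second allows permutations and
  relations to be read off from elements.\<close>

locale rook_model =
  fixes n :: nat and g :: "letter \<Rightarrow> 'm::monoid_mult"
  assumes relations: "(u, v) \<in> relations n \<Longrightarrow> prod_list (map g u) = prod_list (map g v)"
    and sound: "set u \<subseteq> alphabet n \<Longrightarrow> set v \<subseteq> alphabet n \<Longrightarrow>
      prod_list (map g u) = prod_list (map g v) \<Longrightarrow> word_rel n u = word_rel n v"
begin

abbreviation "ev w \<equiv> prod_list (map g w)"
abbreviation "s i \<equiv> g (Ls i)"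
abbreviation "e i \<equiv> g (Le i)"
abbreviation "q i \<equiv> g (Lq i)"
abbreviation "o' i \<equiv> g (Lo i)"
abbreviation "sp is \<equiv> prod_list (map (\<lambda>i. s i) is)"

lemma relation:
  assumes "(u, v) \<in> all_relations" "set u \<subseteq> alphabet n" "set v \<subseteq> alphabet n"
  shows "ev u = ev v"
  using assms by (intro relations) (auto simp: relations_def)

section \<open>The Coxeter presentation of the symmetric group\<close>

lemma s_s: "i \<in> {1..<n} \<Longrightarrow> s i * s i = 1"
  using relation[OF all_relations.ss[of i]] by (simp add: alphabet_def)

lemma s_s_left: "i \<in> {1..<n} \<Longrightarrow> s i * (s i * x) = x"
  by (simp add: mult.assoc[symmetric] s_s)

lemma s_commute: "i \<in> {1..<n} \<Longrightarrow> j \<in> {1..<n} \<Longrightarrow> i + 1 < j \<or> j + 1 < i \<Longrightarrow> s i * s j = s j * s i"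
  using relation[OF all_relations.ss_comm[of i j]] by (auto simp: alphabet_def)

lemma s_braid: "i \<in> {1..<n} \<Longrightarrow> i + 1 < n \<Longrightarrow> s i * (s (i + 1) * s i) = s (i + 1) * (s i * s (i + 1))"
  using relation[OF all_relations.ss_braid[of i "i + 1"]] by (simp add: alphabet_def)

lemma sp_commute:
  assumes "\<And>i. i \<in> set is \<Longrightarrow> s i * x = x * s i"
  shows "sp is * x = x * sp is"
  using assms
proof (induction "is")
  case (Cons i "is")
  then have "sp (i # is) * x = s i * (x * sp is)" by (simp add: mult.assoc)
  also have "\<dots> = x * sp (i # is)" using Cons.prems by (simp add: mult.assoc[symmetric])
  finally show ?case .
qed simp

text \<open>Coset enumeration. A letter far below the descending word commutes with it, the next
  lower letter extends it, and its last letter cancels. A letter \<open>j\<close> further inside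
  passes to the left by a braid relation and becomes \<open>s (j - 1)\<close>.\<close>

lemma descending_word_times_s:
  assumes m: "Suc m \<le> n" and k: "1 \<le> k" "k \<le> Suc m" and j: "1 \<le> j" "j \<le> m"
  shows "\<exists>u k'. set u \<subseteq> {1..<m} \<and> 1 \<le> k' \<and> k' \<le> Suc m \<and>
    sp (rev [k..<Suc m]) * s j = sp u * sp (rev [k'..<Suc m])"
proof -
  consider "j + 1 < k" | "j + 1 = k" | "j = k" | "k < j" by linarith
  then show ?thesis
  proof cases
    case 1
    have "sp (rev [k..<Suc m]) * s j = s j * sp (rev [k..<Suc m])"
      using 1 j m by (intro sp_commute s_commute) auto
    then show ?thesis using 1 j k by (intro exI[of _ "[j]"] exI[of _ k]) auto
  next
    case 2
    then have "[j..<Suc m] = j # [k..<Suc m]" using j by (simp add: upt_conv_Cons del: upt_Suc)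
    then show ?thesis using 2 j by (intro exI[of _ "[]"] exI[of _ j]) (auto simp del: upt_Suc)
  next
    case 3
    then have "[k..<Suc m] = k # [Suc k..<Suc m]" using j by (simp add: upt_conv_Cons del: upt_Suc)
    then show ?thesis using 3 j m
      by (intro exI[of _ "[]"] exI[of _ "Suc k"]) (auto simp: mult.assoc s_s simp del: upt_Suc)
  next
    case 4
    define i where "i = j - 1"
    have ij: "j = i + 1" "k \<le> i" using 4 by (auto simp: i_def)
    define A where "A = sp (rev [j + 1..<Suc m])"
    define B where "B = sp (rev [k..<i])"
    have "[k..<Suc m] = [k..<i] @ [i..<Suc m]"
      using ij j upt_add_eq_append[of k i "Suc m - i"] by (simp del: upt_Suc)
    also have "[i..<Suc m] = i # j # [j + 1..<Suc m]"
      using ij j by (simp add: upt_conv_Cons del: upt_Suc)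
    finally have D: "sp (rev [k..<Suc m]) = A * (s j * (s i * B))"
      by (simp add: A_def B_def mult.assoc del: upt_Suc)
    have Bj: "B * s j = s j * B"
      unfolding B_def using ij j m k by (intro sp_commute s_commute) auto
    have Ai: "A * s i = s i * A"
      unfolding A_def using ij j m k by (intro sp_commute s_commute) auto
    have "sp (rev [k..<Suc m]) * s j = A * (s j * (s i * s j)) * B"
      by (simp only: D mult.assoc Bj)
    also have "s j * (s i * s j) = s i * (s j * s i)"
      using s_braid[of i] ij j k m by simp
    also have "A * (s i * (s j * s i)) * B = s i * sp (rev [k..<Suc m])"
      by (simp only: D mult.assoc[symmetric] Ai)
    finally show ?thesis using ij j k
      by (intro exI[of _ "[i]"] exI[of _ k]) (auto simp del: upt_Suc)
  qed
qed

lemma word_eq_descending: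
  assumes m: "Suc m \<le> n" and "set w \<subseteq> {1..<Suc m}"
  shows "\<exists>u k. set u \<subseteq> {1..<m} \<and> 1 \<le> k \<and> k \<le> Suc m \<and> sp w = sp u * sp (rev [k..<Suc m])"
  using assms(2)
proof (induction w rule: rev_induct)
  case Nil
  show ?case by (intro exI[of _ "[]"] exI[of _ "Suc m"]) auto
next
  case (snoc j w)
  then obtain u k where u: "set u \<subseteq> {1..<m}" "1 \<le> k" "k \<le> Suc m" "sp w = sp u * sp (rev [k..<Suc m])"
    by auto
  have "1 \<le> j" "j \<le> m" using snoc.prems by auto
  then obtain u' k' where u': "set u' \<subseteq> {1..<m}" "1 \<le> k'" "k' \<le> Suc m"
    "sp (rev [k..<Suc m]) * s j = sp u' * sp (rev [k'..<Suc m])"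
    using descending_word_times_s[OF m u(2,3)] by blast
  have "sp (w @ [j]) = sp (u @ u') * sp (rev [k'..<Suc m])"
    using u(4) u'(4) by (simp add: mult.assoc del: upt_Suc)
  then show ?case using u u' by (intro exI[of _ "u @ u'"] exI[of _ k']) auto
qed

text \<open>The relation of a word in the letters s takes preimages, and testing it on singletons
  reveals the permutation. Outside {1..n} both permutations are the identity.\<close>

lemma perm_of_eq_if_sp_eq:
  assumes "set u \<subseteq> {1..<n}" "set v \<subseteq> {1..<n}" "sp u = sp v"
  shows "perm_of u = perm_of v"
proof
  fix x
  have "ev (map Ls u) = ev (map Ls v)" using assms(3) by (simp add: comp_def)
  then have eq: "word_rel n (map Ls u) = word_rel n (map Ls v)"
    using assms by (intro sound) (auto simp: alphabet_def)
  have *: "perm_of u -` Z = perm_of v -` Z" if "Z \<subseteq> {1..n}" for Z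
  proof -
    have "(perm_of u -` Z, Z) \<in> word_rel n (map Ls v)"
      using that word_rel_map_Ls[OF assms(1), of "perm_of u -` Z" Z] eq by simp
    then show ?thesis using word_rel_map_Ls[OF assms(2), of "perm_of u -` Z" Z] by simp
  qed
  show "perm_of u x = perm_of v x"
  proof (cases "x \<in> {1..n}")
    case True
    then have "perm_of u x \<in> {1..n}" by (simp only: permutes_in_image[OF perm_of_permutes[OF assms(1)]])
    then have eq': "perm_of u -` {perm_of u x} = perm_of v -` {perm_of u x}" by (intro *) simp
    have "x \<in> perm_of v -` {perm_of u x}" unfolding eq'[symmetric] by simp
    then show ?thesis by simp
  next
    case False
    then show ?thesis
      using permutes_not_in[OF perm_of_permutes[OF assms(1)]] permutes_not_in[OF perm_of_permutes[OF assms(2)]]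
      by simp
  qed
qed

text \<open>Each word splits into a word in smaller letters and a descending word. The image of the
  last point determines the descending word, which then cancels from the permutations, and the
  induction hypothesis applies to the rest.\<close>

lemma sp_eq_if_perm_of_eq:
  assumes "m \<le> n" "set u \<subseteq> {1..<m}" "set v \<subseteq> {1..<m}" "perm_of u = perm_of v"
  shows "sp u = sp v"
  using assms
proof (induction m arbitrary: u v)
  case 0
  then show ?case by simp
next
  case (Suc m)
  note upt_Suc [simp del]
  obtain u' k where u: "set u' \<subseteq> {1..<m}" "1 \<le> k" "k \<le> Suc m" "sp u = sp u' * sp (rev [k..<Suc m])"
    using word_eq_descending Suc.prems by meson
  obtain v' l where v: "set v' \<subseteq> {1..<m}" "1 \<le> l" "l \<le> Suc m" "sp v = sp v' * sp (rev [l..<Suc m])"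
    using word_eq_descending Suc.prems by meson
  have *: "perm_of w = perm_of (rev [k..<Suc m]) \<circ> perm_of w'"
    if "set w \<subseteq> {1..<Suc m}" "set w' \<subseteq> {1..<m}" "1 \<le> k" "sp w = sp w' * sp (rev [k..<Suc m])" for w w' k
  proof -
    have "perm_of w = perm_of (w' @ rev [k..<Suc m])"
      using that Suc.prems(1) by (intro perm_of_eq_if_sp_eq) (auto simp del: upt_Suc)
    then show ?thesis by (simp add: perm_of_append)
  qed
  have fix_last: "perm_of w' (Suc m) = Suc m" if "set w' \<subseteq> {1..<m}" for w'
    using perm_of_permutes[OF that] by (simp add: permutes_def)
  have eq: "perm_of (rev [k..<Suc m]) \<circ> perm_of u' = perm_of (rev [l..<Suc m]) \<circ> perm_of v'"
    using *[OF Suc.prems(2) u(1,2,4)] *[OF Suc.prems(3) v(1,2,4)] Suc.prems(4) by argo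
  have "k = l" using fun_cong[OF eq, of "Suc m"] fix_last u v perm_of_rev_upt by (simp del: upt_Suc)
  moreover have "inj (perm_of (rev [k..<Suc m]))"
    using perm_of_permutes[of "rev [k..<Suc m]" k "Suc m"] by (intro permutes_inj) simp
  ultimately have "perm_of u' = perm_of v'" using eq by (simp add: fun_eq_iff inj_eq del: upt_Suc)
  then show ?case using Suc.IH[of u' v'] Suc.prems(1) u v \<open>k = l\<close> by simp
qed

text \<open>By \<open>sp_eq_if_perm_of_eq\<close> the choice of the word is immaterial. If \<sigma>
  is not a permutation of {1..n}, the value is unspecified.\<close>

definition P :: "(nat \<Rightarrow> nat) \<Rightarrow> 'm" where
  "P \<sigma> = sp (SOME is. set is \<subseteq> {1..<n} \<and> perm_of is = \<sigma>)"

lemma P_perm_of: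
  assumes "set is \<subseteq> {1..<n}"
  shows "P (perm_of is) = sp is"
proof -
  let ?w = "SOME w. set w \<subseteq> {1..<n} \<and> perm_of w = perm_of is"
  have "set ?w \<subseteq> {1..<n} \<and> perm_of ?w = perm_of is"
    using assms by (intro someI[of "\<lambda>w. set w \<subseteq> {1..<n} \<and> perm_of w = perm_of is"]) simp
  then show ?thesis unfolding P_def using assms by (intro sp_eq_if_perm_of_eq[of n]) auto
qed

lemma P_comp:
  assumes "\<sigma> permutes {1..n}" "\<tau> permutes {1..n}"
  shows "P (\<tau> \<circ> \<sigma>) = P \<sigma> * P \<tau>"
proof -
  obtain u v where u: "set u \<subseteq> {1..<n}" "perm_of u = \<sigma>" and v: "set v \<subseteq> {1..<n}" "perm_of v = \<tau>"
    using assms permutes_interval_obtains_word by metis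
  have "P (perm_of (u @ v)) = sp (u @ v)" using u v by (intro P_perm_of) auto
  then show ?thesis using u v P_perm_of by (simp add: perm_of_append) (metis P_perm_of)
qed

lemma P_id: "P id = 1"
  using P_perm_of[of "[]"] by simp

lemma P_transpose: "i \<in> {1..<n} \<Longrightarrow> P (transpose i (i + 1)) = s i"
  using P_perm_of[of "[i]"] by simp

lemma P_inv:
  assumes "\<sigma> permutes {1..n}"
  shows "P (inv_into UNIV \<sigma>) * P \<sigma> = 1" "P \<sigma> * P (inv_into UNIV \<sigma>) = 1"
  using P_comp[OF assms permutes_inv[OF assms]] P_comp[OF permutes_inv[OF assms] assms]
  by (simp_all add: permutes_inv_o[OF assms] P_id)

lemma conjugate:
  assumes "\<And>i k. i \<in> {1..<n} \<Longrightarrow> k \<in> {1..n} \<Longrightarrow> f k * s i = s i * f (transpose i (i + 1) k)"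
    and \<sigma>: "\<sigma> permutes {1..n}" and "k \<in> {1..n}"
  shows "f k * P \<sigma> = P \<sigma> * f (\<sigma> k)"
proof -
  obtain u where u: "set u \<subseteq> {1..<n}" "perm_of u = \<sigma>"
    using \<sigma> permutes_interval_obtains_word by metis
  have "f k * sp u = sp u * f (perm_of u k)" using u(1) \<open>k \<in> {1..n}\<close>
  proof (induction u arbitrary: k)
    case (Cons i u)
    have "transpose i (i + 1) k \<in> {1..n}" using transpose_Suc_mem_iff[of i n k] Cons.prems by simp
    then have "f (transpose i (i + 1) k) * sp u = sp u * f (perm_of u (transpose i (i + 1) k))"
      using Cons by simp
    moreover have "f k * sp (i # u) = s i * (f (transpose i (i + 1) k) * sp u)"
      using assms(1)[of i k] Cons.prems by (simp add: mult.assoc[symmetric])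
    ultimately show ?case by (simp add: mult.assoc)
  qed simp
  then show ?thesis using u P_perm_of by metis
qed

section \<open>Conjugation of the letters by permutations\<close>

lemma s_braid_conj_q: "i \<in> {1..<n} \<Longrightarrow> i + 1 < n \<Longrightarrow> s i * (s (i + 1) * q i) = q (i + 1) * (s i * s (i + 1))"
  using relation[OF all_relations.ssq[of i "i + 1"]] by (simp add: alphabet_def)

lemma conjugate_letter:
  assumes f: "f = Le \<or> f = Lo" and "i \<in> {1..<n}" "k \<in> {1..n}"
  shows "g (f k) * s i = s i * g (f (transpose i (i + 1) k))"
proof -
  have comm: "s i * g (f j) = g (f j) * s i" if "j \<notin> {i, i + 1}" "j \<in> {1..n}" for j
    using f relation[OF all_relations.se_comm[OF that(1)]] relation[OF all_relations.so_comm[OF that(1)]] that assms(2)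
    by (auto simp: alphabet_def)
  have up: "s i * g (f i) = g (f (i + 1)) * s i"
    using f relation[OF all_relations.se[of i]] relation[OF all_relations.so[of i]] assms(2)
    by (auto simp: alphabet_def)
  consider "k = i" | "k = i + 1" | "k \<notin> {i, i + 1}" by blast
  then show ?thesis
  proof cases
    case 1
    \<comment> \<open>The defining relation only leads from \<open>i\<close> to
      \<open>i + 1\<close>; multiplying by the involution \<open>s i\<close> on both sides reverses
      it.\<close>
    have "s i * (s i * g (f i)) * s i = s i * (g (f (i + 1)) * s i * s i)"
      by (simp only: up mult.assoc)
    then have "g (f i) * s i = s i * g (f (i + 1))"
      using s_s[OF assms(2)] s_s_left[OF assms(2)] by (simp add: mult.assoc)
    then show ?thesis using 1 by simp
  next
    case 2
    then show ?thesis using up by simp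
  next
    case 3
    then show ?thesis using comm[of k] assms(3) by simp
  qed
qed

lemma e_P: "\<sigma> permutes {1..n} \<Longrightarrow> i \<in> {1..n} \<Longrightarrow> e i * P \<sigma> = P \<sigma> * e (\<sigma> i)"
  by (rule conjugate) (rule conjugate_letter, auto)

lemma o_P: "\<sigma> permutes {1..n} \<Longrightarrow> i \<in> {1..n} \<Longrightarrow> o' i * P \<sigma> = P \<sigma> * o' (\<sigma> i)"
  by (rule conjugate) (rule conjugate_letter, auto)

lemma P_commute:
  assumes "\<sigma> permutes {a..b}" "1 \<le> a" "b \<le> n" "\<And>i. i \<in> {a..<b} \<Longrightarrow> s i * x = x * s i"
  shows "P \<sigma> * x = x * P \<sigma>"
proof -
  obtain u where u: "set u \<subseteq> {a..<b}" "perm_of u = \<sigma>"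
    using assms(1) permutes_interval_obtains_word by metis
  have "sp u * x = x * sp u" using u(1) assms(4) by (intro sp_commute) auto
  moreover have "set u \<subseteq> {1..<n}" using u(1) assms(2,3) by (auto simp: subset_iff)
  then have "P \<sigma> = sp u" using u P_perm_of[of u] by simp
  ultimately show ?thesis by simp
qed

lemma P_left_cancel: "\<sigma> permutes {1..n} \<Longrightarrow> P \<sigma> * x = P \<sigma> * y \<Longrightarrow> x = y"
  by (metis P_inv(1) mult.assoc mult_1)

lemma P_inv_comp:
  assumes "\<sigma> permutes {1..n}" "\<tau> permutes {1..n}"
  shows "P (inv_into UNIV (\<tau> \<circ> \<sigma>)) = P (inv_into UNIV \<tau>) * P (inv_into UNIV \<sigma>)"
  using P_comp[OF permutes_inv[OF assms(2)] permutes_inv[OF assms(1)]]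
    o_inv_distrib[OF permutes_bij[OF assms(2)] permutes_bij[OF assms(1)]] by simp

lemma P_transpose_P:
  assumes "\<sigma> permutes {1..n}" "i \<in> {1..n}" "j \<in> {1..n}"
  shows "P (transpose i j) * P \<sigma> = P \<sigma> * P (transpose (\<sigma> i) (\<sigma> j))"
proof -
  have t: "transpose i j permutes {1..n}" "transpose (\<sigma> i) (\<sigma> j) permutes {1..n}"
    using assms permutes_in_image[OF assms(1)] by (intro permutes_swap_id; blast)+
  have "\<sigma> \<circ> transpose i j = transpose (\<sigma> i) (\<sigma> j) \<circ> \<sigma>"
    using injD[OF permutes_inj[OF assms(1)]] by (auto simp: fun_eq_iff transpose_def)
  then show ?thesis using P_comp[OF t(1) assms(1)] P_comp[OF assms(1) t(2)] by simp
qed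

text \<open>The choice of \<open>\<sigma>\<close> is irrelevant because \<open>q\<^sub>1\<close> commutes with all permutations fixing \<open>1\<close> and \<open>2\<close>.\<close>

definition qp :: "nat \<Rightarrow> nat \<Rightarrow> 'm" where
  "qp i j = (let \<sigma> = (SOME \<sigma>. \<sigma> permutes {1..n} \<and> \<sigma> 1 = i \<and> \<sigma> 2 = j)
    in P (inv_into UNIV \<sigma>) * (q 1 * P \<sigma>))"

lemma qp_eq:
  assumes n: "2 \<le> n" and \<sigma>: "\<sigma> permutes {1..n}"
  shows "P (inv_into UNIV \<sigma>) * (q 1 * P \<sigma>) = qp (\<sigma> 1) (\<sigma> 2)"
proof -
  define \<tau> where "\<tau> = (SOME \<tau>. \<tau> permutes {1..n} \<and> \<tau> 1 = \<sigma> 1 \<and> \<tau> 2 = \<sigma> 2)"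
  have \<tau>: "\<tau> permutes {1..n} \<and> \<tau> 1 = \<sigma> 1 \<and> \<tau> 2 = \<sigma> 2"
    unfolding \<tau>_def by (rule someI[of _ \<sigma>]) (use \<sigma> in simp)
  define \<rho> where "\<rho> = inv_into UNIV \<sigma> \<circ> \<tau>"
  have \<rho>N: "\<rho> permutes {1..n}"
    unfolding \<rho>_def using \<tau> \<sigma> by (intro permutes_compose permutes_inv) auto
  have \<rho>: "\<rho> permutes {3..n}"
  proof (rule permutes_superset[OF \<rho>N])
    fix x assume "x \<in> {1..n} - {3..n}"
    then have "x = 1 \<or> x = 2" by auto
    then show "\<rho> x = x" using \<tau> by (auto simp: \<rho>_def permutes_inverses[OF \<sigma>])
  qed
  have \<tau>\<rho>: "\<tau> = \<sigma> \<circ> \<rho>" by (simp add: \<rho>_def fun_eq_iff permutes_inverses[OF \<sigma>])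
  have comm: "P \<rho> * q 1 = q 1 * P \<rho>"
  proof (rule P_commute[OF \<rho>])
    fix i assume "i \<in> {3..<n}"
    then show "s i * q 1 = q 1 * s i"
      using relation[OF all_relations.sq_comm[of i 1]] n by (auto simp: alphabet_def)
  qed auto
  have "qp (\<sigma> 1) (\<sigma> 2) = P (inv_into UNIV \<tau>) * (q 1 * P \<tau>)"
    by (simp only: qp_def \<tau>_def Let_def)
  also have "\<dots> = P (inv_into UNIV \<sigma>) * (P (inv_into UNIV \<rho>) * (q 1 * (P \<rho> * P \<sigma>)))"
    unfolding \<tau>\<rho> using P_inv_comp[OF \<rho>N \<sigma>] P_comp[OF \<rho>N \<sigma>] by (simp add: mult.assoc)
  also have "q 1 * (P \<rho> * P \<sigma>) = P \<rho> * (q 1 * P \<sigma>)" using comm by (metis mult.assoc)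
  also have "P (inv_into UNIV \<rho>) * (P \<rho> * (q 1 * P \<sigma>)) = q 1 * P \<sigma>"
    using P_inv(1)[OF \<rho>N] by (simp add: mult.assoc[symmetric])
  finally show ?thesis by simp
qed

lemma obtain_pair:
  assumes "i \<in> {1..n}" "j \<in> {1..n}" "i \<noteq> j"
  obtains \<sigma> where "\<sigma> permutes {1..n}" "\<sigma> 1 = i" "\<sigma> 2 = j" "2 \<le> n"
proof -
  obtain \<sigma> where "\<sigma> permutes {1..n}" "\<And>t. t < length [i, j] \<Longrightarrow> \<sigma> (Suc t) = [i, j] ! t"
    using permutation_of_distinct[of "[i, j]" n] assms by auto
  moreover from this(2)[of 0] this(2)[of 1] have "\<sigma> 1 = i" "\<sigma> 2 = j" by (simp_all add: numeral_2_eq_2)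
  moreover have "2 \<le> n" using assms by auto
  ultimately show thesis using that by blast
qed

lemma obtain_triple:
  assumes "distinct [i, j, k]" "set [i, j, k] \<subseteq> {1..n}"
  obtains \<sigma> where "\<sigma> permutes {1..n}" "\<sigma> 1 = i" "\<sigma> 2 = j" "\<sigma> 3 = k" "3 \<le> n"
proof -
  obtain \<sigma> where "\<sigma> permutes {1..n}" "\<And>t. t < length [i, j, k] \<Longrightarrow> \<sigma> (Suc t) = [i, j, k] ! t"
    using permutation_of_distinct[OF assms] by auto
  moreover from this(2)[of 0] this(2)[of 1] this(2)[of 2] have "\<sigma> 1 = i" "\<sigma> 2 = j" "\<sigma> 3 = k"
    by (simp_all add: numeral_2_eq_2 numeral_3_eq_3)
  moreover have "3 \<le> n" using card_mono[OF _ assms(2)] assms(1) by simp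
  ultimately show thesis using that by blast
qed

lemma obtain_quadruple:
  assumes "distinct [i, j, k, l]" "set [i, j, k, l] \<subseteq> {1..n}"
  obtains \<sigma> where "\<sigma> permutes {1..n}" "\<sigma> 1 = i" "\<sigma> 2 = j" "\<sigma> 3 = k" "\<sigma> 4 = l" "4 \<le> n"
proof -
  obtain \<sigma> where "\<sigma> permutes {1..n}" "\<And>t. t < length [i, j, k, l] \<Longrightarrow> \<sigma> (Suc t) = [i, j, k, l] ! t"
    using permutation_of_distinct[OF assms] by auto
  moreover from this(2)[of 0] this(2)[of 1] this(2)[of 2] this(2)[of 3]
  have "\<sigma> 1 = i" "\<sigma> 2 = j" "\<sigma> 3 = k" "\<sigma> 4 = l" by (simp_all add: numeral_eq_Suc)
  moreover have "4 \<le> n" using card_mono[OF _ assms(2)] assms(1) by simp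
  ultimately show thesis using that by blast
qed

lemma qp_P:
  assumes "\<sigma> permutes {1..n}" "i \<in> {1..n}" "j \<in> {1..n}" "i \<noteq> j"
  shows "qp i j * P \<sigma> = P \<sigma> * qp (\<sigma> i) (\<sigma> j)"
proof -
  obtain \<tau> where \<tau>: "\<tau> permutes {1..n}" "\<tau> 1 = i" "\<tau> 2 = j" and n: "2 \<le> n"
    using obtain_pair[OF assms(2-4)] by blast
  have "qp (\<sigma> i) (\<sigma> j) = P (inv_into UNIV (\<sigma> \<circ> \<tau>)) * (q 1 * P (\<sigma> \<circ> \<tau>))"
    using qp_eq[OF n permutes_compose[OF \<tau>(1) assms(1)]] \<tau> by simp
  also have "\<dots> = P (inv_into UNIV \<sigma>) * (P (inv_into UNIV \<tau>) * (q 1 * P \<tau>)) * P \<sigma>"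
    using P_inv_comp[OF \<tau>(1) assms(1)] P_comp[OF \<tau>(1) assms(1)] by (simp add: mult.assoc)
  also have "\<dots> = P (inv_into UNIV \<sigma>) * qp i j * P \<sigma>"
    using qp_eq[OF n \<tau>(1)] \<tau>(2,3) by simp
  finally show ?thesis using P_inv(2)[OF assms(1)] by (simp add: mult.assoc[symmetric])
qed

text \<open>Induction along the row: \<open>s (i + 1) * s i\<close> carries the points i, i + 1 to i
  + 1, i + 2, and by the mixed relation between s and q it conjugates \<open>q i\<close> into
  \<open>q (i + 1)\<close>.\<close>

lemma qp_Suc: "i \<in> {1..<n} \<Longrightarrow> qp i (i + 1) = q i"
proof (induction i)
  case 0
  then show ?case by simp
next
  case (Suc i)
  show ?case
  proof (cases "i = 0")
    case True
    then show ?thesis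
      using qp_eq[OF _ permutes_id] Suc.prems
      by (simp add: P_id[unfolded id_def] P_id numeral_2_eq_2)
  next
    case False
    define j where "j = i + 1"
    have i: "i \<in> {1..<n}" and j: "j \<in> {1..<n}" and ij: "j = i + 1"
      using Suc.prems False by (auto simp: j_def)
    define \<sigma> where "\<sigma> = transpose i (i + 1) \<circ> transpose j (j + 1)"
    have p: "transpose i (i + 1) permutes {1..n}" "transpose j (j + 1) permutes {1..n}"
      using i j by (auto intro!: permutes_swap_id)
    have \<sigma>: "\<sigma> permutes {1..n}" "P \<sigma> = s j * s i"
      unfolding \<sigma>_def using p P_comp[OF p(2,1)] P_transpose[OF i] P_transpose[OF j]
      by (auto intro: permutes_compose)
    have \<sigma>i: "\<sigma> i = j" "\<sigma> (i + 1) = j + 1" by (simp_all add: \<sigma>_def ij)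
    have qi: "qp i (i + 1) = q i" using Suc.IH i by simp
    have "P \<sigma> * qp j (j + 1) = q i * (s j * s i)"
      using qp_P[OF \<sigma>(1), of i "i + 1"] i \<sigma>(2) \<sigma>i qi by simp
    also have "\<dots> = P \<sigma> * (s i * (s j * (q i * (s j * s i))))"
      using s_s_left[OF i] s_s_left[OF j] \<sigma>(2) by (simp add: mult.assoc)
    also have "s i * (s j * (q i * (s j * s i))) = s i * (s j * q i) * (s j * s i)"
      by (simp add: mult.assoc)
    also have "s i * (s j * q i) = q j * (s i * s j)"
      using s_braid_conj_q[OF i] j ij by simp
    also have "q j * (s i * s j) * (s j * s i) = q j"
      using s_s_left[OF j] s_s[OF i] by (simp add: mult.assoc)
    finally show ?thesis using P_left_cancel[OF \<sigma>(1)] by (simp add: j_def)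
  qed
qed

section \<open>Identities between letters with arbitrary indices\<close>

lemma e_e: "i \<in> {1..n} \<Longrightarrow> e i * e i = e i"
  using relation[OF all_relations.ee[of i]] by (simp add: alphabet_def)

lemma e_commute: "i \<in> {1..n} \<Longrightarrow> j \<in> {1..n} \<Longrightarrow> e i * e j = e j * e i"
  using relation[OF all_relations.ee_comm[of i j]] by (cases "i = j") (simp_all add: alphabet_def)

lemma o_o: "i \<in> {1..n} \<Longrightarrow> o' i * o' i = o' i"
  using relation[OF all_relations.oo[of i]] by (simp add: alphabet_def)

lemma o_commute: "i \<in> {1..n} \<Longrightarrow> j \<in> {1..n} \<Longrightarrow> o' i * o' j = o' j * o' i"
  using relation[OF all_relations.oo_comm[of i j]] by (cases "i = j") (simp_all add: alphabet_def)

lemma o_e_commute: "i \<in> {1..n} \<Longrightarrow> j \<in> {1..n} \<Longrightarrow> i \<noteq> j \<Longrightarrow> e j * o' i = o' i * e j"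
  using relation[OF all_relations.oe_comm[of i j]] by (simp add: alphabet_def)

lemma o_e_o: "i \<in> {1..n} \<Longrightarrow> o' i * (e i * o' i) = o' i"
  using relation[OF all_relations.oeo[of i]] by (simp add: alphabet_def)

lemma e_o_e: "i \<in> {1..n} \<Longrightarrow> e i * (o' i * e i) = e i"
  using relation[OF all_relations.eoe[of i]] by (simp add: alphabet_def)

text \<open>An identity between letters with small indices is transported to arbitrary indices by
  conjugating it with a permutation.\<close>

definition intertwines :: "(nat \<Rightarrow> nat) \<Rightarrow> 'm \<Rightarrow> 'm \<Rightarrow> bool" where
  "intertwines \<sigma> x y \<longleftrightarrow> \<sigma> permutes {1..n} \<and> x * P \<sigma> = P \<sigma> * y"

lemma transport: "x = y \<Longrightarrow> intertwines \<sigma> x x' \<Longrightarrow> intertwines \<sigma> y y' \<Longrightarrow> x' = y'"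
  unfolding intertwines_def by (metis P_left_cancel)

lemma intertwines_mult: "intertwines \<sigma> x x' \<Longrightarrow> intertwines \<sigma> y y' \<Longrightarrow> intertwines \<sigma> (x * y) (x' * y')"
  unfolding intertwines_def by (metis mult.assoc)

lemma intertwines_gens:
  assumes "\<sigma> permutes {1..n}" "i \<in> {1..n}" "\<sigma> i = i'"
  shows "intertwines \<sigma> (e i) (e i')" "intertwines \<sigma> (o' i) (o' i')"
    "j \<in> {1..n} \<Longrightarrow> \<sigma> j = j' \<Longrightarrow> i \<noteq> j \<Longrightarrow> intertwines \<sigma> (qp i j) (qp i' j')"
    "j \<in> {1..n} \<Longrightarrow> \<sigma> j = j' \<Longrightarrow> intertwines \<sigma> (P (transpose i j)) (P (transpose i' j'))"
  using assms e_P o_P qp_P P_transpose_P unfolding intertwines_def by blast+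

lemmas transport_intros = intertwines_mult intertwines_gens

lemma qp_1_2: "2 \<le> n \<Longrightarrow> qp 1 2 = q 1"
  using qp_Suc[of 1] by (simp add: numeral_2_eq_2)

lemma qp_2_3: "3 \<le> n \<Longrightarrow> qp 2 3 = q 2"
  using qp_Suc[of 2] by (simp add: numeral_3_eq_3 numeral_2_eq_2)

lemma P_1_2: "2 \<le> n \<Longrightarrow> P (transpose 1 2) = s 1"
  using P_transpose[of 1] by (simp add: numeral_2_eq_2)

lemma q_s: "i \<in> {1..<n} \<Longrightarrow> q i * s i = q i"
  using relation[OF all_relations.qs1[of i]] relation[OF all_relations.qs2[of i]] by (simp add: alphabet_def)

lemma s_q: "i \<in> {1..<n} \<Longrightarrow> s i * q i = q i"
  using relation[OF all_relations.qs2[of i]] by (simp add: alphabet_def)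

text \<open>Conjugation by \<open>s 1\<close> exchanges the two indices, and \<open>q 1\<close>
  absorbs \<open>s 1\<close> on either side.\<close>

lemma qp_sym:
  assumes "i \<in> {1..n}" "j \<in> {1..n}" "i \<noteq> j"
  shows "qp i j = qp j i"
proof -
  obtain \<sigma> where \<sigma>: "\<sigma> permutes {1..n}" "\<sigma> 1 = i" "\<sigma> 2 = j" "2 \<le> n"
    using obtain_pair[OF assms] by blast
  have t: "transpose 1 2 permutes {1..n}" using \<sigma>(4) by (intro permutes_swap_id) auto
  have 1: "1 \<in> {1..<n}" using \<sigma>(4) by simp
  have "qp 1 2 * s 1 = s 1 * qp 2 1"
    using qp_P[OF t, of 1 2] \<sigma>(4) P_1_2 by simp
  then have "s 1 * (s 1 * qp 2 1) = s 1 * q 1" using q_s[OF 1] qp_1_2 \<sigma>(4) by simp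
  then have "qp 1 2 = qp 2 1" using s_s_left[OF 1] s_q[OF 1] qp_1_2 \<sigma>(4) by simp
  then show ?thesis
    by (rule transport[where \<sigma> = \<sigma>]) (use \<sigma> in \<open>intro transport_intros; simp\<close>)+
qed

lemma qp_idem:
  assumes "i \<in> {1..n}" "j \<in> {1..n}" "i \<noteq> j"
  shows "qp i j * qp i j = qp i j"
proof -
  obtain \<sigma> where \<sigma>: "\<sigma> permutes {1..n}" "\<sigma> 1 = i" "\<sigma> 2 = j" "2 \<le> n"
    using obtain_pair[OF assms] by blast
  have "qp 1 2 * qp 1 2 = qp 1 2"
    using relation[OF all_relations.qq[of 1]] \<sigma>(4) qp_1_2 by (simp add: alphabet_def)
  then show ?thesis
    by (rule transport[where \<sigma> = \<sigma>]) (use \<sigma> in \<open>intro transport_intros; simp\<close>)+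
qed

lemma qp_P_transpose:
  assumes "i \<in> {1..n}" "j \<in> {1..n}" "i \<noteq> j"
  shows "qp i j * P (transpose i j) = qp i j"
proof -
  obtain \<sigma> where \<sigma>: "\<sigma> permutes {1..n}" "\<sigma> 1 = i" "\<sigma> 2 = j" "2 \<le> n"
    using obtain_pair[OF assms] by blast
  have "qp 1 2 * P (transpose 1 2) = qp 1 2"
    using q_s[of 1] \<sigma>(4) qp_1_2 P_1_2 by simp
  then show ?thesis
    by (rule transport[where \<sigma> = \<sigma>]) (use \<sigma> in \<open>intro transport_intros; simp\<close>)+
qed

lemma e_e_P_transpose:
  assumes "i \<in> {1..n}" "j \<in> {1..n}" "i \<noteq> j"
  shows "e i * (e j * P (transpose i j)) = e i * e j"
proof -
  obtain \<sigma> where \<sigma>: "\<sigma> permutes {1..n}" "\<sigma> 1 = i" "\<sigma> 2 = j" "2 \<le> n"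
    using obtain_pair[OF assms] by blast
  have "e 1 * (e 2 * P (transpose 1 2)) = e 1 * e 2"
    using relation[OF all_relations.ees[of 1]] \<sigma>(4) P_1_2 by (simp add: alphabet_def numeral_2_eq_2)
  then show ?thesis
    by (rule transport[where \<sigma> = \<sigma>]) (use \<sigma> in \<open>intro transport_intros; simp\<close>)+
qed

lemma qp_e_qp:
  assumes "i \<in> {1..n}" "j \<in> {1..n}" "i \<noteq> j"
  shows "qp i j * (e i * qp i j) = qp i j" "e i * (qp i j * e i) = e i"
proof -
  obtain \<sigma> where \<sigma>: "\<sigma> permutes {1..n}" "\<sigma> 1 = i" "\<sigma> 2 = j" "2 \<le> n"
    using obtain_pair[OF assms] by blast
  have "qp 1 2 * (e 1 * qp 1 2) = qp 1 2"
    using relation[OF all_relations.qeq[of 1 1]] \<sigma>(4) qp_1_2 by (simp add: alphabet_def)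
  then show "qp i j * (e i * qp i j) = qp i j"
    by (rule transport[where \<sigma> = \<sigma>]) (use \<sigma> in \<open>intro transport_intros; simp\<close>)+
  have "e 1 * (qp 1 2 * e 1) = e 1"
    using relation[OF all_relations.eqe[of 1 1]] \<sigma>(4) qp_1_2 by (simp add: alphabet_def)
  then show "e i * (qp i j * e i) = e i"
    by (rule transport[where \<sigma> = \<sigma>]) (use \<sigma> in \<open>intro transport_intros; simp\<close>)+
qed

lemma qp_o:
  assumes "i \<in> {1..n}" "j \<in> {1..n}" "i \<noteq> j"
  shows "qp i j * o' i = o' i * o' j"
proof -
  obtain \<sigma> where \<sigma>: "\<sigma> permutes {1..n}" "\<sigma> 1 = i" "\<sigma> 2 = j" "2 \<le> n"
    using obtain_pair[OF assms] by blast
  have "qp 1 2 * o' 1 = o' 1 * o' 2"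
    using relation[OF all_relations.qo1[of 1]] relation[OF all_relations.qo2[of 1]] \<sigma>(4) qp_1_2
    by (simp add: alphabet_def numeral_2_eq_2)
  then show ?thesis
    by (rule transport[where \<sigma> = \<sigma>]) (use \<sigma> in \<open>intro transport_intros; simp\<close>)+
qed

lemma qp_o_commute:
  assumes "i \<in> {1..n}" "j \<in> {1..n}" "i \<noteq> j" "k \<in> {1..n}"
  shows "qp i j * o' k = o' k * qp i j"
proof -
  obtain \<sigma> where \<sigma>: "\<sigma> permutes {1..n}" "\<sigma> 1 = i" "\<sigma> 2 = j" "2 \<le> n"
    using obtain_pair[OF assms(1-3)] by blast
  \<comment> \<open>The point \<open>k\<close> may coincide with \<open>i\<close> or
    \<open>j\<close>, so its preimage is taken instead of prescribing a third value of
    \<sigma>.\<close>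
  define l where "l = inv_into UNIV \<sigma> k"
  have l: "l \<in> {1..n}" "\<sigma> l = k"
    unfolding l_def using assms(4) permutes_in_image[OF permutes_inv[OF \<sigma>(1)]]
    by (auto simp only: permutes_inverses[OF \<sigma>(1)])
  have "qp 1 2 * o' l = o' l * qp 1 2"
    using relation[OF all_relations.qo_comm[of 1 l]] \<sigma>(4) l(1) qp_1_2 by (simp add: alphabet_def)
  then show ?thesis
    by (rule transport[where \<sigma> = \<sigma>]) (use \<sigma> l in \<open>intro transport_intros; simp\<close>)+
qed

lemma qp_e_commute:
  assumes "i \<in> {1..n}" "j \<in> {1..n}" "k \<in> {1..n}" "distinct [i, j, k]"
  shows "e k * qp i j = qp i j * e k"
proof -
  obtain \<sigma> where \<sigma>: "\<sigma> permutes {1..n}" "\<sigma> 1 = i" "\<sigma> 2 = j" "\<sigma> 3 = k" "3 \<le> n"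
    using obtain_triple[OF assms(4)] assms(1-3) by auto
  have "e 3 * qp 1 2 = qp 1 2 * e 3"
    using relation[OF all_relations.qe_comm[of 3 1]] \<sigma>(5) qp_1_2 by (simp add: alphabet_def)
  then show ?thesis
    by (rule transport[where \<sigma> = \<sigma>]) (use \<sigma> in \<open>intro transport_intros; simp\<close>)+
qed

lemma qp_commute_disjoint:
  assumes "i \<in> {1..n}" "j \<in> {1..n}" "k \<in> {1..n}" "l \<in> {1..n}" "distinct [i, j, k, l]"
  shows "qp i j * qp k l = qp k l * qp i j"
proof -
  obtain \<sigma> where \<sigma>: "\<sigma> permutes {1..n}" "\<sigma> 1 = i" "\<sigma> 2 = j" "\<sigma> 3 = k" "\<sigma> 4 = l" "4 \<le> n"
    using obtain_quadruple[OF assms(5)] assms(1-4) by auto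
  have "qp 3 4 = q 3" using qp_Suc[of 3] \<sigma>(6) by simp
  then have "qp 1 2 * qp 3 4 = qp 3 4 * qp 1 2"
    using relation[OF all_relations.qq_comm[of 1 3]] \<sigma>(6) qp_1_2 by (simp add: alphabet_def)
  then show ?thesis
    by (rule transport[where \<sigma> = \<sigma>]) (use \<sigma> in \<open>intro transport_intros; simp\<close>)+
qed

text \<open>For the second identity, \<open>q 1 * q 2 * s 1\<close> is computed twice: moving
  \<open>s 1\<close> to the left across \<open>q 2\<close> gives \<open>q 1 * qp 1 3\<close>,
  whereas moving \<open>q 1\<close> next to \<open>s 1\<close> absorbs it.\<close>

lemma qp_adjacent:
  assumes "i \<in> {1..n}" "j \<in> {1..n}" "k \<in> {1..n}" "distinct [i, j, k]"
  shows "qp i j * qp j k = qp j k * qp i j" "qp i j * qp j k = qp i j * qp i k"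
proof -
  obtain \<sigma> where \<sigma>: "\<sigma> permutes {1..n}" "\<sigma> 1 = i" "\<sigma> 2 = j" "\<sigma> 3 = k" "3 \<le> n"
    using obtain_triple[OF assms(4)] assms(1-3) by auto
  have comm: "q 1 * q 2 = q 2 * q 1"
    using relation[OF all_relations.qq_comm[of 1 2]] \<sigma>(5) by (simp add: alphabet_def)
  then have "qp 1 2 * qp 2 3 = qp 2 3 * qp 1 2"
    using \<sigma>(5) qp_1_2 qp_2_3 by simp
  then show "qp i j * qp j k = qp j k * qp i j"
    by (rule transport[where \<sigma> = \<sigma>]) (use \<sigma> in \<open>intro transport_intros; simp\<close>)+
  have t: "transpose 1 2 permutes {1..n}" using \<sigma>(5) by (intro permutes_swap_id) auto
  have "qp 2 3 * P (transpose 1 2) = P (transpose 1 2) * qp 1 3"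
    using qp_P[OF t, of 2 3] \<sigma>(5) by (simp add: transpose_def)
  then have "q 2 * s 1 = s 1 * qp 1 3" using P_1_2 qp_2_3 \<sigma>(5) by simp
  then have "q 1 * q 2 * s 1 = q 1 * s 1 * qp 1 3" by (simp add: mult.assoc)
  then have "q 1 * q 2 * s 1 = q 1 * qp 1 3" using q_s[of 1] \<sigma>(5) by simp
  moreover have "q 1 * q 2 * s 1 = q 1 * q 2" using q_s[of 1] \<sigma>(5) unfolding comm by (simp add: mult.assoc)
  ultimately have "qp 1 2 * qp 2 3 = qp 1 2 * qp 1 3" using \<sigma>(5) qp_1_2 qp_2_3 by simp
  then show "qp i j * qp j k = qp i j * qp i k"
    by (rule transport[where \<sigma> = \<sigma>]) (use \<sigma> in \<open>intro transport_intros; simp\<close>)+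
qed

text \<open>The value on the diagonal makes pairs harmless whose two entries coincide after a
  renaming of indices.\<close>

definition qq :: "nat \<Rightarrow> nat \<Rightarrow> 'm" where
  "qq i j = (if i = j then 1 else if i = 0 then o' j else if j = 0 then o' i else qp i j)"

lemma qq_same [simp]: "qq i i = 1"
  by (simp add: qq_def)

lemma qq_sym: "i \<le> n \<Longrightarrow> j \<le> n \<Longrightarrow> qq i j = qq j i"
  using qp_sym[of i j] by (auto simp: qq_def)

lemma qq_idem: "i \<le> n \<Longrightarrow> j \<le> n \<Longrightarrow> qq i j * qq i j = qq i j"
  using qp_idem[of i j] o_o[of i] o_o[of j] by (auto simp: qq_def)

lemma qq_P:
  assumes "\<sigma> permutes {1..n}" "i \<le> n" "j \<le> n"
  shows "qq i j * P \<sigma> = P \<sigma> * qq (\<sigma> i) (\<sigma> j)"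
proof -
  have "\<sigma> 0 = 0" using permutes_not_in[OF assms(1), of 0] by simp
  moreover have "\<sigma> k = 0 \<longleftrightarrow> k = 0" if "k \<le> n" for k
    using permutes_in_image[OF assms(1), of k] that \<open>\<sigma> 0 = 0\<close> by (cases "k = 0") auto
  moreover have "\<sigma> i = \<sigma> j \<longleftrightarrow> i = j" by (simp add: inj_eq[OF permutes_inj[OF assms(1)]])
  ultimately show ?thesis
    using qp_P[OF assms(1), of i j] o_P[OF assms(1), of i] o_P[OF assms(1), of j] assms(2,3)
    by (auto simp: qq_def)
qed

lemma qq_commute:
  assumes "i \<le> n" "j \<le> n" "k \<le> n" "l \<le> n"
  shows "qq i j * qq k l = qq k l * qq i j"
proof -
  have qp: "qp i j * qp k l = qp k l * qp i j"
    if ijkl: "i \<in> {1..n}" "j \<in> {1..n}" "k \<in> {1..n}" "l \<in> {1..n}" "i \<noteq> j" "k \<noteq> l" for i j k l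
  proof -
    consider "i = k \<and> j = l \<or> i = l \<and> j = k" | "distinct [i, j, k, l]" | "j = k" "distinct [i, j, l]"
      | "j = l" "distinct [i, j, k]" | "i = k" "distinct [j, i, l]" | "i = l" "distinct [j, i, k]"
      using ijkl by auto
    then show ?thesis
      by cases (use ijkl qp_sym[of i j] qp_sym[of k l] qp_commute_disjoint[of i j k l] qp_adjacent(1)[of i j l]
         qp_adjacent(1)[of i j k] qp_adjacent(1)[of j i l] qp_adjacent(1)[of j i k] in auto)
  qed
  show ?thesis
    using assms qp[of i j k l] qp_o_commute[of i j k] qp_o_commute[of i j l] qp_o_commute[of k l i]
      qp_o_commute[of k l j] o_commute[of i k] o_commute[of i l] o_commute[of j k] o_commute[of j l]
    by (auto simp: qq_def)
qed

text \<open>For three distinct positive indices this is \<open>qp_adjacent\<close>. If one of them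
  is 0, it is a form of the relation that turns a product of q and o into two letters o, so the rook
  dots obey the rule of an ordinary class.\<close>

lemma qq_trans:
  assumes "i \<le> n" "j \<le> n" "k \<le> n"
  shows "qq i j * qq j k = qq i j * qq i k"
proof -
  consider "i = j" | "j = k" | "i = k" | "distinct [i, j, k]" by auto
  then show ?thesis
  proof cases
    case 3
    then show ?thesis using qq_idem[of i j] qq_sym[of i j] assms by simp
  next
    case 4
    note d = 4
    consider "i = 0" | "j = 0" | "k = 0" | "i \<in> {1..n}" "j \<in> {1..n}" "k \<in> {1..n}"
      using assms by (cases "i = 0"; cases "j = 0"; cases "k = 0") auto
    then show ?thesis
    proof cases
      case 1
      then show ?thesis using d assms qp_o[of j k] qp_o_commute[of j k j] by (simp add: qq_def)
    next
      case 2
      then show ?thesis using d assms qp_o[of i k] qp_o_commute[of i k i] by (simp add: qq_def)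
    next
      case 3
      then show ?thesis using d assms qp_o[of i j] qp_o[of j i] qp_sym[of i j] o_commute[of i j]
        by (simp add: qq_def)
    next
      case 4
      then show ?thesis using d qp_adjacent(2)[of i j k] by (simp add: qq_def)
    qed
  qed (simp_all add: qq_idem assms)
qed

lemma e_qq_commute:
  assumes "i \<in> {1..n}" "j \<le> n" "k \<le> n" "i \<noteq> j" "i \<noteq> k"
  shows "e i * qq j k = qq j k * e i"
  using assms qp_e_commute[of j k i] o_e_commute[of j i] o_e_commute[of k i] by (auto simp: qq_def)

lemma e_qq_e:
  assumes "i \<in> {1..n}" "j \<le> n" "i \<noteq> j"
  shows "e i * (qq i j * e i) = e i"
  using assms qp_e_qp(2)[of i j] e_o_e[of i] by (auto simp: qq_def)

lemma qq_e_qq: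
  assumes "i \<in> {1..n}" "j \<le> n" "i \<noteq> j"
  shows "qq i j * (e i * qq i j) = qq i j"
  using assms qp_e_qp(1)[of i j] o_e_o[of i] by (auto simp: qq_def)

lemma qq_P_transpose:
  assumes "i \<in> {1..n}" "j \<in> {1..n}" 
  shows "qq i j * P (transpose i j) = qq i j"
  using assms qp_P_transpose[of i j] P_id by (auto simp: qq_def)

section \<open>Normal forms of words\<close>

abbreviation "Q l \<equiv> prod_list (map (\<lambda>(i, j). qq i j) l)"
abbreviation "E xs \<equiv> prod_list (map (\<lambda>i. e i) xs)"

definition nf :: "(nat \<times> nat) list \<Rightarrow> nat list \<Rightarrow> (nat \<Rightarrow> nat) \<Rightarrow> (nat \<times> nat) list \<Rightarrow> 'm" where
  "nf k xs \<sigma> l = Q k * (E xs * (P \<sigma> * Q l))"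

section \<open>Absorption rules for products of pairs and of cuts\<close>

lemma Q_qq_commute:
  assumes "pairs_upto n l" "i \<le> n" "j \<le> n"
  shows "Q l * qq i j = qq i j * Q l"
  using assms
proof (induction l)
  case (Cons p l)
  then have "qq (fst p) (snd p) * qq i j = qq i j * qq (fst p) (snd p)" "Q l * qq i j = qq i j * Q l"
    by (simp_all add: qq_commute)
  moreover have "Q (p # l) * qq i j = qq (fst p) (snd p) * (Q l * qq i j)"
    by (simp add: mult.assoc case_prod_unfold)
  ultimately have "Q (p # l) * qq i j = qq i j * qq (fst p) (snd p) * Q l"
    by (simp add: mult.assoc[symmetric])
  then show ?case by (simp add: mult.assoc case_prod_unfold)
qed simp

lemma Q_absorb_mem:
  assumes "pairs_upto n l" "(i, j) \<in> set l"
  shows "Q l * qq i j = Q l"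
  using assms
proof (induction l)
  case (Cons p l)
  show ?case
  proof (cases "(i, j) \<in> set l")
    case True
    then show ?thesis using Cons by (simp add: mult.assoc)
  next
    case False
    then have p: "p = (i, j)" and "i \<le> n" "j \<le> n" using Cons.prems by auto
    then have "Q (p # l) * qq i j = qq i j * (qq i j * Q l)"
      using Q_qq_commute[of l i j] Cons.prems by (simp add: mult.assoc)
    then show ?thesis using p qq_idem[of i j] Cons.prems by (simp add: mult.assoc[symmetric])
  qed
qed simp

text \<open>The points \<open>k\<close> for which \<open>qq i k\<close> is absorbed form a closed
  set, since \<open>qq_trans\<close> allows one more pair of the list to be followed. That set
  contains \<open>i\<close>, hence its whole class.\<close>

lemma Q_absorb:
  assumes "pairs_upto n l" "i \<le> n" "j \<le> n" "sim l i j"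
  shows "Q l * qq i j = Q l"
proof -
  define X where "X = {k. k \<le> n \<and> Q l * qq i k = Q l}"
  have step: "b \<in> X" if "a \<in> X" "(a, b) \<in> set l \<or> (b, a) \<in> set l" for a b
  proof -
    have ab: "a \<le> n" "b \<le> n" using that assms(1) by (auto simp: pairs_upto_def)
    have "Q l * qq a b = Q l"
      using that(2) Q_absorb_mem[OF assms(1), of a b] Q_absorb_mem[OF assms(1), of b a] qq_sym[OF ab]
      by (elim disjE) simp_all
    then have "Q l * qq i b = Q l * qq a b * qq i b" by simp
    also have "\<dots> = Q l * qq i a * qq a b * qq i b"
      using that(1) by (simp add: X_def)
    also have "\<dots> = Q l * (qq i a * qq i b * qq i b)"
      using qq_trans[OF assms(2) ab] by (simp add: mult.assoc)
    also have "qq i a * qq i b * qq i b = qq i a * qq a b"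
      using qq_trans[OF assms(2) ab] qq_idem[OF assms(2) ab(2)] by (simp add: mult.assoc)
    also have "Q l * (qq i a * qq a b) = Q l"
      using that(1) \<open>Q l * qq a b = Q l\<close> by (simp add: X_def mult.assoc[symmetric])
    finally show ?thesis using ab by (simp add: X_def)
  qed
  have "closed_under l X" unfolding closed_under_def using step by blast
  moreover have "i \<in> X" using assms(2) by (simp add: X_def)
  ultimately have "j \<in> X" using assms(4) by (simp add: sim_def)
  then show ?thesis by (simp add: X_def)
qed

lemma Q_absorb_left:
  assumes "pairs_upto n l" "i \<le> n" "j \<le> n" "sim l i j"
  shows "qq i j * Q l = Q l"
  using Q_absorb[OF assms] Q_qq_commute[OF assms(1-3)] by simp

text \<open>Each product absorbs all factors of the other, so both are equal to their common
  product.\<close>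

lemma Q_eqI:
  assumes "pairs_upto n l" "pairs_upto n l'" "\<And>i j. i \<le> n \<Longrightarrow> j \<le> n \<Longrightarrow> sim l i j \<longleftrightarrow> sim l' i j"
  shows "Q l = Q l'"
proof -
  have absorb: "Q k * Q k' = Q k" if "pairs_upto n k" "pairs_upto n k'" "\<And>i j. (i, j) \<in> set k' \<Longrightarrow> sim k i j" for k k'
    using that(2,3)
  proof (induction k')
    case (Cons p k')
    then show ?case using Q_absorb[OF that(1), of "fst p" "snd p"]
      by (cases p) (simp add: mult.assoc[symmetric])
  qed simp
  have comm: "Q l * Q l' = Q l' * Q l" using assms(2)
  proof (induction l')
    case (Cons p l')
    have "Q l * Q (p # l') = qq (fst p) (snd p) * Q l * Q l'"
      using Q_qq_commute[OF assms(1), of "fst p" "snd p"] Cons.prems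
      by (simp add: mult.assoc[symmetric] case_prod_unfold)
    also have "\<dots> = Q (p # l') * Q l" using Cons by (simp add: mult.assoc case_prod_unfold)
    finally show ?case .
  qed simp
  have "Q l * Q l' = Q l"
  proof (rule absorb[OF assms(1,2)])
    fix i j assume "(i, j) \<in> set l'"
    then show "sim l i j" using assms(2,3) sim_mem[of i j l'] by (auto simp: pairs_upto_def)
  qed
  moreover have "Q l' * Q l = Q l'"
  proof (rule absorb[OF assms(2,1)])
    fix i j assume "(i, j) \<in> set l"
    then show "sim l' i j" using assms(1,3) sim_mem[of i j l] by (auto simp: pairs_upto_def)
  qed
  ultimately show ?thesis using comm by simp
qed

lemma E_e_commute:
  assumes "set xs \<subseteq> {1..n}" "i \<in> {1..n}"
  shows "E xs * e i = e i * E xs"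
  using assms(1)
proof (induction xs)
  case (Cons x xs)
  then have "E (x # xs) * e i = e x * e i * E xs" by (simp add: mult.assoc)
  also have "\<dots> = e i * E (x # xs)" using e_commute[of x i] assms(2) Cons.prems by (simp add: mult.assoc)
  finally show ?case .
qed simp

lemma E_absorb:
  assumes "set xs \<subseteq> {1..n}" "i \<in> set xs"
  shows "E xs * e i = E xs"
  using assms
proof (induction xs)
  case (Cons x xs)
  show ?case
  proof (cases "i \<in> set xs")
    case True
    then show ?thesis using Cons by (simp add: mult.assoc)
  next
    case False
    then have "E (x # xs) * e i = e i * (e i * E xs)"
      using Cons.prems E_e_commute[of xs i] by (simp add: mult.assoc)
    then show ?thesis using False Cons.prems e_e[of i] by (simp add: mult.assoc[symmetric])
  qed
qed simp

lemma E_eqI: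
  assumes "set xs = set ys" "set xs \<subseteq> {1..n}"
  shows "E xs = E ys"
proof -
  have absorb: "E xs * E ys = E xs" if "set ys \<subseteq> set xs" "set xs \<subseteq> {1..n}" for xs ys
    using that(1)
  proof (induction ys)
    case (Cons y ys)
    then show ?case using E_absorb[OF that(2), of y] by (simp add: mult.assoc[symmetric])
  qed simp
  have comm: "E xs * E ys = E ys * E xs" if "set ys \<subseteq> {1..n}" for ys
    using that
  proof (induction ys)
    case (Cons y ys)
    have "E xs * E (y # ys) = E xs * e y * E ys" by (simp add: mult.assoc)
    also have "\<dots> = e y * (E xs * E ys)"
      using E_e_commute[OF assms(2), of y] Cons.prems by (simp add: mult.assoc)
    also have "\<dots> = E (y # ys) * E xs" using Cons by (simp add: mult.assoc)
    finally show ?case .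
  qed simp
  show ?thesis using absorb[of ys xs] absorb[of xs ys] comm[of ys] assms by simp
qed

lemma E_qq_commute:
  assumes "set xs \<subseteq> {1..n}" "i \<le> n" "j \<le> n" "i \<notin> set xs" "j \<notin> set xs"
  shows "E xs * qq i j = qq i j * E xs"
  using assms
proof (induction xs)
  case (Cons x xs)
  then have "E (x # xs) * qq i j = e x * qq i j * E xs" by (simp add: mult.assoc)
  also have "\<dots> = qq i j * E (x # xs)" using e_qq_commute[of x i j] Cons.prems by (auto simp: mult.assoc)
  finally show ?case .
qed simp

lemma E_P_transpose_commute:
  assumes "set xs \<subseteq> {1..n}" "i \<in> {1..n}" "j \<in> {1..n}" "i \<notin> set xs" "j \<notin> set xs"
  shows "E xs * P (transpose i j) = P (transpose i j) * E xs"
  using assms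
proof (induction xs)
  case (Cons x xs)
  have t: "transpose i j permutes {1..n}" using assms by (intro permutes_swap_id)
  have "e x * P (transpose i j) = P (transpose i j) * e x"
    using e_P[OF t, of x] Cons.prems by (auto simp: transpose_def)
  moreover have "E (x # xs) * P (transpose i j) = e x * P (transpose i j) * E xs"
    using Cons by (simp add: mult.assoc)
  ultimately show ?case by (simp add: mult.assoc)
qed simp

lemma Q_P:
  assumes "pairs_upto n l" "\<sigma> permutes {1..n}"
  shows "Q l * P \<sigma> = P \<sigma> * Q (map (map_prod \<sigma> \<sigma>) l)"
  using assms(1)
proof (induction l)
  case (Cons p l)
  then have "Q (p # l) * P \<sigma> = qq (fst p) (snd p) * P \<sigma> * Q (map (map_prod \<sigma> \<sigma>) l)"
    by (simp add: mult.assoc case_prod_unfold)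
  also have "\<dots> = P \<sigma> * Q (map (map_prod \<sigma> \<sigma>) (p # l))"
    using qq_P[OF assms(2), of "fst p" "snd p"] Cons.prems by (simp add: mult.assoc case_prod_unfold)
  finally show ?case .
qed simp

section \<open>Moves between normal forms of the same element\<close>

lemma qq_e_shift:
  assumes "i \<in> {1..n}" "j \<in> {1..n}" "i \<noteq> j"
  shows "qq i j * e i = qq i j * (e j * P (transpose i j))"
proof -
  have t: "transpose i j permutes {1..n}" using assms by (intro permutes_swap_id)
  have "qq i j * e i = qq i j * (P (transpose i j) * e i)"
    using qq_P_transpose[OF assms(1,2)] by (simp add: mult.assoc[symmetric])
  then show ?thesis using e_P[OF t assms(2)] by simp
qed

text \<open>The class in \<open>k\<close> supplies a factor q, which is split as q e q. The left q
  is absorbed by \<open>Q k\<close> again, the middle factor cuts strand \<open>j\<close>, and the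
  right q passes through \<sigma> into the lower row. The index \<open>i\<close> may be 0, but
  \<open>j\<close> must be a strand.\<close>

lemma nf_add_upper:
  assumes ok: "nf_ok n k xs \<sigma> l" and i: "i \<le> n" "i \<notin> set xs" and j: "j \<in> {1..n}" "j \<notin> set xs"
    and ij: "i \<noteq> j" "sim k i j"
  shows "nf k xs \<sigma> l = nf k (j # xs) \<sigma> ((\<sigma> i, \<sigma> j) # l)"
proof -
  note ok = ok[unfolded nf_ok_def]
  have jn: "j \<le> n" using j by simp
  have k: "Q k * qq i j = Q k" using ok i jn ij by (intro Q_absorb) auto
  have "Q k = Q k * (qq i j * (e j * qq i j))"
    using k qq_e_qq[of j i] qq_sym[of i j] i jn j ij by simp
  also have "\<dots> = Q k * qq i j * e j * qq i j" by (simp add: mult.assoc)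
  finally have "Q k = Q k * e j * qq i j" using k by simp
  then have "nf k xs \<sigma> l = Q k * e j * qq i j * (E xs * (P \<sigma> * Q l))" by (simp add: nf_def)
  also have "\<dots> = Q k * e j * (qq i j * E xs) * (P \<sigma> * Q l)" by (simp add: mult.assoc)
  also have "qq i j * E xs = E xs * qq i j" using E_qq_commute[of xs i j] ok i j jn by simp
  also have "Q k * e j * (E xs * qq i j) * (P \<sigma> * Q l) = Q k * (E (j # xs) * (qq i j * P \<sigma> * Q l))"
    by (simp add: mult.assoc)
  also have "qq i j * P \<sigma> * Q l = P \<sigma> * Q ((\<sigma> i, \<sigma> j) # l)"
    using qq_P[of \<sigma> i j] ok i jn by (simp add: mult.assoc)
  finally show ?thesis by (simp only: nf_def)
qed

text \<open>The mirror image: the pair is supplied by the lower row and recorded in the upper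
  one.\<close>

lemma nf_add_lower:
  assumes ok: "nf_ok n k xs \<sigma> l" and i: "i \<le> n" "i \<notin> set xs" and j: "j \<in> {1..n}" "j \<notin> set xs"
    and ij: "i \<noteq> j" "sim l (\<sigma> i) (\<sigma> j)"
  shows "nf k xs \<sigma> l = nf ((i, j) # k) (j # xs) \<sigma> l"
proof -
  note ok = ok[unfolded nf_ok_def]
  have jn: "j \<le> n" using j by simp
  have \<sigma>n: "\<sigma> x \<le> n" if "x \<le> n" for x
    using that permutes_in_image[of \<sigma> "{1..n}" x] permutes_not_in[of \<sigma> "{1..n}" x] ok by (cases "x = 0") auto
  have "qq (\<sigma> i) (\<sigma> j) * Q l = Q l" using ok i jn ij \<sigma>n by (intro Q_absorb_left) auto
  then have l: "qq i j * (P \<sigma> * Q l) = P \<sigma> * Q l"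
    using qq_P[of \<sigma> i j] ok i jn by (simp add: mult.assoc[symmetric]) (simp add: mult.assoc)
  have "qq i j * (e j * (qq i j * (P \<sigma> * Q l))) = (qq i j * (e j * qq i j)) * (P \<sigma> * Q l)"
    by (simp add: mult.assoc)
  also have "\<dots> = qq i j * (P \<sigma> * Q l)"
    using qq_e_qq[of j i] qq_sym[of i j] i jn j ij by simp
  finally have "P \<sigma> * Q l = qq i j * (e j * (P \<sigma> * Q l))" using l by simp
  then have "nf k xs \<sigma> l = Q k * (E xs * (qq i j * (e j * (P \<sigma> * Q l))))" by (simp add: nf_def)
  also have "\<dots> = Q k * (E xs * qq i j) * (e j * (P \<sigma> * Q l))" by (simp add: mult.assoc)
  also have "E xs * qq i j = qq i j * E xs" using E_qq_commute[of xs i j] ok i j jn by simp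
  also have "Q k * (qq i j * E xs) * (e j * (P \<sigma> * Q l)) = Q k * qq i j * (E xs * e j) * (P \<sigma> * Q l)"
    by (simp add: mult.assoc)
  also have "E xs * e j = E (j # xs)" using E_e_commute[of xs j] ok j by simp
  also have "Q k * qq i j = Q ((i, j) # k)" using Q_qq_commute[of k i j] ok i jn by simp
  finally show ?thesis by (simp add: nf_def mult.assoc)
qed

text \<open>Within an upper class it does not matter which strand is cut: q absorbs the
  transposition, and moving it past the cut turns \<open>e i\<close> into \<open>e j\<close>. The
  strand that is uncut afterwards takes over the lower end of the other.\<close>

lemma nf_swap_upper:
  assumes ok: "nf_ok n k xs \<sigma> l" and i: "i \<in> set xs" and j: "j \<in> {1..n}" "j \<notin> set xs" and ij: "sim k i j"
  shows "nf k xs \<sigma> l = nf k (j # removeAll i xs) (\<sigma> \<circ> transpose i j) l"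
proof -
  note ok = ok[unfolded nf_ok_def]
  let ?t = "transpose i j"
  define ys where "ys = removeAll i xs"
  have ne: "i \<noteq> j" and iN: "i \<in> {1..n}" using i j ok by auto
  have t: "?t permutes {1..n}" using iN j by (intro permutes_swap_id)
  have k: "Q k * qq i j = Q k" using ok iN j ij by (intro Q_absorb) auto
  have "E xs = E (i # ys)" using ok i by (intro E_eqI) (auto simp: ys_def)
  then have "nf k xs \<sigma> l = Q k * qq i j * (e i * E ys * (P \<sigma> * Q l))" using k by (simp add: nf_def)
  also have "\<dots> = Q k * (qq i j * e i) * E ys * (P \<sigma> * Q l)" by (simp add: mult.assoc)
  also have "qq i j * e i = qq i j * (e j * P ?t)" by (rule qq_e_shift[OF iN j(1) ne])
  also have "Q k * (qq i j * (e j * P ?t)) * E ys * (P \<sigma> * Q l) =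
      Q k * qq i j * e j * (P ?t * E ys) * (P \<sigma> * Q l)" by (simp add: mult.assoc)
  also have "P ?t * E ys = E ys * P ?t"
    using ok iN j by (intro E_P_transpose_commute[symmetric]) (auto simp: ys_def)
  also have "Q k * qq i j = Q k" by (rule k)
  also have "Q k * e j * (E ys * P ?t) * (P \<sigma> * Q l) = Q k * (E (j # ys) * (P ?t * P \<sigma> * Q l))"
    by (simp add: mult.assoc)
  also have "P ?t * P \<sigma> = P (\<sigma> \<circ> ?t)" using P_comp[OF t] ok by simp
  finally show ?thesis by (simp only: nf_def ys_def)
qed

text \<open>Strands may exchange lower ends within a class, because q absorbs the transposition on
  the left as well.\<close>

lemma nf_swap_lower:
  assumes ok: "nf_ok n k xs \<sigma> l" and ab: "a \<in> {1..n}" "b \<in> {1..n}" "sim l a b"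
  shows "nf k xs \<sigma> l = nf k xs (transpose a b \<circ> \<sigma>) l"
proof -
  note ok = ok[unfolded nf_ok_def]
  let ?t = "transpose a b"
  have t: "?t permutes {1..n}" using ab by (intro permutes_swap_id)
  have l: "qq a b * Q l = Q l" using ok ab by (intro Q_absorb_left) auto
  \<comment> \<open>Absorption on the right, carried to the other side by the transposition itself,
    which only exchanges the two indices.\<close>
  have "P ?t * qq a b = qq a b"
    using qq_P[OF t, of b a] qq_P_transpose[of b a] ab qq_sym[of a b]
    by (simp add: transpose_commute)
  then have "P ?t * (qq a b * Q l) = qq a b * Q l" by (simp add: mult.assoc[symmetric])
  then have "P \<sigma> * Q l = P \<sigma> * (P ?t * Q l)" using l by simp
  also have "\<dots> = P (?t \<circ> \<sigma>) * Q l" using P_comp[of \<sigma> ?t] t ok by (simp add: mult.assoc)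
  finally show ?thesis by (simp only: nf_def)
qed

lemma nf_swap_dead:
  assumes ok: "nf_ok n k xs \<sigma> l" and ij: "i \<in> set xs" "j \<in> set xs"
  shows "nf k xs \<sigma> l = nf k xs (\<sigma> \<circ> transpose i j) l"
proof (cases "i = j")
  case False
  note ok = ok[unfolded nf_ok_def]
  let ?t = "transpose i j"
  have N: "i \<in> {1..n}" "j \<in> {1..n}" using ij ok by auto
  have t: "?t permutes {1..n}" using N by (intro permutes_swap_id)
  have E: "E xs = E xs * (e i * e j)" using E_absorb[of xs] ok ij by (simp add: mult.assoc[symmetric])
  have "E xs * (e i * (e j * P ?t)) = E xs * (e i * e j) * P ?t" by (simp add: mult.assoc)
  then have "E xs = E xs * P ?t" using e_e_P_transpose[OF N False] E by simp
  then have "nf k xs \<sigma> l = Q k * (E xs * P ?t * (P \<sigma> * Q l))" by (simp add: nf_def)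
  also have "\<dots> = nf k xs (\<sigma> \<circ> ?t) l" using P_comp[of ?t \<sigma>] t ok by (simp add: nf_def mult.assoc)
  finally show ?thesis .
qed simp

section \<open>Right multiplication of normal forms by letters\<close>

lemma Q_e_commute:
  assumes "pairs_upto n l" "i \<in> {1..n}" "\<And>a b. (a, b) \<in> set l \<Longrightarrow> a = i \<longleftrightarrow> b = i"
  shows "Q l * e i = e i * Q l"
  using assms(1,3)
proof (induction l)
  case (Cons p l)
  have "qq (fst p) (snd p) * e i = e i * qq (fst p) (snd p)"
    using Cons.prems(1) Cons.prems(2)[of "fst p" "snd p"] e_qq_commute[OF assms(2), of "fst p" "snd p"]
    by (cases "fst p = i") auto
  moreover have "Q l * e i = e i * Q l" using Cons by simp
  moreover have "Q (p # l) * e i = qq (fst p) (snd p) * (Q l * e i)"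
    by (simp add: mult.assoc case_prod_unfold)
  ultimately have "Q (p # l) * e i = e i * qq (fst p) (snd p) * Q l"
    by (simp add: mult.assoc[symmetric])
  then show ?case by (simp add: mult.assoc case_prod_unfold)
qed simp

lemma E_e: "set xs \<subseteq> {1..n} \<Longrightarrow> i \<in> {1..n} \<Longrightarrow> E xs * e i = E (i # xs)"
  using E_e_commute[of xs i] by simp

text \<open>The hard letter, as \<open>e i\<close> need not commute with the pairs of
  \<open>l\<close> that involve \<open>i\<close>. If a pair links \<open>i\<close> to some other
  \<open>j\<close>, all remaining mentions of \<open>i\<close> are redirected to \<open>j\<close>,
  and a single factor q stays in front of \<open>e i\<close>. Both are carried to the other side of
  \<sigma>, and the outcome depends on which of the two strands is already cut.\<close>

lemma nf_times_e:
  assumes ok: "nf_ok n k xs \<sigma> l" and i: "i \<in> {1..n}"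
  shows "\<exists>k' xs' \<sigma>' l'. nf_ok n k' xs' \<sigma>' l' \<and> nf k xs \<sigma> l * e i = nf k' xs' \<sigma>' l'"
proof -
  have k: "pairs_upto n k" and xs: "set xs \<subseteq> {1..n}" and \<sigma>: "\<sigma> permutes {1..n}" and l: "pairs_upto n l"
    using ok by (auto simp: nf_ok_def)
  define i' where "i' = inv_into UNIV \<sigma> i"
  have \<sigma>i: "\<sigma> i' = i" by (simp add: i'_def permutes_inverses[OF \<sigma>])
  have i': "i' \<in> {1..n}" using permutes_in_image[OF \<sigma>, of i'] i \<sigma>i by simp
  have eP: "P \<sigma> * e i = e i' * P \<sigma>" using e_P[OF \<sigma> i'] \<sigma>i by simp
  show ?thesis
  proof (cases "\<forall>(a, b) \<in> set l. a = i \<longleftrightarrow> b = i")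
    case True
    then have "\<And>a b. (a, b) \<in> set l \<Longrightarrow> a = i \<longleftrightarrow> b = i" by auto
    then have "Q l * e i = e i * Q l" by (rule Q_e_commute[OF l i])
    then have "nf k xs \<sigma> l * e i = Q k * (E xs * (P \<sigma> * e i * Q l))" by (simp add: nf_def mult.assoc)
    also have "\<dots> = Q k * (E xs * e i' * (P \<sigma> * Q l))" by (simp add: eP mult.assoc)
    also have "E xs * e i' = E (i' # xs)" by (rule E_e[OF xs i'])
    finally have "nf k xs \<sigma> l * e i = nf k (i' # xs) \<sigma> l" by (simp only: nf_def)
    moreover have "nf_ok n k (i' # xs) \<sigma> l" using ok i' by (simp add: nf_ok_def)
    ultimately show ?thesis by blast
  next
    case False
    then obtain j where j: "(i, j) \<in> set l \<or> (j, i) \<in> set l" "j \<noteq> i" by auto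
    then have jn: "j \<le> n" using l by (auto simp: pairs_upto_def)
    define r where "r x = (if x = i then j else x)" for x
    define l' where "l' = map (map_prod r r) l"
    have l': "pairs_upto n l'" using l jn by (auto simp: pairs_upto_def l'_def r_def)
    have "closed_under l X \<longleftrightarrow> closed_under ((i, j) # l') X" for X
    proof (cases "i \<in> X \<longleftrightarrow> j \<in> X")
      case True
      then have "r x \<in> X \<longleftrightarrow> x \<in> X" for x by (simp add: r_def)
      then show ?thesis using True by (simp add: closed_under_def l'_def case_prod_unfold)
    next
      case False
      moreover have "sim l i j" using j(1) sim_mem[of i j l] sim_sym[OF sim_mem[of j i l]] by blast
      ultimately have "\<not> closed_under l X" unfolding sim_def by blast
      then show ?thesis using False by (simp add: closed_under_def)
    qed
    then have "Q l = Q ((i, j) # l')"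
      using l l' i jn by (intro Q_eqI) (simp_all add: sim_def)
    moreover have "Q l' * e i = e i * Q l'"
    proof (rule Q_e_commute[OF l' i])
      fix a b assume "(a, b) \<in> set l'"
      then obtain x y where "a = r x" "b = r y" by (auto simp: l'_def)
      then show "a = i \<longleftrightarrow> b = i" using j(2) by (simp add: r_def)
    qed
    ultimately have Qle: "Q l * e i = qq i j * (e i * Q l')" by (simp add: mult.assoc)
    define j' where "j' = inv_into UNIV \<sigma> j"
    have \<sigma>j: "\<sigma> j' = j" by (simp add: j'_def permutes_inverses[OF \<sigma>])
    have j': "j' \<le> n"
      using permutes_in_image[OF \<sigma>, of j'] permutes_not_in[OF \<sigma>, of j'] jn \<sigma>j by (cases "j' \<in> {1..n}") auto
    have ij': "i' \<noteq> j'" using \<sigma>i \<sigma>j j(2) by auto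
    have i'n: "i' \<le> n" using i' by simp
    have "P \<sigma> * qq i j = qq i' j' * P \<sigma>" using qq_P[OF \<sigma> i'n j'] \<sigma>i \<sigma>j by simp
    then have "P \<sigma> * (Q l * e i) = qq i' j' * (P \<sigma> * e i) * Q l'"
      by (simp add: Qle mult.assoc[symmetric])
    then have eq: "nf k xs \<sigma> l * e i = Q k * (E xs * (qq i' j' * (e i' * (P \<sigma> * Q l'))))"
      by (simp add: nf_def eP mult.assoc)
    consider "i' \<in> set xs" | "i' \<notin> set xs" "j' \<in> set xs" | "i' \<notin> set xs" "j' \<notin> set xs" by blast
    then show ?thesis
    proof cases
      case 1
      \<comment> \<open>The strand ending at \<open>i\<close> is already cut, so e q e = e removes
        the pair.\<close>
      have "nf k xs \<sigma> l * e i = Q k * (E xs * (e i' * (qq i' j' * e i')) * (P \<sigma> * Q l'))"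
        using E_absorb[OF xs 1] by (simp add: eq mult.assoc[symmetric])
      also have "\<dots> = nf k xs \<sigma> l'"
        using e_qq_e[OF i' j' ij'] E_absorb[OF xs 1] by (simp add: nf_def)
      finally show ?thesis using ok l' by (auto simp: nf_ok_def)
    next
      case 2
      \<comment> \<open>The strand ending at \<open>j\<close> is cut and the one ending at
        \<open>i\<close> is not. The latter is rerouted to \<open>j\<close>, and \<open>i\<close>
        becomes the end of the cut strand.\<close>
      let ?t = "transpose i' j'"
      have j'N: "j' \<in> {1..n}" using 2 xs by auto
      have t: "?t permutes {1..n}" using i' j'N by (intro permutes_swap_id)
      have "qq i' j' * e i' = qq j' i' * (e j' * P ?t)"
        using qq_e_shift[OF i' j'N ij'] qq_sym[OF i'n j'] by simp
      then have "nf k xs \<sigma> l * e i = Q k * (E xs * (qq j' i' * (e j' * P ?t)) * (P \<sigma> * Q l'))"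
        by (simp add: eq mult.assoc[symmetric])
      also have "\<dots> = Q k * (E xs * e j' * (qq j' i' * (e j' * P ?t)) * (P \<sigma> * Q l'))"
        using E_absorb[OF xs 2(2)] by simp
      also have "\<dots> = Q k * (E xs * (e j' * (qq j' i' * e j')) * (P ?t * P \<sigma> * Q l'))"
        by (simp add: mult.assoc)
      also have "\<dots> = Q k * (E xs * (P ?t * P \<sigma> * Q l'))"
        using e_qq_e[OF j'N i'n] ij' E_absorb[OF xs 2(2)] by simp
      also have "\<dots> = nf k xs (\<sigma> \<circ> ?t) l'" using P_comp[OF t \<sigma>] by (simp add: nf_def)
      finally have "nf k xs \<sigma> l * e i = nf k xs (\<sigma> \<circ> ?t) l'" .
      moreover have "nf_ok n k xs (\<sigma> \<circ> ?t) l'"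
        using k xs l' permutes_compose[OF t \<sigma>] by (simp add: nf_ok_def)
      ultimately show ?thesis by blast
    next
      case 3
      \<comment> \<open>Neither is cut: the pair joins the upper row, and the strand ending at
        \<open>i\<close> is cut.\<close>
      have "nf k xs \<sigma> l * e i = Q k * (E xs * qq i' j' * (e i' * (P \<sigma> * Q l')))"
        by (simp add: eq mult.assoc)
      also have "E xs * qq i' j' = qq i' j' * E xs" by (rule E_qq_commute[OF xs i'n j' 3])
      also have "Q k * (qq i' j' * E xs * (e i' * (P \<sigma> * Q l'))) = Q k * qq i' j' * (E xs * e i' * (P \<sigma> * Q l'))"
        by (simp add: mult.assoc)
      also have "E xs * e i' = E (i' # xs)" by (rule E_e[OF xs i'])
      also have "Q k * qq i' j' = Q (k @ [(i', j')])" by simp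
      finally have "nf k xs \<sigma> l * e i = nf (k @ [(i', j')]) (i' # xs) \<sigma> l'" by (simp only: nf_def)
      moreover have "nf_ok n (k @ [(i', j')]) (i' # xs) \<sigma> l'"
        using k xs \<sigma> l' i' j' by (simp add: nf_ok_def)
      ultimately show ?thesis by blast
    qed
  qed
qed

text \<open>A letter q or o appends a pair to \<open>l\<close>, and s passes through the pairs of
  \<open>l\<close> by renaming them and joins \<sigma>.\<close>

lemma nf_times_letter:
  assumes ok: "nf_ok n k xs \<sigma> l" and x: "x \<in> alphabet n"
  shows "\<exists>k' xs' \<sigma>' l'. nf_ok n k' xs' \<sigma>' l' \<and> nf k xs \<sigma> l * g x = nf k' xs' \<sigma>' l'"
proof -
  have k: "pairs_upto n k" and xs: "set xs \<subseteq> {1..n}" and \<sigma>: "\<sigma> permutes {1..n}" and l: "pairs_upto n l"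
    using ok by (auto simp: nf_ok_def)
  have add_pair: ?thesis if "g x = qq i j" "i \<le> n" "j \<le> n" for i j
  proof -
    have "nf k xs \<sigma> l * g x = nf k xs \<sigma> (l @ [(i, j)])" by (simp add: nf_def that mult.assoc)
    moreover have "nf_ok n k xs \<sigma> (l @ [(i, j)])" using ok that by (simp add: nf_ok_def)
    ultimately show ?thesis by blast
  qed
  show ?thesis
  proof (cases x)
    case (Ls i)
    then have i: "i \<in> {1..<n}" using x by (auto simp: alphabet_def)
    let ?t = "transpose i (i + 1)"
    have t: "?t permutes {1..n}" using i by (intro permutes_swap_id) auto
    let ?l = "map (map_prod ?t ?t) l"
    have "Q l * s i = s i * Q ?l" using Q_P[OF l t] P_transpose[OF i] by simp
    then have "nf k xs \<sigma> l * g x = Q k * (E xs * (P \<sigma> * s i * Q ?l))" by (simp add: nf_def Ls mult.assoc)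
    also have "P \<sigma> * s i = P (?t \<circ> \<sigma>)" using P_comp[OF \<sigma> t] P_transpose[OF i] by simp
    finally have "nf k xs \<sigma> l * g x = nf k xs (?t \<circ> \<sigma>) ?l" by (simp only: nf_def)
    moreover have "?t a \<le> n" if "a \<le> n" for a using that i by (auto simp: transpose_def)
    then have "pairs_upto n ?l" using l by (auto simp: pairs_upto_def)
    then have "nf_ok n k xs (?t \<circ> \<sigma>) ?l"
      using k xs permutes_compose[OF \<sigma> t] by (simp add: nf_ok_def)
    ultimately show ?thesis by blast
  next
    case (Le i)
    then show ?thesis using nf_times_e[OF ok, of i] x by (auto simp: alphabet_def)
  next
    case (Lq i)
    then have i: "i \<in> {1..<n}" using x by (auto simp: alphabet_def)
    then have "q i = qq i (i + 1)" using qp_Suc[OF i] by (simp add: qq_def)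
    then show ?thesis using add_pair[of i "i + 1"] i Lq by simp
  next
    case (Lo i)
    then have i: "i \<in> {1..n}" using x by (auto simp: alphabet_def)
    then have "o' i = qq 0 i" by (simp add: qq_def)
    then show ?thesis using add_pair[of 0 i] i Lo by simp
  qed
qed

lemma word_eq_nf:
  assumes "set w \<subseteq> alphabet n"
  shows "\<exists>k xs \<sigma> l. nf_ok n k xs \<sigma> l \<and> ev w = nf k xs \<sigma> l"
  using assms
proof (induction w rule: rev_induct)
  case Nil
  have "nf_ok n [] [] id []" by (simp add: nf_ok_def permutes_id del: id_apply)
  moreover have "ev [] = nf [] [] id []" by (simp add: nf_def P_id)
  ultimately show ?case by blast
next
  case (snoc x w)
  then obtain k xs \<sigma> l where "nf_ok n k xs \<sigma> l" "ev w = nf k xs \<sigma> l" by auto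
  then show ?case using nf_times_letter[of k xs \<sigma> l x] snoc.prems by simp
qed

section \<open>The relation denoted by an element\<close>

definition denotes :: "'m \<Rightarrow> (nat set \<times> nat set) set \<Rightarrow> bool" where
  "denotes m r \<longleftrightarrow> (\<exists>w. set w \<subseteq> alphabet n \<and> ev w = m \<and> word_rel n w = r)"

text \<open>By soundness the denoted relation is a function of the element. It can be computed from
  any factorisation, such as the conjugates in \<open>qp_eq\<close>, without exhibiting a
  word.\<close>

lemma denotes_unique: "denotes m r \<Longrightarrow> denotes m r' \<Longrightarrow> r = r'"
  unfolding denotes_def using sound by metis

lemma word_rel_append:
  assumes "set v \<subseteq> alphabet n"
  shows "word_rel n (u @ v) = word_rel n u O word_rel n v"
proof (induction u)
  case Nil
  show ?case unfolding append_Nil word_rel_Nil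
  proof (intro equalityI subrelI)
    fix X Z assume XZ: "(X, Z) \<in> word_rel n v"
    then have "(X, X) \<in> Id_on (Pow {1..n})" using word_rel_domain[OF assms] by (intro Id_onI PowI)
    then show "(X, Z) \<in> Id_on (Pow {1..n}) O word_rel n v" using XZ by (rule relcompI)
  qed auto
next
  case (Cons x u)
  then show ?case by (simp add: word_rel_Cons O_assoc)
qed

lemma denotes_mult: "denotes a r \<Longrightarrow> denotes b t \<Longrightarrow> denotes (a * b) (r O t)"
  unfolding denotes_def
proof (elim exE conjE)
  fix u v assume "set u \<subseteq> alphabet n" "ev u = a" "word_rel n u = r" "set v \<subseteq> alphabet n" "ev v = b" "word_rel n v = t"
  then show "\<exists>w. set w \<subseteq> alphabet n \<and> ev w = a * b \<and> word_rel n w = r O t"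
    by (intro exI[of _ "u @ v"]) (simp add: word_rel_append)
qed

lemma denotes_one: "denotes 1 {(X, Y). X \<subseteq> {1..n} \<and> X = Y}"
  unfolding denotes_def by (intro exI[of _ "[]"]) auto

lemma denotes_P:
  assumes "\<sigma> permutes {1..n}"
  shows "denotes (P \<sigma>) {(X, Y). Y \<subseteq> {1..n} \<and> X = \<sigma> -` Y}"
proof -
  obtain u where u: "set u \<subseteq> {1..<n}" "perm_of u = \<sigma>"
    using assms permutes_interval_obtains_word by metis
  then have "ev (map Ls u) = P \<sigma>" using P_perm_of[OF u(1)] by (simp add: comp_def)
  moreover have "word_rel n (map Ls u) = {(X, Y). Y \<subseteq> {1..n} \<and> X = \<sigma> -` Y}"
    using word_rel_map_Ls[OF u(1)] u(2) by auto
  moreover have "set (map Ls u) \<subseteq> alphabet n" using u(1) by (auto simp: alphabet_def)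
  ultimately show ?thesis unfolding denotes_def by blast
qed

lemma denotes_letter:
  assumes "x \<in> alphabet n"
  shows "denotes (g x) (letter_rel n x)"
proof -
  have "letter_rel n x O Id_on (Pow {1..n}) = letter_rel n x"
    by (cases x) auto
  then show ?thesis unfolding denotes_def using assms
    by (intro exI[of _ "[x]"]) (simp add: word_rel_Cons del: letter_rel.simps)
qed

lemma denotes_qp:
  assumes "i \<in> {1..n}" "j \<in> {1..n}" "i \<noteq> j"
  shows "denotes (qp i j) {(X, Y). X \<subseteq> {1..n} \<and> X = Y \<and> (i \<in> X \<longleftrightarrow> j \<in> X)}"
proof -
  obtain \<sigma> where \<sigma>: "\<sigma> permutes {1..n}" "\<sigma> 1 = i" "\<sigma> 2 = j" "2 \<le> n"
    using obtain_pair[OF assms] by blast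
  have "denotes (q 1) (letter_rel n (Lq 1))" using \<sigma>(4) by (intro denotes_letter) (simp add: alphabet_def)
  then have d: "denotes (P (inv_into UNIV \<sigma>) * (q 1 * P \<sigma>))
     ({(X, Y). Y \<subseteq> {1..n} \<and> X = inv_into UNIV \<sigma> -` Y} O (letter_rel n (Lq 1) O {(X, Y). Y \<subseteq> {1..n} \<and> X = \<sigma> -` Y}))"
    (is "denotes _ ?r")
    using \<sigma>(1) by (intro denotes_mult denotes_P permutes_inv)
  have r: "?r = {(X, Y). X \<subseteq> {1..n} \<and> X = Y \<and> (i \<in> X \<longleftrightarrow> j \<in> X)}"
  proof -
    have inv: "inv_into UNIV \<sigma> -` \<sigma> -` Y = Y" for Y by (auto simp: permutes_inverses[OF \<sigma>(1)])
    have sub: "\<sigma> -` Y \<subseteq> {1..n} \<longleftrightarrow> Y \<subseteq> {1..n}" for Y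
      using permutes_in_image[OF \<sigma>(1)] permutes_inverses(1)[OF \<sigma>(1)]
      unfolding subset_iff vimage_eq by metis
    have mem: "(X, Z) \<in> ?r \<longleftrightarrow> Z \<subseteq> {1..n} \<and> X = Z \<and> (i \<in> Z \<longleftrightarrow> j \<in> Z) \<and> Z \<subseteq> {1..n}" for X Z
    proof -
      have "(X, Z) \<in> ?r \<longleftrightarrow> \<sigma> -` Z \<subseteq> {1..n} \<and> X = inv_into UNIV \<sigma> -` \<sigma> -` Z \<and>
          (1 \<in> \<sigma> -` Z \<longleftrightarrow> 1 + 1 \<in> \<sigma> -` Z) \<and> Z \<subseteq> {1..n}"
        by (simp add: relcomp_unfold) blast
      then show ?thesis unfolding inv sub using \<sigma>(2,3) by (simp add: numeral_2_eq_2)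
    qed
    show ?thesis
    proof (intro equalityI subrelI)
      fix X Z assume "(X, Z) \<in> ?r"
      then show "(X, Z) \<in> {(X, Y). X \<subseteq> {1..n} \<and> X = Y \<and> (i \<in> X \<longleftrightarrow> j \<in> X)}"
        unfolding mem by simp
    next
      fix X Z assume "(X, Z) \<in> {(X, Y). X \<subseteq> {1..n} \<and> X = Y \<and> (i \<in> X \<longleftrightarrow> j \<in> X)}"
      then show "(X, Z) \<in> ?r" unfolding mem by auto
    qed
  qed
  show ?thesis using d unfolding r qp_eq[OF \<sigma>(4,1)] \<sigma>(2,3) .
qed

lemma denotes_qq:
  assumes "i \<le> n" "j \<le> n"
  shows "denotes (qq i j) {(X, Y). X \<subseteq> {1..n} \<and> X = Y \<and> (i \<in> X \<longleftrightarrow> j \<in> X)}"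
proof -
  have o: "denotes (o' a) {(X, Y). X \<subseteq> {1..n} \<and> X = Y \<and> a \<notin> X}" if "a \<in> {1..n}" for a
  proof -
    have "letter_rel n (Lo a) = {(X, Y). X \<subseteq> {1..n} \<and> X = Y \<and> a \<notin> X}"
      by (intro equalityI subrelI) simp_all
    then show ?thesis using denotes_letter[of "Lo a"] that by (simp add: alphabet_def del: letter_rel.simps)
  qed
  have zero: "{(X, Y). X \<subseteq> {1..n} \<and> X = Y \<and> (0 \<in> X \<longleftrightarrow> a \<in> X)} = {(X, Y). X \<subseteq> {1..n} \<and> X = Y \<and> a \<notin> X}"
    (is "?L a = ?R a") for a
  proof -
    have *: "0 \<notin> X" if "X \<subseteq> {1..n}" for X using that by auto
    show ?thesis
      by (intro equalityI subrelI; simp; blast dest: *[simplified])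
  qed
  consider "i = j" | "i \<noteq> j" "i = 0" | "i \<noteq> j" "i \<noteq> 0" "j = 0" | "i \<noteq> j" "i \<noteq> 0" "j \<noteq> 0" by blast
  then show ?thesis
  proof cases
    case 1
    then show ?thesis using denotes_one by simp
  next
    case 2
    then show ?thesis using o[of j] assms zero[of j] by (simp add: qq_def)
  next
    case 3
    have "{(X, Y). X \<subseteq> {1..n} \<and> X = Y \<and> (i \<in> X \<longleftrightarrow> 0 \<in> X)} = ?L i"
      by (intro equalityI subrelI; simp; blast)
    with 3 show ?thesis using o[of i] assms zero[of i] qq_sym[of i 0] by (simp add: qq_def)
  next
    case 4
    then show ?thesis using denotes_qp[of i j] assms by (simp add: qq_def)
  qed
qed

lemma denotes_Q:
  assumes "pairs_upto n l"
  shows "denotes (Q l) {(X, Y). X \<subseteq> {1..n} \<and> X = Y \<and> closed_under l X}"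
  using assms
proof (induction l)
  case Nil
  then show ?case using denotes_one by (simp add: closed_under_def)
next
  case (Cons p l)
  obtain a b where p: "p = (a, b)" by (cases p)
  have "denotes (qq a b * Q l) ({(X, Y). X \<subseteq> {1..n} \<and> X = Y \<and> (a \<in> X \<longleftrightarrow> b \<in> X)} O
      {(X, Y). X \<subseteq> {1..n} \<and> X = Y \<and> closed_under l X})"
    using Cons p by (intro denotes_mult denotes_qq) auto
  also have "{(X, Y). X \<subseteq> {1..n} \<and> X = Y \<and> (a \<in> X \<longleftrightarrow> b \<in> X)} O
      {(X, Y). X \<subseteq> {1..n} \<and> X = Y \<and> closed_under l X} =
      {(X, Y). X \<subseteq> {1..n} \<and> X = Y \<and> closed_under (p # l) X}"
    by (auto simp: closed_under_def p)
  finally show ?case by (simp add: p)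
qed

lemma denotes_E:
  assumes "set xs \<subseteq> {1..n}"
  shows "denotes (E xs) {(X, Y). X \<subseteq> {1..n} \<and> Y \<subseteq> {1..n} \<and> X - set xs = Y - set xs}"
  using assms
proof (induction xs)
  case Nil
  have "{(X, Y). X \<subseteq> {1..n} \<and> Y \<subseteq> {1..n} \<and> X = Y} = {(X, Y). X \<subseteq> {1..n} \<and> X = Y}" by auto
  then show ?case using denotes_one by simp
next
  case (Cons x xs)
  have "denotes (e x * E xs) (letter_rel n (Le x) O
      {(X, Y). X \<subseteq> {1..n} \<and> Y \<subseteq> {1..n} \<and> X - set xs = Y - set xs})"
    using Cons by (intro denotes_mult denotes_letter) (auto simp: alphabet_def)
  also have "letter_rel n (Le x) O {(X, Y). X \<subseteq> {1..n} \<and> Y \<subseteq> {1..n} \<and> X - set xs = Y - set xs} =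
      {(X, Y). X \<subseteq> {1..n} \<and> Y \<subseteq> {1..n} \<and> X - set (x # xs) = Y - set (x # xs)}"
    (is "?L = ?R")
  proof (intro equalityI subrelI)
    fix X Y assume "(X, Y) \<in> ?L"
    then obtain Z where "X \<subseteq> {1..n}" "Y \<subseteq> {1..n}" "X - {x} = Z - {x}" "Z - set xs = Y - set xs" by auto
    then show "(X, Y) \<in> ?R" by auto
  next
    fix X Y assume XY: "(X, Y) \<in> ?R"
    \<comment> \<open>The intermediate set agrees with Y at the newly cut strand and with X
      everywhere else.\<close>
    define Z where "Z = (X - {x}) \<union> (Y \<inter> {x})"
    have "(X, Z) \<in> letter_rel n (Le x)" using XY by (auto simp: Z_def)
    moreover have "Z \<subseteq> {1..n} \<and> Y \<subseteq> {1..n} \<and> Z - set xs = Y - set xs" using XY by (auto simp: Z_def)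
    ultimately show "(X, Y) \<in> ?L" by (auto simp del: letter_rel.simps)
  qed
  finally show ?case by simp
qed

lemma denotes_nf:
  assumes "nf_ok n k xs \<sigma> l"
  shows "denotes (nf k xs \<sigma> l) (nf_rel n k xs \<sigma> l)"
proof -
  have k: "pairs_upto n k" and xs: "set xs \<subseteq> {1..n}" and \<sigma>: "\<sigma> permutes {1..n}" and l: "pairs_upto n l"
    using assms by (auto simp: nf_ok_def)
  let ?q = "\<lambda>l. {(X, Y). X \<subseteq> {1..n} \<and> X = Y \<and> closed_under l X}"
  let ?e = "{(X, Y). X \<subseteq> {1..n} \<and> Y \<subseteq> {1..n} \<and> X - set xs = Y - set xs}"
  let ?p = "{(X, Y). Y \<subseteq> {1..n} \<and> X = \<sigma> -` Y}"
  have mem: "(X, Y) \<in> ?q k O (?e O (?p O ?q l)) \<longleftrightarrow> (X, Y) \<in> nf_rel n k xs \<sigma> l" for X Y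
  proof -
    have A: "(X, Y) \<in> ?q k O (?e O (?p O ?q l)) \<longleftrightarrow> X \<subseteq> {1..n} \<and> closed_under k X \<and> \<sigma> -` Y \<subseteq> {1..n} \<and>
        X - set xs = \<sigma> -` Y - set xs \<and> Y \<subseteq> {1..n} \<and> closed_under l Y"
      by (simp add: relcomp_unfold) blast
    have sub: "\<sigma> -` Y \<subseteq> {1..n}" if "Y \<subseteq> {1..n}"
    proof
      fix i assume "i \<in> \<sigma> -` Y"
      then have "\<sigma> i \<in> {1..n}" using that by auto
      then show "i \<in> {1..n}" by (simp only: permutes_in_image[OF \<sigma>])
    qed
    have C: "X - set xs = \<sigma> -` Y - set xs \<longleftrightarrow> (\<forall>i \<in> {1..n} - set xs. i \<in> X \<longleftrightarrow> \<sigma> i \<in> Y)"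
      if "X \<subseteq> {1..n}" "Y \<subseteq> {1..n}"
    proof -
      have *: "i \<in> X \<Longrightarrow> i \<in> {1..n}" "\<sigma> i \<in> Y \<Longrightarrow> i \<in> {1..n}" for i using that sub by auto
      show ?thesis
      proof
        assume "X - set xs = \<sigma> -` Y - set xs"
        then show "\<forall>i \<in> {1..n} - set xs. i \<in> X \<longleftrightarrow> \<sigma> i \<in> Y" by blast
      next
        assume a: "\<forall>i \<in> {1..n} - set xs. i \<in> X \<longleftrightarrow> \<sigma> i \<in> Y"
        have "i \<in> X - set xs \<longleftrightarrow> i \<in> \<sigma> -` Y - set xs" for i
        proof -
          have "i \<in> {1..n} \<Longrightarrow> i \<notin> set xs \<Longrightarrow> i \<in> X \<longleftrightarrow> \<sigma> i \<in> Y" using a by blast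
          then show ?thesis using *[of i] unfolding Diff_iff vimage_eq by metis
        qed
        then show "X - set xs = \<sigma> -` Y - set xs" by (rule Set.set_eqI)
      qed
    qed
    show ?thesis
    proof (cases "X \<subseteq> {1..n} \<and> Y \<subseteq> {1..n}")
      case True
      then show ?thesis using C sub unfolding A nf_rel_def mem_Collect_eq case_prod_conv by argo
    next
      case False
      then show ?thesis unfolding A nf_rel_def mem_Collect_eq case_prod_conv by argo
    qed
  qed
  have r: "?q k O (?e O (?p O ?q l)) = nf_rel n k xs \<sigma> l"
    by (intro equalityI subrelI) (erule iffD1[OF mem] iffD2[OF mem])+
  show ?thesis unfolding nf_def r[symmetric]
    by (intro denotes_mult denotes_Q denotes_E denotes_P k xs \<sigma> l)
qed

section \<open>Reduction and comparison of normal forms\<close>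

lemma nf_reduce:
  assumes "nf_ok n k xs \<sigma> l"
  shows "\<exists>k' xs' l'. nf_reduced n k' xs' \<sigma> l' \<and> nf k xs \<sigma> l = nf k' xs' \<sigma> l'"
  using assms
\<comment> \<open>Each move cuts one more strand, so the number of uncut strands decreases.\<close>
proof (induction "card ({1..n} - set xs)" arbitrary: k xs l rule: less_induct)
  case less
  show ?case
  proof (cases "nf_reduced n k xs \<sigma> l")
    case True
    then show ?thesis by blast
  next
    case False
    then obtain i0 j0 where ij0: "i0 \<le> n" "j0 \<le> n" "i0 \<notin> set xs" "j0 \<notin> set xs" "i0 \<noteq> j0"
      "sim k i0 j0 \<or> sim l (\<sigma> i0) (\<sigma> j0)"
      using less.prems unfolding nf_reduced_def by blast
    \<comment> \<open>Two distinct indices are not both 0, and the one to be cut is chosen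
      positive.\<close>
    obtain i j where ij: "i \<le> n" "i \<notin> set xs" "j \<in> {1..n}" "j \<notin> set xs" "i \<noteq> j"
      and s: "sim k i j \<or> sim l (\<sigma> i) (\<sigma> j)"
    proof (cases "j0 = 0")
      case True
      then have "i0 \<in> {1..n}" using ij0(1,5) by simp
      moreover have "sim k j0 i0 \<or> sim l (\<sigma> j0) (\<sigma> i0)" using ij0(6) by (auto intro: sim_sym)
      ultimately show ?thesis using that[of j0 i0] ij0 by simp
    next
      case False
      then show ?thesis using that[of i0 j0] ij0 by simp
    qed
    note \<sigma> = nf_ok_permutes[OF less.prems]
    have smaller: "card ({1..n} - set (j # xs)) < card ({1..n} - set xs)"
    proof -
      have "{1..n} - set (j # xs) = ({1..n} - set xs) - {j}" by auto
      then show ?thesis using ij by (simp only:) (intro card_Diff1_less, auto)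
    qed
    show ?thesis
    proof (cases "sim k i j")
      case True
      have "nf_ok n k (j # xs) \<sigma> ((\<sigma> i, \<sigma> j) # l)"
        using less.prems ij permutes_le[OF \<sigma>] by (simp add: nf_ok_def)
      from less.hyps[OF smaller this] nf_add_upper[OF less.prems ij True]
      show ?thesis by simp
    next
      case False
      then have s: "sim l (\<sigma> i) (\<sigma> j)" using s by simp
      have "nf_ok n ((i, j) # k) (j # xs) \<sigma> l"
        using less.prems ij by (simp add: nf_ok_def)
      from less.hyps[OF smaller this] nf_add_lower[OF less.prems ij s]
      show ?thesis by simp
    qed
  qed
qed

text \<open>The ends of cut strands are put right one at a time: strand \<open>i\<close> obtains its
  prescribed end from the strand that currently holds it. That strand is cut too, because \<sigma>
  and \<sigma>' disagree there as well.\<close>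

lemma nf_dead_eq:
  assumes "nf_ok n k xs \<sigma> l" "\<sigma>' permutes {1..n}" "\<And>i. i \<in> {1..n} - set xs \<Longrightarrow> \<sigma> i = \<sigma>' i"
  shows "nf k xs \<sigma> l = nf k xs \<sigma>' l"
  using assms(1,3)
proof (induction "card {i \<in> {1..n}. \<sigma> i \<noteq> \<sigma>' i}" arbitrary: \<sigma> rule: less_induct)
  case less
  note \<sigma> = nf_ok_permutes[OF less.prems(1)]
  show ?case
  proof (cases "\<exists>i \<in> {1..n}. \<sigma> i \<noteq> \<sigma>' i")
    case False
    have "\<sigma> x = \<sigma>' x" for x
      using False permutes_not_in[OF \<sigma>, of x] permutes_not_in[OF assms(2), of x] by (cases "x \<in> {1..n}") auto
    then have "\<sigma> = \<sigma>'" by (rule ext)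
    then show ?thesis by simp
  next
    case True
    then obtain i where i: "i \<in> {1..n}" "\<sigma> i \<noteq> \<sigma>' i" by blast
    then have ixs: "i \<in> set xs" using less.prems(2) by blast
    define j where "j = inv_into UNIV \<sigma> (\<sigma>' i)"
    have \<sigma>j: "\<sigma> j = \<sigma>' i" by (simp add: j_def permutes_inverses[OF \<sigma>])
    have "\<sigma> j \<in> {1..n}" using \<sigma>j permutes_pos[OF assms(2) i(1)] by simp
    then have jN: "j \<in> {1..n}" by (simp only: permutes_in_image[OF \<sigma>])
    have \<sigma>'j: "\<sigma>' j \<noteq> \<sigma> j"
    proof
      assume "\<sigma>' j = \<sigma> j"
      then have "\<sigma>' j = \<sigma>' i" using \<sigma>j by simp
      then have "j = i" using permutes_inj[OF assms(2)] by (simp add: inj_eq)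
      then show False using \<sigma>j i(2) by simp
    qed
    then have jxs: "j \<in> set xs" using less.prems(2)[of j] jN by auto
    have t: "transpose i j permutes {1..n}" using i jN by (intro permutes_swap_id) auto
    let ?\<tau> = "\<sigma> \<circ> transpose i j"
    have "{x \<in> {1..n}. ?\<tau> x \<noteq> \<sigma>' x} \<subseteq> {x \<in> {1..n}. \<sigma> x \<noteq> \<sigma>' x} - {i}"
      using \<sigma>j \<sigma>'j i(2) by (auto simp: transpose_def)
    then have "{x \<in> {1..n}. ?\<tau> x \<noteq> \<sigma>' x} \<subset> {x \<in> {1..n}. \<sigma> x \<noteq> \<sigma>' x}" using i by blast
    then have "card {x \<in> {1..n}. ?\<tau> x \<noteq> \<sigma>' x} < card {x \<in> {1..n}. \<sigma> x \<noteq> \<sigma>' x}"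
      by (intro psubset_card_mono) simp
    moreover have "nf_ok n k xs ?\<tau> l"
      using less.prems(1) permutes_compose[OF t \<sigma>] by (simp add: nf_ok_def)
    moreover have "?\<tau> x = \<sigma>' x" if "x \<in> {1..n} - set xs" for x
      using less.prems(2)[OF that] that ixs jxs by (auto simp: transpose_def)
    ultimately have "nf k xs ?\<tau> l = nf k xs \<sigma>' l" by (rule less.hyps)
    then show ?thesis using nf_swap_dead[OF less.prems(1) ixs jxs] by simp
  qed
qed

text \<open>Transpositions inside lower classes put the ends of uncut strands right one by one, and
  ends that are right already stay untouched. The disagreements that remain concern cut strands
  only.\<close>

lemma nf_align_lower:
  assumes "nf_ok n k xs \<sigma> l" "\<sigma>' permutes {1..n}" "\<And>i. i \<in> {1..n} - set xs \<Longrightarrow> sim l (\<sigma> i) (\<sigma>' i)"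
  shows "nf k xs \<sigma> l = nf k xs \<sigma>' l"
  using assms(1,3)
proof (induction "card {i \<in> {1..n} - set xs. \<sigma> i \<noteq> \<sigma>' i}" arbitrary: \<sigma> rule: less_induct)
  case less
  note \<sigma> = nf_ok_permutes[OF less.prems(1)]
  show ?case
  proof (cases "\<exists>i \<in> {1..n} - set xs. \<sigma> i \<noteq> \<sigma>' i")
    case False
    then show ?thesis using nf_dead_eq[OF less.prems(1) assms(2)] by blast
  next
    case True
    then obtain i where i: "i \<in> {1..n} - set xs" "\<sigma> i \<noteq> \<sigma>' i" by blast
    have s: "sim l (\<sigma> i) (\<sigma>' i)" by (rule less.prems(2)[OF i(1)])
    have N: "\<sigma> i \<in> {1..n}" "\<sigma>' i \<in> {1..n}" using permutes_pos[OF \<sigma>] permutes_pos[OF assms(2)] i(1) by auto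
    let ?t = "transpose (\<sigma> i) (\<sigma>' i)"
    have t: "?t permutes {1..n}" using N by (rule permutes_swap_id)
    let ?\<tau> = "?t \<circ> \<sigma>"
    have "?\<tau> x = \<sigma>' x" if "\<sigma> x = \<sigma>' x \<or> x = i" for x
    proof (cases "x = i")
      case False
      then have "\<sigma> x \<noteq> \<sigma> i" "\<sigma>' x \<noteq> \<sigma>' i"
        using permutes_inj[OF \<sigma>] permutes_inj[OF assms(2)] by (simp_all add: inj_eq)
      then show ?thesis using that False by (simp add: transpose_def)
    qed simp
    then have "{x \<in> {1..n} - set xs. ?\<tau> x \<noteq> \<sigma>' x} \<subset> {x \<in> {1..n} - set xs. \<sigma> x \<noteq> \<sigma>' x}"
      using i by blast
    then have "card {x \<in> {1..n} - set xs. ?\<tau> x \<noteq> \<sigma>' x} < card {x \<in> {1..n} - set xs. \<sigma> x \<noteq> \<sigma>' x}"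
      by (intro psubset_card_mono) simp
    moreover have "nf_ok n k xs ?\<tau> l"
      using less.prems(1) permutes_compose[OF \<sigma> t] by (simp add: nf_ok_def)
    moreover have "sim l (?\<tau> x) (\<sigma>' x)" if "x \<in> {1..n} - set xs" for x
      using sim_trans[OF sim_transpose[OF s] less.prems(2)[OF that]] by simp
    ultimately have "nf k xs ?\<tau> l = nf k xs \<sigma>' l" by (rule less.hyps)
    then show ?thesis using nf_swap_lower[OF less.prems(1) N s] by simp
  qed
qed

text \<open>Cuts are moved within upper classes. For a strand \<open>i\<close> that only the first
  form cuts, the matching strand \<open>j\<close> is cut instead and hands its lower end to
  \<open>i\<close>. The number of such strands drops, and once it is zero the two forms cut the same
  strands.\<close>

lemma nf_align_upper:
  assumes "nf_ok n k xs \<sigma> l" "nf_ok n k xs' \<sigma>' l"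
    and "\<And>i j. i \<in> {1..n} - set xs \<Longrightarrow> j \<in> {1..n} - set xs \<Longrightarrow> sim k i j \<Longrightarrow> i = j"
    and inj': "\<And>i j. i \<in> {1..n} - set xs' \<Longrightarrow> j \<in> {1..n} - set xs' \<Longrightarrow> sim k i j \<Longrightarrow> i = j"
    and "\<And>i. i \<in> {1..n} - set xs' \<Longrightarrow> \<exists>j \<in> {1..n} - set xs. sim k j i \<and> sim l (\<sigma> j) (\<sigma>' i)"
    and "\<And>i. i \<in> {1..n} - set xs \<Longrightarrow> \<exists>j \<in> {1..n} - set xs'. sim k j i"
  shows "nf k xs \<sigma> l = nf k xs' \<sigma>' l"
  using assms(1,3,5,6)
proof (induction "card (({1..n} - set xs') \<inter> set xs)" arbitrary: xs \<sigma> rule: less_induct)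
  case less
  note inj = less.prems(2) and match = less.prems(3) and match' = less.prems(4)
  note \<sigma> = nf_ok_permutes[OF less.prems(1)]
  have xsN: "set xs \<subseteq> {1..n}" "set xs' \<subseteq> {1..n}" using less.prems(1) assms(2) by (auto simp: nf_ok_def)
  show ?case
  proof (cases "({1..n} - set xs') \<inter> set xs = {}")
    case True
    \<comment> \<open>The partner of an uncut strand is uncut in the second form, hence in both, and
      a class has only one uncut strand.\<close>
    have "{1..n} - set xs \<subseteq> {1..n} - set xs'"
    proof
      fix j assume j: "j \<in> {1..n} - set xs"
      then obtain i where i: "i \<in> {1..n} - set xs'" "sim k i j" using match' by blast
      then have "i \<in> {1..n} - set xs" using True by blast
      then show "j \<in> {1..n} - set xs'" using inj[OF _ j i(2)] i(1) by simp
    qed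
    then have eq: "set xs = set xs'" using True xsN by blast
    have "sim l (\<sigma> i) (\<sigma>' i)" if "i \<in> {1..n} - set xs" for i
      using match[of i] inj[of _ i] that unfolding eq by blast
    then have "nf k xs \<sigma> l = nf k xs \<sigma>' l"
      by (rule nf_align_lower[OF less.prems(1) nf_ok_permutes[OF assms(2)]])
    also have "\<dots> = nf k xs' \<sigma>' l" unfolding nf_def using E_eqI[OF eq xsN(1)] by simp
    finally show ?thesis .
  next
    case False
    then obtain i where i: "i \<in> {1..n} - set xs'" "i \<in> set xs" by blast
    obtain j where j: "j \<in> {1..n} - set xs" "sim k j i" "sim l (\<sigma> j) (\<sigma>' i)" using match[OF i(1)] by blast
    have ij: "i \<noteq> j" using i j by blast
    \<comment> \<open>In the second form \<open>i\<close> is the only uncut strand of its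
      class.\<close>
    have j': "j \<in> set xs'" using inj'[OF i(1), of j] sim_sym[OF j(2)] j(1) ij by blast
    let ?ys = "j # removeAll i xs" and ?\<tau> = "\<sigma> \<circ> transpose i j"
    have t: "transpose i j permutes {1..n}" using i j by (intro permutes_swap_id) auto
    have ys: "x \<in> {1..n} - set ?ys \<longleftrightarrow> x = i \<or> x \<in> {1..n} - set xs \<and> x \<noteq> j" for x
      using i(1) ij by auto
    have \<tau>: "?\<tau> i = \<sigma> j" "x \<noteq> i \<Longrightarrow> x \<noteq> j \<Longrightarrow> ?\<tau> x = \<sigma> x" for x by (simp_all add: transpose_def)
    have "({1..n} - set xs') \<inter> set ?ys = ({1..n} - set xs') \<inter> set xs - {i}"
      using j' by auto
    then have "card (({1..n} - set xs') \<inter> set ?ys) < card (({1..n} - set xs') \<inter> set xs)"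
      using i by (simp only:) (intro card_Diff1_less, auto)
    moreover have "nf_ok n k ?ys ?\<tau> l"
      using less.prems(1) permutes_compose[OF t \<sigma>] j(1) by (auto simp: nf_ok_def)
    moreover have "a = b" if ab: "a \<in> {1..n} - set ?ys" "b \<in> {1..n} - set ?ys" "sim k a b" for a b
    proof -
      have aux: False if "x \<in> {1..n} - set xs" "x \<noteq> j" "sim k x i" for x
        using inj[OF that(1) j(1)] sim_trans[OF that(3) sim_sym[OF j(2)]] that(2) by blast
      show ?thesis
        using ab aux[of a] aux[of b] inj[of a b] sim_sym[OF ab(3)] unfolding ys by metis
    qed
    moreover have "\<exists>b \<in> {1..n} - set ?ys. sim k b a \<and> sim l (?\<tau> b) (\<sigma>' a)" if a: "a \<in> {1..n} - set xs'" for a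
    proof (cases "a = i")
      case True
      have "i \<in> {1..n} - set ?ys" using ys[of i] by blast
      moreover have "sim l (?\<tau> i) (\<sigma>' i)" using j(3) \<tau>(1) by simp
      ultimately show ?thesis using True sim_refl by blast
    next
      case False
      obtain b where b: "b \<in> {1..n} - set xs" "sim k b a" "sim l (\<sigma> b) (\<sigma>' a)" using match[OF a] by blast
      have "b \<noteq> j"
      proof
        assume "b = j"
        then have "sim k i a" using sim_trans[OF sim_sym[OF j(2)]] b(2) by blast
        then show False using inj'[OF i(1) a] False by blast
      qed
      moreover have "b \<noteq> i" using b(1) i(2) by blast
      ultimately have "b \<in> {1..n} - set ?ys" "sim l (?\<tau> b) (\<sigma>' a)" using ys[of b] \<tau>(2)[of b] b by auto
      then show ?thesis using b(2) by blast
    qed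
    moreover have "\<exists>b \<in> {1..n} - set xs'. sim k b a" if a: "a \<in> {1..n} - set ?ys" for a
    proof (cases "a = i")
      case True
      then show ?thesis using i(1) sim_refl by blast
    next
      case False
      then have "a \<in> {1..n} - set xs" using a ys[of a] by blast
      then show ?thesis by (rule match')
    qed
    ultimately have "nf k ?ys ?\<tau> l = nf k xs' \<sigma>' l" by (rule less.hyps)
    moreover have "nf k xs \<sigma> l = nf k ?ys ?\<tau> l"
      using nf_swap_upper[OF less.prems(1) i(2)] j(1) sim_sym[OF j(2)] by blast
    ultimately show ?thesis by simp
  qed
qed

text \<open>Equal relations have equal classes, so the outer products agree. It remains to align the
  cuts and the permutation, for which \<open>nf_rel_match\<close> provides the partners.\<close>

lemma nf_eq_if_nf_rel_eq:
  assumes red: "nf_reduced n k xs \<sigma> l" "nf_reduced n k' xs' \<sigma>' l'"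
    and eq: "nf_rel n k xs \<sigma> l = nf_rel n k' xs' \<sigma>' l'"
  shows "nf k xs \<sigma> l = nf k' xs' \<sigma>' l'"
proof -
  have ok: "nf_ok n k xs \<sigma> l" "nf_ok n k' xs' \<sigma>' l'" using red by (auto simp: nf_reduced_def)
  have p: "pairs_upto n k" "pairs_upto n l" "pairs_upto n k'" "pairs_upto n l'"
    using ok by (auto simp: nf_ok_def)
  note sim_eq = nf_rel_sim_eq[OF red eq] nf_rel_sim_eq[OF red(2,1) eq[symmetric]]
  have "Q k = Q k'" using sim_eq by (intro Q_eqI[OF p(1,3)]) blast
  moreover have "Q l = Q l'" using sim_eq by (intro Q_eqI[OF p(2,4)]) blast
  ultimately have "nf k' xs' \<sigma>' l' = nf k xs' \<sigma>' l" by (simp add: nf_def)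
  moreover have "nf k xs \<sigma> l = nf k xs' \<sigma>' l"
  proof (rule nf_align_upper[OF ok(1)])
    show "nf_ok n k xs' \<sigma>' l" using ok by (simp add: nf_ok_def)
  next
    fix i j assume "i \<in> {1..n} - set xs" "j \<in> {1..n} - set xs" "sim k i j"
    then show "i = j" using nf_reduced_upper[OF red(1), of i j] by simp
  next
    fix i j assume "i \<in> {1..n} - set xs'" "j \<in> {1..n} - set xs'" "sim k i j"
    then show "i = j" using nf_reduced_upper[OF red(2), of i j] sim_eq(1)[of i j] by simp
  next
    fix i assume "i \<in> {1..n} - set xs'"
    then show "\<exists>j \<in> {1..n} - set xs. sim k j i \<and> sim l (\<sigma> j) (\<sigma>' i)" by (rule nf_rel_match[OF red eq])
  next
    fix i assume i: "i \<in> {1..n} - set xs"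
    obtain j where j: "j \<in> {1..n} - set xs'" "sim k' j i"
      using nf_rel_match[OF red(2,1) eq[symmetric] i] by blast
    then have "sim k j i" using sim_eq(3)[of j i] i by simp
    then show "\<exists>j \<in> {1..n} - set xs'. sim k j i" using j(1) by blast
  qed
  ultimately show ?thesis by simp
qed

lemma ev_eq_if_word_rel_eq:
  assumes "set u \<subseteq> alphabet n" "set v \<subseteq> alphabet n" "word_rel n u = word_rel n v"
  shows "ev u = ev v"
proof -
  have ex: "\<exists>k xs \<sigma> l. nf_reduced n k xs \<sigma> l \<and> ev w = nf k xs \<sigma> l \<and> word_rel n w = nf_rel n k xs \<sigma> l"
    if w: "set w \<subseteq> alphabet n" for w
  proof -
    obtain k xs \<sigma> l where "nf_ok n k xs \<sigma> l" "ev w = nf k xs \<sigma> l" using word_eq_nf[OF w] by blast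
    then obtain k' xs' l' where nf: "nf_reduced n k' xs' \<sigma> l'" "ev w = nf k' xs' \<sigma> l'"
      using nf_reduce by metis
    have "denotes (ev w) (word_rel n w)" using w by (auto simp: denotes_def)
    moreover have "denotes (ev w) (nf_rel n k' xs' \<sigma> l')"
      unfolding nf(2) using nf(1) by (intro denotes_nf) (simp add: nf_reduced_def)
    ultimately show ?thesis using nf denotes_unique by blast
  qed
  obtain k xs \<sigma> l where u: "nf_reduced n k xs \<sigma> l" "ev u = nf k xs \<sigma> l" "word_rel n u = nf_rel n k xs \<sigma> l"
    using ex[OF assms(1)] by blast
  obtain k' xs' \<sigma>' l' where v: "nf_reduced n k' xs' \<sigma>' l'" "ev v = nf k' xs' \<sigma>' l'" "word_rel n v = nf_rel n k' xs' \<sigma>' l'"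
    using ex[OF assms(2)] by blast
  show ?thesis using nf_eq_if_nf_rel_eq[OF u(1) v(1)] u v assms(3) by simp
qed

end

section \<open>The presentation\<close>

text \<open>The congruence depends on \<open>n\<close>, whereas the locale asks for a type with a
  multiplication. Endomaps of sets of words form such a type, and the free monoid modulo the
  congruence embeds into it by its left action on classes.\<close>

datatype 'a endo = Endo (apply_endo: "'a \<Rightarrow> 'a")

instantiation endo :: (type) monoid_mult
begin

definition one_endo :: "'a endo" where "1 = Endo id"
definition times_endo :: "'a endo \<Rightarrow> 'a endo \<Rightarrow> 'a endo" where
  "f * h = Endo (apply_endo f \<circ> apply_endo h)"

instance
  by standard (simp_all add: one_endo_def times_endo_def comp_assoc)

end

text \<open>Sets that are not congruence classes are fixed, so that the empty word acts as the identity
  on all sets.\<close>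

definition class_action :: "'a list set \<Rightarrow> ('a list \<times> 'a list) set \<Rightarrow> 'a \<Rightarrow> 'a list set endo" where
  "class_action L C x = Endo (\<lambda>A. if A \<in> L // C then C `` ((#) x ` A) else A)"

lemma monoid_congruence_freeD:
  assumes "monoid_congruence (free_monoid X) C"
  shows "equiv (lists X) C" "(a, b) \<in> C \<Longrightarrow> (c, d) \<in> C \<Longrightarrow> (a @ c, b @ d) \<in> C"
  using assms by (auto simp: monoid_congruence_def free_monoid_def)

lemma class_action_word:
  assumes C: "monoid_congruence (free_monoid X) C" and w: "set w \<subseteq> X"
  shows "a \<in> lists X \<Longrightarrow>
      apply_endo (prod_list (map (class_action (lists X) C) w)) (C `` {a}) = C `` {w @ a}"
    and "A \<notin> lists X // C \<Longrightarrow> apply_endo (prod_list (map (class_action (lists X) C) w)) A = A"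
proof -
  note eq = monoid_congruence_freeD(1)[OF C]
  have step: "C `` ((#) x ` (C `` {b})) = C `` {x # b}" if "x \<in> X" "b \<in> lists X" for x b
  proof (intro equalityI subsetI)
    fix z assume "z \<in> C `` ((#) x ` (C `` {b}))"
    then obtain c where c: "(b, c) \<in> C" "(x # c, z) \<in> C" by auto
    have "([x], [x]) \<in> C" using that(1) eq by (auto simp: equiv_def refl_on_def)
    then have "(x # b, x # c) \<in> C" using monoid_congruence_freeD(2)[OF C _ c(1), of "[x]" "[x]"] by simp
    moreover have "trans C" using eq by (simp add: equiv_def)
    ultimately show "z \<in> C `` {x # b}" using c(2) by (auto dest: transD)
  next
    fix z assume "z \<in> C `` {x # b}"
    moreover have "(b, b) \<in> C" using that(2) eq by (auto simp: equiv_def refl_on_def)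
    ultimately show "z \<in> C `` ((#) x ` (C `` {b}))" by auto
  qed
  show "apply_endo (prod_list (map (class_action (lists X) C) w)) (C `` {a}) = C `` {w @ a}"
    if "a \<in> lists X"
    using w
  proof (induction w)
    case Nil
    then show ?case by (simp add: one_endo_def)
  next
    case (Cons x w)
    then have "w @ a \<in> lists X" using that by auto
    then show ?case using Cons step[of x "w @ a"]
      by (simp add: times_endo_def class_action_def quotientI)
  qed
  show "apply_endo (prod_list (map (class_action (lists X) C) w)) A = A" if "A \<notin> lists X // C"
    using that by (induction w) (simp_all add: one_endo_def times_endo_def class_action_def)
qed

text \<open>The action is faithful because it sends the class of the empty word to the class of the
  acting word.\<close>

lemma class_action_eq_iff:
  assumes C: "monoid_congruence (free_monoid X) C" and u: "set u \<subseteq> X" and v: "set v \<subseteq> X"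
  shows "prod_list (map (class_action (lists X) C) u) = prod_list (map (class_action (lists X) C) v) \<longleftrightarrow>
    (u, v) \<in> C" (is "?f = ?h \<longleftrightarrow> _")
proof
  note eq = monoid_congruence_freeD(1)[OF C]
  assume "?f = ?h"
  then have "C `` {u @ []} = C `` {v @ []}"
    using class_action_word(1)[OF C u, of "[]"] class_action_word(1)[OF C v, of "[]"] by simp
  then show "(u, v) \<in> C" using eq_equiv_class_iff[OF eq, of u v] u v by (simp add: in_lists_conv_set subset_iff)
next
  note eq = monoid_congruence_freeD(1)[OF C]
  assume uv: "(u, v) \<in> C"
  have "apply_endo ?f A = apply_endo ?h A" for A
  proof (cases "A \<in> lists X // C")
    case True
    then obtain a where a: "a \<in> lists X" "A = C `` {a}" unfolding quotient_def by blast
    then have "(a, a) \<in> C" using eq by (auto simp: equiv_def refl_on_def)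
    then have "(u @ a, v @ a) \<in> C" using monoid_congruence_freeD(2)[OF C uv] by blast
    then show ?thesis using class_action_word(1)[OF C u a(1)] class_action_word(1)[OF C v a(1)]
      equiv_class_eq[OF eq] a(2) by simp
  next
    case False
    then show ?thesis using class_action_word(2)[OF C u] class_action_word(2)[OF C v] by simp
  qed
  then have "apply_endo ?f = apply_endo ?h" by (rule ext)
  then show "?f = ?h" by (rule endo.expand)
qed

section \<open>Kernels and generated congruences\<close>

lemma monoid_congruence_kernel:
  assumes "\<And>u v. u \<in> lists X \<Longrightarrow> v \<in> lists X \<Longrightarrow> f (u @ v) = m (f u) (f v)"
  shows "monoid_congruence (free_monoid X) {(u, v). u \<in> lists X \<and> v \<in> lists X \<and> f u = f v}"
  using assms by (auto simp: monoid_congruence_def free_monoid_def equiv_def refl_on_def sym_def trans_def)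

lemma monoid_congruence_hull:
  assumes "monoid_congruence (free_monoid X) K" "R \<subseteq> K"
  shows "monoid_congruence (free_monoid X) (monoid_congruence (free_monoid X) hull R)"
proof -
  define F where "F = {C. monoid_congruence (free_monoid X) C \<and> R \<subseteq> C}"
  have "K \<in> F" using assms by (simp add: F_def)
  have eq: "equiv (lists X) C" and mult: "\<And>a b c d. (a, b) \<in> C \<Longrightarrow> (c, d) \<in> C \<Longrightarrow> (a @ c, b @ d) \<in> C"
    if "C \<in> F" for C
    using that monoid_congruence_freeD unfolding F_def by blast+
  have "equiv (lists X) (\<Inter>F)"
  proof (rule equivI)
    show "\<Inter>F \<subseteq> lists X \<times> lists X" using eq[OF \<open>K \<in> F\<close>] \<open>K \<in> F\<close> unfolding equiv_def by blast
    show "refl_on (lists X) (\<Inter>F)" using eq unfolding equiv_def refl_on_def by blast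
    show "sym (\<Inter>F)" using eq unfolding equiv_def sym_def by blast
    show "trans (\<Inter>F)" using eq unfolding equiv_def trans_def by blast
  qed
  moreover have "(a @ c, b @ d) \<in> \<Inter>F" if "(a, b) \<in> \<Inter>F" "(c, d) \<in> \<Inter>F" for a b c d
    using that mult by blast
  ultimately have "monoid_congruence (free_monoid X) (\<Inter>F)"
    by (auto simp: monoid_congruence_def free_monoid_def)
  then show ?thesis by (simp add: F_def hull_def)
qed

theorem theorem4p7:
  fixes n :: nat
  shows "monoid_presentation (rook_partition_monoid n) (alphabet n) (relations n) (Psi n)"
proof -
  let ?X = "alphabet n"
  define K where "K = {(u, v). u \<in> lists ?X \<and> v \<in> lists ?X \<and> Psi n u = Psi n v}"
  define C where "C = monoid_congruence (free_monoid ?X) hull relations n"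
  have sets: "w \<in> lists ?X \<longleftrightarrow> set w \<subseteq> ?X" for w by auto
  have K: "monoid_congruence (free_monoid ?X) K"
    unfolding K_def by (rule monoid_congruence_kernel[where m = "rook_product n"]) (simp add: Psi_append sets)
  have RX: "relations n \<subseteq> lists ?X \<times> lists ?X" by (auto simp: relations_def)
  have RK: "relations n \<subseteq> K"
  proof (rule subrelI)
    fix u v assume uv: "(u, v) \<in> relations n"
    then have "u \<in> lists ?X" "v \<in> lists ?X" using RX by auto
    then show "(u, v) \<in> K"
      using word_rel_eq_if_relations[OF uv] Psi_eq_iff_word_rel_eq unfolding K_def sets by blast
  qed
  have CK: "C \<subseteq> K" unfolding C_def using RK K by (rule hull_minimal)
  have RC: "relations n \<subseteq> C" unfolding C_def by (rule hull_subset)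
  have C: "monoid_congruence (free_monoid ?X) C" unfolding C_def by (rule monoid_congruence_hull[OF K RK])
  \<comment> \<open>Words with equal actions are related by \<open>C\<close>, hence have equal
    images under \<open>Psi\<close>, so the quotient determines \<open>word_rel\<close>.\<close>
  interpret rook_model n "class_action (lists ?X) C"
  proof
    fix u v assume uv: "(u, v) \<in> relations n"
    then have "set u \<subseteq> ?X" "set v \<subseteq> ?X" using RX sets by blast+
    then show "prod_list (map (class_action (lists ?X) C) u) = prod_list (map (class_action (lists ?X) C) v)"
      using class_action_eq_iff[OF C] RC uv by blast
  next
    fix u v assume uv: "set u \<subseteq> ?X" "set v \<subseteq> ?X"
      "prod_list (map (class_action (lists ?X) C) u) = prod_list (map (class_action (lists ?X) C) v)"
    then have "(u, v) \<in> K" using class_action_eq_iff[OF C] CK by blast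
    then show "word_rel n u = word_rel n v" using Psi_eq_iff_word_rel_eq[OF uv(1,2)] by (simp add: K_def)
  qed
  have "K \<subseteq> C"
  proof (rule subrelI)
    fix u v assume "(u, v) \<in> K"
    then have uv: "set u \<subseteq> ?X" "set v \<subseteq> ?X" and "Psi n u = Psi n v" by (auto simp: K_def)
    then have "word_rel n u = word_rel n v" using Psi_eq_iff_word_rel_eq by simp
    then show "(u, v) \<in> C" using ev_eq_if_word_rel_eq[OF uv] class_action_eq_iff[OF C uv] by blast
  qed
  moreover have "Psi n ` lists ?X = rook_partitions n"
  proof
    show "Psi n ` lists ?X \<subseteq> rook_partitions n" using Psi_in_rook_partitions by blast
    show "rook_partitions n \<subseteq> Psi n ` lists ?X"
    proof
      fix \<alpha> assume \<alpha>: "\<alpha> \<in> rook_partitions n"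
      obtain k xs \<sigma> l where nf: "nf_ok n k xs \<sigma> l" "nf_rel n k xs \<sigma> l = diag_rel \<alpha>"
        using diag_rel_eq_nf_rel[OF \<alpha>] by blast
      \<comment> \<open>Surjectivity: the normal form with the relation of \<alpha> is the value of
        a word, and a rook partition is determined by its relation.\<close>
      obtain w where w: "set w \<subseteq> ?X" "word_rel n w = diag_rel \<alpha>"
        using denotes_nf[OF nf(1)] nf(2) unfolding denotes_def by auto
      then have "Psi n w = \<alpha>" using diag_rel_Psi \<alpha> Psi_in_rook_partitions diag_rel_inject by metis
      then show "\<alpha> \<in> Psi n ` lists ?X" using w(1) sets by blast
    qed
  qed
  ultimately show ?thesis
    using monoid_rook_partition_monoid RX CK Psi_in_rook_partitions
    unfolding monoid_presentation_def C_def[symmetric] K_def[symmetric]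
    by (auto simp: free_monoid_def rook_partition_monoid_def hom_def Psi_append Psi_Nil sets K_def)
qed

end
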